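(* Let $N\in\mathbb N$ and fix a vertex $\varkappa$ of $H(N,2)$, with subconstituent algebra $T=T(\varkappa)$. The vector space $T$ becomes an $\mathfrak{sl}_4(\mathbb C)$-module on which $$A_i=\mathcal A^{(i)},\qquad A_i^*=\mathcal A^{*(i)}\qquad\qquad i\in\{1,2,3\}.$$ Moreover, the restriction $\varepsilon|_{{\rm Fix}(G)}:{\rm Fix}(G)\to T$ is an isomorphism of $\mathfrak{sl}_4(\mathbb C)$-modules.
   Context: $\mathbb N=\{0,1,2,\ldots\}$; all vector spaces are over $\mathbb C$. Lie algebra: with $E_{a,b}$ the $4\times4$ matrix units, define in $\mathfrak{sl}_4(\mathbb C)$: $A_1=E_{12}+E_{21}+E_{34}+E_{43}$, $A_2=E_{13}+E_{31}+E_{24}+E_{42}$, $A_3=E_{14}+E_{41}+E_{23}+E_{32}$, $A_1^*={\rm diag}(1,1,-1,-1)$, $A_2^*={\rm diag}(1,-1,1,-1)$, $A_3^*={\rm diag}(1,-1,-1,1)$. These six elements generate $\mathfrak{sl}_4(\mathbb C)$. Hypercube: $H(N,2)$ is the graph with vertex set $X=\{1,-1\}^N$, two vertices adjacent when they differ in exactly one coordinate; $\partial$ is path-length distance; $\Gamma_i(x)=\{y\in X:\partial(x,y)=i\}$, $\Gamma(x)=\Gamma_1(x)$. $V$ is the vector space with basis $X$, with the Hermitian form (linear in the first argument) for which $X$ is orthonormal. $V^{\otimes3}$ has basis $X^{\otimes 3}=\{x\otimes y\otimes z:x,y,z\in X\}$. $G$ is the automorphism group of the graph, acting linearly on $V$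 by permuting $X$ and diagonally on $V^{\otimes 3}$; ${\rm Fix}(G)=\{v\in V^{\otimes3}:g(v)=v\ \forall g\in G\}$. Put $\theta_i=\theta_i^*=N-2i$ $(0\le i\le N)$. ${\rm Fix}(G)$ is an $\mathfrak{sl}_4(\mathbb C)$-module on which $A_i,A_i^*$ act as the maps $A^{(i)},A^{*(i)}$ given on $X^{\otimes3}$ by $A^{(1)}(x\otimes y\otimes z)=\sum_{\xi\in\Gamma(x)}\xi\otimes y\otimes z$, $A^{(2)}(x\otimes y\otimes z)=\sum_{\xi\in\Gamma(y)}x\otimes\xi\otimes z$, $A^{(3)}(x\otimes y\otimes z)=\sum_{\xi\in\Gamma(z)}x\otimes y\otimes\xi$, and $A^{*(1)},A^{*(2)},A^{*(3)}$ multiply $x\otimes y\otimes z$ by $\theta^*_{\partial(y,z)}$, $\theta^*_{\partial(z,x)}$, $\theta^*_{\partial(x,y)}$ respectively. Subconstituent algebra: ${\sf A}_h\in{\rm End}(V)$ is given by ${\sf A}_hx=\sum_{\xi\in\Gamma_h(x)}\xi$ for $x\in X$, and ${\sf A}={\sf A}_1$ is the adjacency map; if $N=0$ then ${\sf A}=0$. ${\sf A}$ is diagonalizable with eigenvalues $\theta_i$ $(0\le i\le N)$; ${\sf E}_i$ is the primitive idempotent (projection onto the $\theta_i$-eigenspace along the other eigenspaces). For $x\in X$: ${\sf A}^*x=\theta^*_{\partial(x,\varkappa)}x$; ${\sf E}_i^*x=x$ if $\partial(x,\varkappa)=i$ and ${\sf E}^*_ix=0$ otherwise; ${\sf A}^*_hx=2^N\langle{\sf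 E}_h\varkappa,x\rangle x$. $T=T(\varkappa)$ is the subalgebra of ${\rm End}(V)$ generated by ${\sf A},{\sf A}^*$. $\mathcal P''_N$ is the set of integer triples $(h,i,j)$ with $0\le h,i,j\le N$, $h+i+j$ even, $h+i+j\le 2N$, $h\le i+j$, $i\le j+h$, $j\le h+i$. The elements ${\sf E}_i{\sf A}_h^*{\sf E}_j$ with $(h,i,j)\in\mathcal P''_N$ form a basis of $T$, and so do the elements ${\sf E}_i^*{\sf A}_h{\sf E}_j^*$ with $(h,i,j)\in\mathcal P''_N$. The maps $\mathcal A^{(k)},\mathcal A^{*(k)}\in{\rm End}(T)$ are defined by: $\mathcal A^{(1)},\mathcal A^{(2)},\mathcal A^{(3)}$ multiply ${\sf E}_i{\sf A}_h^*{\sf E}_j$ by $\theta_h,\theta_i,\theta_j$ respectively, and $\mathcal A^{*(1)},\mathcal A^{*(2)},\mathcal A^{*(3)}$ multiply ${\sf E}^*_i{\sf A}_h{\sf E}^*_j$ by $\theta^*_h,\theta^*_j,\theta^*_i$ respectively, for all $(h,i,j)\in\mathcal P''_N$. For $x,y\in X$, $e_{x,y}\in{\rm End}(V)$ sends $y\mapsto x$ and all other vertices to $0$. The linear map $\varepsilon:V^{\otimes 3}\to{\rm End}(V)$ is given by $\varepsilon(x\otimes y\otimes z)=2^{N/2}e_{y,z}$ if $x=\varkappa$ and $0$ if $x\ne\varkappa$ $(x,y,z\in X)$. *)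

theory Defs
  imports "HOL-Analysis.Analysis" "HOL-Library.Function_Algebras"
    "HOL-Combinatorics.Permutations"
begin

section \<open>Linear algebra on explicit carriers\<close>

text \<open>
  The dimension \<open>2 ^ N\<close> varies with \<open>N\<close> and \<open>N = 0\<close> is allowed, so complex vector spaces
  are carriers \<open>W\<close> inside an additive group type, together with a scalar multiplication \<open>s\<close>
  (\<open>smul\<close> for vectors, \<open>emul\<close> for linear maps between vectors).  Addition is pointwise,
  as in the theory Function_Algebras.
\<close>

definition smul :: "complex \<Rightarrow> ('a \<Rightarrow> complex) \<Rightarrow> ('a \<Rightarrow> complex)" where
  "smul c v = (\<lambda>a. c * v a)"

definition emul :: "complex \<Rightarrow> ('b \<Rightarrow> ('a \<Rightarrow> complex)) \<Rightarrow> ('b \<Rightarrow> ('a \<Rightarrow> complex))" where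
  "emul c F = (\<lambda>v. smul c (F v))"

definition linear_on ::
  "(complex \<Rightarrow> 'a \<Rightarrow> 'a) \<Rightarrow> (complex \<Rightarrow> 'b \<Rightarrow> 'b) \<Rightarrow> 'a::ab_group_add set \<Rightarrow> 'b::ab_group_add set
    \<Rightarrow> ('a \<Rightarrow> 'b) \<Rightarrow> bool" where
  "linear_on s s' U W F \<longleftrightarrow>
     (\<forall>u\<in>U. F u \<in> W) \<and>
     (\<forall>u\<in>U. \<forall>v\<in>U. F (u + v) = F u + F v) \<and>
     (\<forall>c. \<forall>u\<in>U. F (s c u) = s' c (F u))"

text \<open>Endomorphisms of \<open>W\<close> are extended by \<open>0\<close> outside \<open>W\<close>, so that equality of functions is
  equality of linear maps; this is preserved by sums, scalar multiples and composition.\<close>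

definition Endo :: "(complex \<Rightarrow> 'a \<Rightarrow> 'a) \<Rightarrow> 'a::ab_group_add set \<Rightarrow> ('a \<Rightarrow> 'a) set" where
  "Endo s W = {F. linear_on s s W W F \<and> (\<forall>v. v \<notin> W \<longrightarrow> F v = 0)}"

definition id_endo :: "'a::ab_group_add set \<Rightarrow> 'a \<Rightarrow> 'a" where
  "id_endo W v = (if v \<in> W then v else 0)"

text \<open>The vector space with basis \<open>S\<close>, its basis vectors, and the linear map on it that
  is given by prescribed images of the basis vectors.\<close>

definition free_space :: "'a set \<Rightarrow> ('a \<Rightarrow> complex) set" where
  "free_space S = {v. \<forall>a. a \<notin> S \<longrightarrow> v a = 0}"

definition basis_vec :: "'a \<Rightarrow> ('a \<Rightarrow> complex)" where
  "basis_vec a = (\<lambda>b. if b = a then 1 else 0)"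

definition lin_ext ::
  "(complex \<Rightarrow> 'w \<Rightarrow> 'w) \<Rightarrow> 'a set \<Rightarrow> ('a \<Rightarrow> 'w::ab_group_add) \<Rightarrow> ('a \<Rightarrow> complex) \<Rightarrow> 'w" where
  "lin_ext s S g v = (if v \<in> free_space S then \<Sum>a\<in>S. s (v a) (g a) else 0)"

text \<open>Selection of the entry with index \<open>k \<in> {1, 2, 3}\<close>.\<close>

definition sel :: "nat \<Rightarrow> 'a \<Rightarrow> 'a \<Rightarrow> 'a \<Rightarrow> 'a" where
  "sel k a b c = (if k = 1 then a else if k = 2 then b else c)"


section \<open>The Lie algebra and its modules\<close>

text \<open>In the index type \<open>4\<close> the four elements are \<open>1, 2, 3\<close> and \<open>4 = 0\<close>.\<close>

type_synonym mat4 = "complex ^ 4 ^ 4"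

definition sl4 :: "mat4 set" where
  "sl4 = {M. trace M = 0}"

definition mscale :: "complex \<Rightarrow> mat4 \<Rightarrow> mat4" where
  "mscale c M = (\<chi> i j. c * M $ i $ j)"

definition bracket :: "mat4 \<Rightarrow> mat4 \<Rightarrow> mat4" where
  "bracket M M' = M ** M' - M' ** M"

definition munit :: "4 \<Rightarrow> 4 \<Rightarrow> mat4" where
  "munit a b = (\<chi> i j. if i = a \<and> j = b then 1 else 0)"

definition mdiag :: "complex \<Rightarrow> complex \<Rightarrow> complex \<Rightarrow> complex \<Rightarrow> mat4" where
  "mdiag a b c d =
     mscale a (munit 1 1) + mscale b (munit 2 2) + mscale c (munit 3 3) + mscale d (munit 4 4)"

definition gen :: "nat \<Rightarrow> mat4" where
  "gen k = sel k
     (munit 1 2 + munit 2 1 + munit 3 4 + munit 4 3)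
     (munit 1 3 + munit 3 1 + munit 2 4 + munit 4 2)
     (munit 1 4 + munit 4 1 + munit 2 3 + munit 3 2)"

definition gen_star :: "nat \<Rightarrow> mat4" where
  "gen_star k = sel k (mdiag 1 1 (-1) (-1)) (mdiag 1 (-1) 1 (-1)) (mdiag 1 (-1) (-1) 1)"

definition sl4_module ::
  "(complex \<Rightarrow> 'w \<Rightarrow> 'w) \<Rightarrow> 'w::ab_group_add set \<Rightarrow> (mat4 \<Rightarrow> 'w \<Rightarrow> 'w) \<Rightarrow> bool" where
  "sl4_module s W \<rho> \<longleftrightarrow>
     vector_space s \<and> module.subspace s W \<and>
     (\<forall>M\<in>sl4. linear_on s s W W (\<rho> M)) \<and>
     (\<forall>M\<in>sl4. \<forall>M'\<in>sl4. \<forall>w\<in>W. \<rho> (M + M') w = \<rho> M w + \<rho> M' w) \<and>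
     (\<forall>c. \<forall>M\<in>sl4. \<forall>w\<in>W. \<rho> (mscale c M) w = s c (\<rho> M w)) \<and>
     (\<forall>M\<in>sl4. \<forall>M'\<in>sl4. \<forall>w\<in>W. \<rho> (bracket M M') w = \<rho> M (\<rho> M' w) - \<rho> M' (\<rho> M w))"

definition sl4_module_on_which ::
  "(complex \<Rightarrow> 'w \<Rightarrow> 'w) \<Rightarrow> 'w::ab_group_add set \<Rightarrow> (nat \<Rightarrow> 'w \<Rightarrow> 'w) \<Rightarrow> (nat \<Rightarrow> 'w \<Rightarrow> 'w)
    \<Rightarrow> (mat4 \<Rightarrow> 'w \<Rightarrow> 'w) \<Rightarrow> bool" where
  "sl4_module_on_which s W P Q \<rho> \<longleftrightarrow>
     sl4_module s W \<rho> \<and>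
     (\<forall>k\<in>{1, 2, 3}. \<forall>w\<in>W. \<rho> (gen k) w = P k w \<and> \<rho> (gen_star k) w = Q k w)"

definition sl4_module_iso ::
  "(complex \<Rightarrow> 'v \<Rightarrow> 'v) \<Rightarrow> 'v::ab_group_add set \<Rightarrow> (mat4 \<Rightarrow> 'v \<Rightarrow> 'v) \<Rightarrow>
   (complex \<Rightarrow> 'w \<Rightarrow> 'w) \<Rightarrow> 'w::ab_group_add set \<Rightarrow> (mat4 \<Rightarrow> 'w \<Rightarrow> 'w) \<Rightarrow> ('v \<Rightarrow> 'w) \<Rightarrow> bool" where
  "sl4_module_iso s U \<sigma> s' W \<rho> f \<longleftrightarrow>
     linear_on s s' U W f \<and> bij_betw f U W \<and>
     (\<forall>M\<in>sl4. \<forall>u\<in>U. f (\<sigma> M u) = \<rho> M (f u))"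


section \<open>The hypercube\<close>

type_synonym vertex = "int list"
type_synonym cvec = "vertex \<Rightarrow> complex"
type_synonym tvec = "vertex \<times> vertex \<times> vertex \<Rightarrow> complex"

definition vertices :: "nat \<Rightarrow> vertex set" where
  "vertices N = {x. length x = N \<and> set x \<subseteq> {1, -1}}"

definition adj :: "nat \<Rightarrow> vertex rel" where
  "adj N = {(x, y). x \<in> vertices N \<and> y \<in> vertices N \<and> card {i. i < N \<and> x ! i \<noteq> y ! i} = 1}"

text \<open>\<open>(x, y) \<in> adj N ^^ n\<close> says that there is a walk of length \<open>n\<close> from \<open>x\<close> to \<open>y\<close>, and a
  shortest walk is a path.\<close>

definition gdist :: "nat \<Rightarrow> vertex \<Rightarrow> vertex \<Rightarrow> nat" where
  "gdist N x y = (LEAST n. (x, y) \<in> adj N ^^ n)"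

definition sphere_at :: "nat \<Rightarrow> nat \<Rightarrow> vertex \<Rightarrow> vertex set" where
  "sphere_at N i x = {y \<in> vertices N. gdist N x y = i}"

definition theta :: "nat \<Rightarrow> nat \<Rightarrow> complex" where
  "theta N i = of_nat N - 2 * of_nat i"

abbreviation theta_star :: "nat \<Rightarrow> nat \<Rightarrow> complex" where
  "theta_star \<equiv> theta"

definition V :: "nat \<Rightarrow> cvec set" where
  "V N = free_space (vertices N)"

definition herm :: "nat \<Rightarrow> cvec \<Rightarrow> cvec \<Rightarrow> complex" where
  "herm N u v = (\<Sum>x\<in>vertices N. u x * cnj (v x))"


section \<open>The triple tensor product\<close>

text \<open>\<open>V \<otimes> V \<otimes> V\<close> is realised as the space with basis \<open>X \<times> X \<times> X\<close>; by \<open>tensor3\<close> the triple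
  \<open>(x, y, z)\<close> is the basis vector \<open>x \<otimes> y \<otimes> z\<close>.\<close>

definition tensor3 :: "cvec \<Rightarrow> cvec \<Rightarrow> cvec \<Rightarrow> tvec" where
  "tensor3 u v w = (\<lambda>(x, y, z). u x * v y * w z)"

abbreviation btensor :: "vertex \<Rightarrow> vertex \<Rightarrow> vertex \<Rightarrow> tvec" where
  "btensor x y z \<equiv> tensor3 (basis_vec x) (basis_vec y) (basis_vec z)"

abbreviation triples :: "nat \<Rightarrow> (vertex \<times> vertex \<times> vertex) set" where
  "triples N \<equiv> vertices N \<times> vertices N \<times> vertices N"

definition V3 :: "nat \<Rightarrow> tvec set" where
  "V3 N = free_space (triples N)"

definition Aut :: "nat \<Rightarrow> (vertex \<Rightarrow> vertex) set" where
  "Aut N = {g. g permutes vertices N \<and>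
     (\<forall>x\<in>vertices N. \<forall>y\<in>vertices N. (g x, g y) \<in> adj N \<longleftrightarrow> (x, y) \<in> adj N)}"

definition act3 :: "nat \<Rightarrow> (vertex \<Rightarrow> vertex) \<Rightarrow> tvec \<Rightarrow> tvec" where
  "act3 N g = lin_ext smul (triples N) (\<lambda>(x, y, z). btensor (g x) (g y) (g z))"

definition Fix :: "nat \<Rightarrow> tvec set" where
  "Fix N = {v \<in> V3 N. \<forall>g\<in>Aut N. act3 N g v = v}"

definition A3 :: "nat \<Rightarrow> nat \<Rightarrow> tvec \<Rightarrow> tvec" where
  "A3 N k = lin_ext smul (triples N) (\<lambda>(x, y, z). sel k
     (\<Sum>\<xi>\<in>sphere_at N 1 x. btensor \<xi> y z)
     (\<Sum>\<xi>\<in>sphere_at N 1 y. btensor x \<xi> z)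
     (\<Sum>\<xi>\<in>sphere_at N 1 z. btensor x y \<xi>))"

definition A3_star :: "nat \<Rightarrow> nat \<Rightarrow> tvec \<Rightarrow> tvec" where
  "A3_star N k = lin_ext smul (triples N) (\<lambda>(x, y, z).
     smul (theta_star N (sel k (gdist N y z) (gdist N z x) (gdist N x y))) (btensor x y z))"


section \<open>The subconstituent algebra\<close>

definition Ah :: "nat \<Rightarrow> nat \<Rightarrow> cvec \<Rightarrow> cvec" where
  "Ah N h = lin_ext smul (vertices N) (\<lambda>x. \<Sum>\<xi>\<in>sphere_at N h x. basis_vec \<xi>)"

abbreviation adjacency :: "nat \<Rightarrow> cvec \<Rightarrow> cvec" where
  "adjacency N \<equiv> Ah N 1"

definition eigenspace :: "nat \<Rightarrow> nat \<Rightarrow> cvec set" where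
  "eigenspace N i = {v \<in> V N. adjacency N v = smul (theta N i) v}"

text \<open>The projection onto the \<open>theta N i\<close>-eigenspace along the other eigenspaces; it is
  uniquely determined because the adjacency map is diagonalizable with these eigenvalues.\<close>

definition idem :: "nat \<Rightarrow> nat \<Rightarrow> cvec \<Rightarrow> cvec" where
  "idem N i = (THE P. P \<in> Endo smul (V N) \<and>
     (\<forall>j\<le>N. \<forall>v\<in>eigenspace N j. P v = (if j = i then v else 0)))"

definition adjacency_star :: "nat \<Rightarrow> vertex \<Rightarrow> cvec \<Rightarrow> cvec" where
  "adjacency_star N \<kappa> = lin_ext smul (vertices N)
     (\<lambda>x. smul (theta_star N (gdist N x \<kappa>)) (basis_vec x))"

definition idem_star :: "nat \<Rightarrow> vertex \<Rightarrow> nat \<Rightarrow> cvec \<Rightarrow> cvec" where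
  "idem_star N \<kappa> i = lin_ext smul (vertices N)
     (\<lambda>x. if gdist N x \<kappa> = i then basis_vec x else 0)"

definition Ah_star :: "nat \<Rightarrow> vertex \<Rightarrow> nat \<Rightarrow> cvec \<Rightarrow> cvec" where
  "Ah_star N \<kappa> h = lin_ext smul (vertices N)
     (\<lambda>x. smul (2 ^ N * herm N (idem N h (basis_vec \<kappa>)) (basis_vec x)) (basis_vec x))"

text \<open>Subalgebras contain the identity of \<open>End(V)\<close>.\<close>

definition unital_subalgebra :: "nat \<Rightarrow> (cvec \<Rightarrow> cvec) set \<Rightarrow> bool" where
  "unital_subalgebra N S \<longleftrightarrow>
     S \<subseteq> Endo smul (V N) \<and> module.subspace emul S \<and> id_endo (V N) \<in> S \<and>
     (\<forall>F\<in>S. \<forall>F'\<in>S. F \<circ> F' \<in> S)"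

definition T :: "nat \<Rightarrow> vertex \<Rightarrow> (cvec \<Rightarrow> cvec) set" where
  "T N \<kappa> = unital_subalgebra N hull {adjacency N, adjacency_star N \<kappa>}"

definition P'' :: "nat \<Rightarrow> (nat \<times> nat \<times> nat) set" where
  "P'' N = {(h, i, j). h \<le> N \<and> i \<le> N \<and> j \<le> N \<and> even (h + i + j) \<and> h + i + j \<le> 2 * N \<and>
     h \<le> i + j \<and> i \<le> j + h \<and> j \<le> h + i}"

text \<open>Each of the following maps is uniquely determined, because its prescribed eigenvectors
  form a basis of \<open>T\<close>.\<close>

definition calA :: "nat \<Rightarrow> vertex \<Rightarrow> nat \<Rightarrow> (cvec \<Rightarrow> cvec) \<Rightarrow> (cvec \<Rightarrow> cvec)" where
  "calA N \<kappa> k = (THE F. F \<in> Endo emul (T N \<kappa>) \<and>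
     (\<forall>(h, i, j)\<in>P'' N. F (idem N i \<circ> Ah_star N \<kappa> h \<circ> idem N j) =
        emul (theta N (sel k h i j)) (idem N i \<circ> Ah_star N \<kappa> h \<circ> idem N j)))"

text \<open>Here the second map belongs to \<open>j\<close> and the third to \<open>i\<close>.\<close>

definition calA_star :: "nat \<Rightarrow> vertex \<Rightarrow> nat \<Rightarrow> (cvec \<Rightarrow> cvec) \<Rightarrow> (cvec \<Rightarrow> cvec)" where
  "calA_star N \<kappa> k = (THE F. F \<in> Endo emul (T N \<kappa>) \<and>
     (\<forall>(h, i, j)\<in>P'' N. F (idem_star N \<kappa> i \<circ> Ah N h \<circ> idem_star N \<kappa> j) =
        emul (theta_star N (sel k h j i)) (idem_star N \<kappa> i \<circ> Ah N h \<circ> idem_star N \<kappa> j)))"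

definition e_unit :: "nat \<Rightarrow> vertex \<Rightarrow> vertex \<Rightarrow> cvec \<Rightarrow> cvec" where
  "e_unit N x y = lin_ext smul (vertices N) (\<lambda>w. if w = y then basis_vec x else 0)"

definition eps :: "nat \<Rightarrow> vertex \<Rightarrow> tvec \<Rightarrow> (cvec \<Rightarrow> cvec)" where
  "eps N \<kappa> = lin_ext emul (triples N) (\<lambda>(x, y, z).
     if x = \<kappa> then emul (of_real (2 powr (real N / 2))) (e_unit N y z) else 0)"

end

theory Submission
  imports Defs
begin

text \<open>
  An endomorphism of \<open>V\<close> is a kernel \<open>K(y, z)\<close>.  The type of the signs \<open>(\<kappa>\<^sub>k, y\<^sub>k, z\<^sub>k)\<close>, up to a
  common sign, takes four values, so kernels form the \<open>N\<close>-th tensor power of \<open>\<complex>\<^sup>4\<close>, on which all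
  \<open>4 \<times> 4\<close> matrices act by derivations.  The algebra \<open>T\<close> consists of the kernels fixed by the
  stabilizer of \<open>\<kappa>\<close>, equivalently those depending only on the distances between \<open>\<kappa>\<close>, \<open>y\<close>, \<open>z\<close>:
  these form an algebra, and Lagrange interpolation in \<open>A\<close> and \<open>A\<^sup>*\<close> yields every orbit kernel
  \<open>E\<^sub>i\<^sup>* A\<^sub>h E\<^sub>j\<^sup>*\<close>.  Conjugation by the Hadamard matrix of characters exchanges these with
  \<open>E\<^sub>i A\<^sub>h\<^sup>* E\<^sub>j\<close>, and turns multiplication by a sign at coordinate \<open>k\<close> into the flip of
  coordinate \<open>k\<close>; so the maps defined by eigenvectors are sums of coordinate flips or
  multiplications by \<open>\<theta>\<close>, which are the actions of the six generators.  A fixed tensor is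
  determined by its values at \<open>x = \<kappa>\<close>, so \<open>\<epsilon>\<close> is bijective, and by invariance flipping \<open>\<kappa>\<close> is the
  same as flipping both \<open>y\<close> and \<open>z\<close>.  Since the generators generate the Lie algebra, an
  intertwiner of the generators is an isomorphism of modules.
\<close>


section \<open>Finite-dimensional linear algebra and the Hamming distance\<close>

text \<open>The bracket relations come from letting every 4x4 matrix act at once, one coordinate at
  a time. Two such actions compose to the action of the matrix product plus a part that uses two
  different coordinates; this part is symmetric in the two matrices and cancels in a commutator.
  That invariant kernels stay invariant is seen for the six generators and carried to all matrices
  through brackets. The numbering of the types is dictated by the six matrices. Changing one of the
  three signs permutes the types by a double transposition, which gives \<open>gen k\<close>; the
  product of two of the signs is constant on each type, which gives the diagonal of
  \<open>gen_star k\<close>. Since \<open>theta\<close> of a distance is the sum of such products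
  over the coordinates, multiplication by it is a derivation. Definite descriptions are resolved by
  exhibiting the map and a spanning family on which its values are prescribed. The powers of two in
  the duality come from the square of the Hadamard matrix. The module structure on the fixed tensors
  is pulled back along \<open>eps\<close>, so that on tensors only the generators have to be
  computed.\<close>

lemma vector_space_smul: "vector_space smul"
  by unfold_locales (auto simp: smul_def fun_eq_iff algebra_simps)

lemma vector_space_emul: "vector_space emul"
  by unfold_locales (auto simp: emul_def smul_def fun_eq_iff algebra_simps)

lemma subspace_iff:
  assumes "vector_space s"
  shows "module.subspace s W \<longleftrightarrow> 0 \<in> W \<and> (\<forall>u\<in>W. \<forall>v\<in>W. u + v \<in> W) \<and> (\<forall>c. \<forall>u\<in>W. s c u \<in> W)"
proof -
  interpret vector_space s by fact
  show ?thesis by (auto simp: subspace_def)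
qed

lemmas subspace_smul_iff = subspace_iff[OF vector_space_smul]
lemmas subspace_emul_iff = subspace_iff[OF vector_space_emul]

lemma sum_fun_apply: "(\<Sum>i\<in>A. f i) x = (\<Sum>i\<in>A. f i x)"
  by (induction A rule: infinite_finite_induct) auto

text \<open>Additivity of \<open>F\<close> is known on \<open>U\<close> only, so the induction has
  to carry membership along with the formula. With the identity as \<open>F\<close>, the first
  conjunct is closure under linear combinations.\<close>

lemma linear_on_sum:
  assumes vs: "vector_space s" and sub: "module.subspace s U"
    and vs': "vector_space s'"
    and F: "linear_on s s' U W F"
    and fin: "finite P" and e: "\<And>p. p \<in> P \<Longrightarrow> e p \<in> U"
  shows "(\<Sum>p\<in>P. s (c p) (e p)) \<in> U \<and> F (\<Sum>p\<in>P. s (c p) (e p)) = (\<Sum>p\<in>P. s' (c p) (F (e p)))"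
proof -
  have sub': "0 \<in> U" "\<And>u v. u \<in> U \<Longrightarrow> v \<in> U \<Longrightarrow> u + v \<in> U" "\<And>c u. u \<in> U \<Longrightarrow> s c u \<in> U"
    using sub unfolding subspace_iff[OF vs] by auto
  have F0: "F 0 = 0"
    using F sub'(1) unfolding linear_on_def by (metis add_cancel_left_left add_0)
  show ?thesis using fin e
  proof (induction P)
    case empty
    then show ?case using sub' F0 by simp
  next
    case (insert p P)
    then have "s (c p) (e p) \<in> U" "(\<Sum>p\<in>P. s (c p) (e p)) \<in> U"
      using sub' by auto
    moreover have "F (s (c p) (e p)) = s' (c p) (F (e p))"
      using F insert.prems unfolding linear_on_def by simp
    moreover have "F (s (c p) (e p) + (\<Sum>p\<in>P. s (c p) (e p))) =
        F (s (c p) (e p)) + F (\<Sum>p\<in>P. s (c p) (e p))"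
      using F calculation(1,2) unfolding linear_on_def by simp
    moreover have "F (\<Sum>p\<in>P. s (c p) (e p)) = (\<Sum>p\<in>P. s' (c p) (F (e p)))"
      using insert by blast
    ultimately show ?case
      using sub'(2) by (simp only: sum.insert[OF insert.hyps])
  qed
qed

text \<open>A linear map is determined by its values on a spanning family, and elements of
  \<open>Endo\<close> vanish off \<open>W\<close> by convention. This is the uniqueness half of the
  definite descriptions \<open>calA\<close> and \<open>calA_star\<close>.\<close>

lemma Endo_eqI:
  fixes s :: "complex \<Rightarrow> 'w \<Rightarrow> 'w::ab_group_add"
  assumes vs: "vector_space s" and sub: "module.subspace s W"
    and F: "F \<in> Endo s W" "F' \<in> Endo s W"
    and fin: "finite P" and e: "\<And>p. p \<in> P \<Longrightarrow> e p \<in> W"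
    and span: "\<And>w. w \<in> W \<Longrightarrow> \<exists>c. w = (\<Sum>p\<in>P. s (c p) (e p))"
    and eq: "\<And>p. p \<in> P \<Longrightarrow> F (e p) = F' (e p)"
  shows "F = F'"
proof
  fix w
  show "F w = F' w"
  proof (cases "w \<in> W")
    case True
    then obtain c where w: "w = (\<Sum>p\<in>P. s (c p) (e p))" using span by blast
    have *: "G (\<Sum>p\<in>P. s (c p) (e p)) = (\<Sum>p\<in>P. s (c p) (G (e p)))" if "G \<in> Endo s W" for G
    proof -
      have "linear_on s s W W G" using that by (simp add: Endo_def)
      then show ?thesis using linear_on_sum[OF vs sub vs, of W G P e c] fin e by blast
    qed
    show ?thesis unfolding w *[OF F(1)] *[OF F(2)] using eq by simp
  next
    case False
    then show ?thesis using F by (auto simp: Endo_def)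
  qed
qed

section \<open>Hamming distance, coordinate flips and the graph metric\<close>

definition hamm :: "nat \<Rightarrow> vertex \<Rightarrow> vertex \<Rightarrow> nat" where
  "hamm N x y = card {i. i < N \<and> x ! i \<noteq> y ! i}"

text \<open>Beyond the end of the list the update does nothing, so \<open>flip k\<close> preserves
  the vertex set and is an involution for every \<open>k\<close>.\<close>

definition flip :: "nat \<Rightarrow> vertex \<Rightarrow> vertex" where
  "flip k x = x[k := - x ! k]"

text \<open>For fixed \<open>x\<close> and \<open>y\<close> this is multiplication by the sign
  vector \<open>x y\<close>, the translation that interchanges \<open>x\<close> and
  \<open>y\<close>. For \<open>x\<close> = \<kappa> it is also the product of \<open>y\<close> and
  \<open>z\<close> in the group of sign vectors with \<kappa> as neutral element.\<close>

definition translate :: "nat \<Rightarrow> vertex \<Rightarrow> vertex \<Rightarrow> vertex \<Rightarrow> vertex" where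
  "translate N x y z = map (\<lambda>k. x ! k * y ! k * z ! k) [0..<N]"

lemma vertices_iff: "x \<in> vertices N \<longleftrightarrow> length x = N \<and> (\<forall>k<N. x ! k = 1 \<or> x ! k = -1)"
  unfolding vertices_def by (auto simp: set_conv_nth)

lemma vertex_nth: "x \<in> vertices N \<Longrightarrow> k < N \<Longrightarrow> x ! k = 1 \<or> x ! k = -1"
  by (simp add: vertices_iff)

lemma vertex_length: "x \<in> vertices N \<Longrightarrow> length x = N"
  by (simp add: vertices_iff)

lemma vertex_eqI:
  "x \<in> vertices N \<Longrightarrow> y \<in> vertices N \<Longrightarrow> (\<And>k. k < N \<Longrightarrow> x ! k = y ! k) \<Longrightarrow> x = y"
  by (rule nth_equalityI) (simp_all add: vertices_iff)

lemma vertices_lists: "vertices N = {x. set x \<subseteq> {1, -1} \<and> length x = N}"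
  by (auto simp: vertices_def)

lemma finite_vertices [simp, intro]: "finite (vertices N)"
  unfolding vertices_lists by (rule finite_lists_length_eq) simp

lemma card_vertices: "card (vertices N) = 2 ^ N"
  unfolding vertices_lists by (subst card_lists_length_eq) (simp_all add: numeral_2_eq_2)

lemma flip_in [simp]: "x \<in> vertices N \<Longrightarrow> flip k x \<in> vertices N"
  by (cases "k < length x") (auto simp: vertices_iff flip_def nth_list_update)

lemma flip_nth: "x \<in> vertices N \<Longrightarrow> k < N \<Longrightarrow> flip k x ! i = (if i = k then - x ! k else x ! i)"
  by (auto simp: flip_def nth_list_update vertex_length)

lemma flip_flip [simp]: "flip k (flip k x) = x"
  by (cases "k < length x") (auto simp: flip_def list_update_beyond)

lemma translate_nth: "k < N \<Longrightarrow> translate N x y z ! k = x ! k * y ! k * z ! k"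
  by (simp add: translate_def)

lemma translate_in [simp]:
  assumes "x \<in> vertices N" "y \<in> vertices N" "z \<in> vertices N"
  shows "translate N x y z \<in> vertices N"
proof -
  have "translate N x y z ! k = 1 \<or> translate N x y z ! k = -1" if "k < N" for k
    using vertex_nth[OF assms(1) that] vertex_nth[OF assms(2) that] vertex_nth[OF assms(3) that] that
    by (auto simp: translate_nth)
  then show ?thesis by (simp add: vertices_iff translate_def)
qed

lemma translate_translate:
  assumes "x \<in> vertices N" "y \<in> vertices N" "z \<in> vertices N"
  shows "translate N x y (translate N x y z) = z"
proof (rule vertex_eqI[of _ N])
  fix k assume k: "k < N"
  show "translate N x y (translate N x y z) ! k = z ! k"
    using k vertex_nth[OF assms(1) k] vertex_nth[OF assms(2) k] by (auto simp: translate_nth)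
qed (use assms in auto)

lemma translate_same:
  assumes "x \<in> vertices N" "z \<in> vertices N"
  shows "translate N x x z = z" "translate N x z x = z"
proof -
  show "translate N x x z = z"
  proof (rule vertex_eqI[of _ N])
    fix k assume k: "k < N"
    show "translate N x x z ! k = z ! k"
      using k vertex_nth[OF assms(1) k] by (auto simp: translate_nth)
  qed (use assms in auto)
  show "translate N x z x = z"
  proof (rule vertex_eqI[of _ N])
    fix k assume k: "k < N"
    show "translate N x z x ! k = z ! k"
      using k vertex_nth[OF assms(1) k] by (auto simp: translate_nth)
  qed (use assms in auto)
qed

lemma hamm_commute: "hamm N x y = hamm N y x"
  unfolding hamm_def by (simp add: eq_commute)

lemma hamm_self [simp]: "hamm N x x = 0"
  by (simp add: hamm_def)

lemma hamm_0_iff: "x \<in> vertices N \<Longrightarrow> y \<in> vertices N \<Longrightarrow> hamm N x y = 0 \<longleftrightarrow> x = y"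
  by (auto simp: hamm_def intro: vertex_eqI)

lemma hamm_le: "hamm N x y \<le> N"
proof -
  have "hamm N x y \<le> card {..<N}" unfolding hamm_def by (rule card_mono) auto
  then show ?thesis by simp
qed

lemma hamm_triangle: "hamm N x z \<le> hamm N x y + hamm N y z"
proof -
  have "hamm N x z \<le> card ({i. i < N \<and> x ! i \<noteq> y ! i} \<union> {i. i < N \<and> y ! i \<noteq> z ! i})"
    unfolding hamm_def by (rule card_mono) auto
  also have "\<dots> \<le> hamm N x y + hamm N y z"
    unfolding hamm_def by (rule card_Un_le)
  finally show ?thesis .
qed

lemma hamm_flip_step:
  assumes "x \<in> vertices N" "y \<in> vertices N" "k < N" "x ! k \<noteq> y ! k"
  shows "hamm N x y = Suc (hamm N (flip k x) y)"
proof -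
  have "{i. i < N \<and> x ! i \<noteq> y ! i} = insert k {i. i < N \<and> flip k x ! i \<noteq> y ! i}"
    using assms vertex_nth[OF assms(1,3)] vertex_nth[OF assms(2,3)] by (auto simp: flip_nth)
  moreover have "k \<notin> {i. i < N \<and> flip k x ! i \<noteq> y ! i}"
    using assms vertex_nth[OF assms(1,3)] vertex_nth[OF assms(2,3)] by (auto simp: flip_nth)
  ultimately show ?thesis unfolding hamm_def by simp
qed

lemma hamm_flip_self:
  assumes "x \<in> vertices N" "k < N"
  shows "hamm N x (flip k x) = 1"
proof -
  have "x ! k \<noteq> flip k x ! k" using assms vertex_nth[OF assms] by (auto simp: flip_nth)
  from hamm_flip_step[OF assms(1) flip_in[OF assms(1)] assms(2) this] show ?thesis by simp
qed

lemma hamm_flip_swap: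
  assumes "x \<in> vertices N" "y \<in> vertices N" "k < N"
  shows "hamm N (flip k x) y = hamm N x (flip k y)"
proof -
  have "flip k x ! i \<noteq> y ! i \<longleftrightarrow> x ! i \<noteq> flip k y ! i" if "i < N" for i
    using assms vertex_nth[OF assms(1,3)] vertex_nth[OF assms(2,3)] by (auto simp: flip_nth)
  then have "{i. i < N \<and> flip k x ! i \<noteq> y ! i} = {i. i < N \<and> x ! i \<noteq> flip k y ! i}" by blast
  then show ?thesis unfolding hamm_def by simp
qed

lemma adj_iff: "(x, y) \<in> adj N \<longleftrightarrow> x \<in> vertices N \<and> y \<in> vertices N \<and> hamm N x y = 1"
  by (simp add: adj_def hamm_def)

lemma hamm_relpow:
  "(x, y) \<in> adj N ^^ n \<Longrightarrow> hamm N x y \<le> n"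
proof (induction n arbitrary: y)
  case (Suc n)
  then obtain w where "(x, w) \<in> adj N ^^ n" "(w, y) \<in> adj N" by auto
  then show ?case using Suc.IH[of w] hamm_triangle[of N x y w] by (auto simp: adj_iff)
qed simp

text \<open>Flipping a coordinate in which \<open>x\<close> and \<open>y\<close> differ is a step
  that lowers the Hamming distance by one; iterating gives a walk of the least length that
  \<open>hamm_relpow\<close> permits.\<close>

lemma relpow_hamm:
  "x \<in> vertices N \<Longrightarrow> y \<in> vertices N \<Longrightarrow> hamm N x y = n \<Longrightarrow> (x, y) \<in> adj N ^^ n"
proof (induction n arbitrary: x)
  case 0
  then show ?case by (simp add: hamm_0_iff)
next
  case (Suc n)
  then have "x \<noteq> y" by auto
  then obtain k where k: "k < N" "x ! k \<noteq> y ! k" using Suc.prems vertex_eqI by blast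
  have "hamm N (flip k x) y = n" using hamm_flip_step[OF Suc.prems(1,2) k] Suc.prems by simp
  then have "(flip k x, y) \<in> adj N ^^ n" using Suc by simp
  moreover have "(x, flip k x) \<in> adj N" using Suc.prems k by (simp add: adj_iff hamm_flip_self)
  ultimately show ?case by (meson relpow_Suc_I2)
qed

lemma gdist_eq: "x \<in> vertices N \<Longrightarrow> y \<in> vertices N \<Longrightarrow> gdist N x y = hamm N x y"
  unfolding gdist_def by (rule Least_equality) (auto intro: relpow_hamm hamm_relpow)

lemma sphere_1: 
  assumes "x \<in> vertices N"
  shows "sphere_at N 1 x = (\<lambda>k. flip k x) ` {..<N}"
proof (intro set_eqI iffI)
  fix y assume "y \<in> sphere_at N 1 x"
  then have y: "y \<in> vertices N" "hamm N x y = 1" using assms by (auto simp: sphere_at_def gdist_eq)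
  then have "x \<noteq> y" by auto
  then obtain k where k: "k < N" "x ! k \<noteq> y ! k" using y assms vertex_eqI by blast
  have "hamm N (flip k x) y = 0" using hamm_flip_step[OF assms y(1) k] y by simp
  then have "y = flip k x" using assms y by (simp add: hamm_0_iff)
  then show "y \<in> (\<lambda>k. flip k x) ` {..<N}" using k by auto
qed (use assms in \<open>auto simp: sphere_at_def gdist_eq hamm_flip_self\<close>)

lemma inj_flip: "x \<in> vertices N \<Longrightarrow> inj_on (\<lambda>k. flip k x) {..<N}"
proof (rule inj_onI)
  fix i k assume x: "x \<in> vertices N" and "i \<in> {..<N}" "k \<in> {..<N}" "flip i x = flip k x"
  then have "flip i x ! i = flip k x ! i" "i < N" "k < N" by auto
  then show "i = k" using vertex_nth[OF x, of i] x by (auto simp: flip_nth split: if_splits)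
qed

lemma sum_sphere_1:
  "x \<in> vertices N \<Longrightarrow> (\<Sum>\<xi>\<in>sphere_at N 1 x. f \<xi>) = (\<Sum>k<N. f (flip k x))"
  by (simp only: sphere_1 sum.reindex[OF inj_flip] comp_def)

text \<open>N - 2d counts agreements minus disagreements, which is the inner product of the two sign
  vectors. This makes \<open>theta\<close> of a distance additive over the coordinates.\<close>

lemma theta_hamm:
  assumes "x \<in> vertices N" "y \<in> vertices N"
  shows "theta N (hamm N x y) = (\<Sum>k<N. of_int (x ! k * y ! k))"
proof -
  have "(\<Sum>k<N. of_int (x ! k * y ! k)) = (\<Sum>k<N. 1 - 2 * (if x ! k \<noteq> y ! k then 1 else (0::complex)))"
    using vertex_nth[OF assms(1)] vertex_nth[OF assms(2)] by (intro sum.cong refl) force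
  also have "\<dots> = of_nat N - 2 * (\<Sum>k<N. (if x ! k \<noteq> y ! k then 1 else (0::complex)))"
    by (simp add: sum_subtractf sum_distrib_left)
  also have "(\<Sum>k<N. (if x ! k \<noteq> y ! k then 1 else (0::complex))) = of_nat (hamm N x y)"
    unfolding hamm_def by (subst sum.inter_filter[symmetric]) (auto simp: lessThan_def)
  finally show ?thesis by (simp add: theta_def)
qed

lemma theta_inj: "theta N i = theta N j \<longleftrightarrow> i = j"
  by (simp add: theta_def)


section \<open>Generation of the Lie algebra\<close>

lemma sl4_add: "M \<in> sl4 \<Longrightarrow> M' \<in> sl4 \<Longrightarrow> M + M' \<in> sl4"
  by (simp add: sl4_def trace_add)

lemma sl4_mscale: "M \<in> sl4 \<Longrightarrow> mscale c M \<in> sl4"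
  by (simp add: sl4_def trace_def mscale_def flip: sum_distrib_left)

lemma sl4_bracket: "bracket M M' \<in> sl4"
  by (simp add: sl4_def bracket_def trace_sub trace_mul_sym[of M M'])

lemma numeral_4_distinct:
  "(1::4) \<noteq> 2" "(1::4) \<noteq> 3" "(1::4) \<noteq> 4" "(2::4) \<noteq> 3" "(2::4) \<noteq> 4" "(3::4) \<noteq> 4"
  "(2::4) \<noteq> 1" "(3::4) \<noteq> 1" "(4::4) \<noteq> 1" "(3::4) \<noteq> 2" "(4::4) \<noteq> 2" "(4::4) \<noteq> 3"
  by simp_all

lemmas mat4_entry =
  gen_def gen_star_def sel_def mdiag_def munit_def mscale_def bracket_def
  matrix_matrix_mult_def sum_4 numeral_4_distinct

lemma gen_in_sl4: "gen k \<in> sl4" "gen_star k \<in> sl4"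
  by (simp_all add: sl4_def trace_def mat4_entry)

lemma mscale_entry: "mscale c M $ i $ j = c * M $ i $ j"
  by (simp add: mscale_def)

text \<open>The three double transpositions of the types, the nontrivial elements of the Klein
  four-group; \<open>gen k\<close> is the permutation matrix of \<open>klein k\<close>.\<close>

definition klein :: "nat \<Rightarrow> 4 \<Rightarrow> 4" where
  "klein k j = sel k
     (if j = 1 then 2 else if j = 2 then 1 else if j = 3 then 4 else 3)
     (if j = 1 then 3 else if j = 3 then 1 else if j = 2 then 4 else 2)
     (if j = 1 then 4 else if j = 4 then 1 else if j = 2 then 3 else 2)"

lemma gen_entry: "gen k $ i $ j = (if i = klein k j then 1 else 0)"
proof -
  have "\<forall>i j. gen k $ i $ j = (if i = klein k j then 1 else 0)"
    unfolding forall_4 by (simp add: gen_def munit_def klein_def sel_def numeral_4_distinct)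
  then show ?thesis by blast
qed

lemma klein_sym: "i = klein k j \<longleftrightarrow> j = klein k i"
proof -
  have "\<forall>i j. i = klein k j \<longleftrightarrow> j = klein k i"
    unfolding forall_4 by (simp add: klein_def sel_def numeral_4_distinct)
  then show ?thesis by blast
qed

lemma gen_star_entry: "gen_star k $ i $ j = (if i = j then sel k
    (if j = 1 \<or> j = 2 then 1 else -1)
    (if j = 1 \<or> j = 3 then 1 else -1)
    (if j = 1 \<or> j = 4 then 1 else -1) else 0)"
proof -
  have "\<forall>i j. gen_star k $ i $ j = (if i = j then sel k
    (if j = 1 \<or> j = 2 then 1 else -1)
    (if j = 1 \<or> j = 3 then 1 else -1)
    (if j = 1 \<or> j = 4 then 1 else -1) else 0)"
    unfolding forall_4
    by (simp add: gen_star_def mdiag_def mscale_def munit_def sel_def numeral_4_distinct)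
  then show ?thesis by blast
qed

text \<open>Multiplying by \<open>gen k\<close> permutes columns from the right and rows from the
  left, and \<open>klein k\<close> is its own inverse. Nested brackets with generators thus reduce
  to re-indexed entries.\<close>

lemma bracket_gen_entry: "bracket M (gen k) $ i $ j = M $ i $ klein k j - M $ klein k i $ j"
proof -
  have "(\<Sum>l\<in>UNIV. M $ i $ l * (if l = klein k j then 1 else 0)) = M $ i $ klein k j"
    by (simp add: if_distrib cong: if_cong)
  moreover have "(\<Sum>l\<in>UNIV. (if i = klein k l then 1 else 0) * M $ l $ j) = M $ klein k i $ j"
    by (simp add: klein_sym[of i] if_distrib[where f="\<lambda>x. x * _"] cong: if_cong)
  ultimately show ?thesis
    by (simp add: bracket_def matrix_matrix_mult_def gen_entry)
qed

lemma bracket_gen_star_entry: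
  "bracket M (gen_star k) $ i $ j = M $ i $ j * (gen_star k $ j $ j - gen_star k $ i $ i)"
proof -
  have *: "gen_star k $ i $ j = (if i = j then gen_star k $ j $ j else 0)" for i j
    by (simp add: gen_star_entry)
  have "(\<Sum>l\<in>UNIV. M $ i $ l * gen_star k $ l $ j) = M $ i $ j * gen_star k $ j $ j"
    by (subst *) (simp add: if_distrib[where f="\<lambda>x. _ * x"] cong: if_cong)
  moreover have "(\<Sum>l\<in>UNIV. gen_star k $ i $ l * M $ l $ j) = M $ i $ j * gen_star k $ i $ i"
    by (subst *) (simp add: if_distrib[where f="\<lambda>x. x * _"] cong: if_cong)
  ultimately show ?thesis
    by (simp add: bracket_def matrix_matrix_mult_def algebra_simps)
qed

text \<open>The generators and the products \<open>gen i ** gen_star j\<close> form a basis; these products are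
  brackets of generators up to a factor, double brackets if \<open>i = j\<close>.\<close>

lemma sl4_decompose:
  assumes "M \<in> sl4"
  defines "m \<equiv> \<lambda>i j. M $ i $ j"
  shows "M =
    mscale ((m 1 2 + m 2 1 + m 3 4 + m 4 3) / 4) (gen 1) +
    mscale ((m 1 3 + m 3 1 + m 2 4 + m 4 2) / 4) (gen 2) +
    mscale ((m 1 4 + m 4 1 + m 2 3 + m 3 2) / 4) (gen 3) +
    mscale ((m 1 1 + m 2 2 - m 3 3 - m 4 4) / 4) (gen_star 1) +
    mscale ((m 1 1 - m 2 2 + m 3 3 - m 4 4) / 4) (gen_star 2) +
    mscale ((m 1 1 - m 2 2 - m 3 3 + m 4 4) / 4) (gen_star 3) +
    mscale ((m 2 1 - m 1 2 + m 4 3 - m 3 4) / 8) (bracket (gen 1) (gen_star 2)) +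
    mscale ((m 2 1 - m 1 2 + m 3 4 - m 4 3) / 8) (bracket (gen 1) (gen_star 3)) +
    mscale ((m 3 1 - m 1 3 + m 4 2 - m 2 4) / 8) (bracket (gen 2) (gen_star 1)) +
    mscale ((m 3 1 - m 1 3 + m 2 4 - m 4 2) / 8) (bracket (gen 2) (gen_star 3)) +
    mscale ((m 4 1 - m 1 4 + m 3 2 - m 2 3) / 8) (bracket (gen 3) (gen_star 1)) +
    mscale ((m 4 1 - m 1 4 + m 2 3 - m 3 2) / 8) (bracket (gen 3) (gen_star 2)) +
    mscale (- (m 1 2 + m 2 1 - m 3 4 - m 4 3) / 16) (bracket (bracket (gen 2) (gen_star 1)) (gen 3)) +
    mscale (- (m 1 3 + m 3 1 - m 2 4 - m 4 2) / 16) (bracket (bracket (gen 3) (gen_star 2)) (gen 1)) +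
    mscale (- (m 1 4 + m 4 1 - m 2 3 - m 3 2) / 16) (bracket (bracket (gen 1) (gen_star 3)) (gen 2))"
proof -
  \<comment> \<open>Each generator has four nonzero entries \<plusminus>1, hence the divisor 4. For
    i \<noteq> j the matrices \<open>gen i\<close> and \<open>gen_star j\<close> anticommute, so
    their bracket is twice the product (divisor 8); the double brackets are -4 times a product
    \<open>gen i ** gen_star i\<close> (divisor -16). Trace zero eliminates the last diagonal
    entry.\<close>
  have tr: "M $ 4 $ 4 = - M $ 1 $ 1 - M $ 2 $ 2 - M $ 3 $ 3"
    using assms by (simp add: sl4_def trace_def sum_4) (simp add: eq_neg_iff_add_eq_0 algebra_simps)
  show ?thesis
    unfolding vec_eq_iff forall_4 m_def
    by (simp add: bracket_gen_entry bracket_gen_star_entry mscale_entry gen_entry gen_star_entry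
        klein_def sel_def numeral_4_distinct, simp add: tr, simp add: field_simps)
qed

lemma sl4_induct [consumes 1, case_names gen gen_star add mscale bracket]:
  assumes "M \<in> sl4"
    and gen: "\<And>k. k \<in> {1, 2, 3} \<Longrightarrow> P (gen k)"
    and gen_star: "\<And>k. k \<in> {1, 2, 3} \<Longrightarrow> P (gen_star k)"
    and add: "\<And>M M'. M \<in> sl4 \<Longrightarrow> M' \<in> sl4 \<Longrightarrow> P M \<Longrightarrow> P M' \<Longrightarrow> P (M + M')"
    and scale: "\<And>c M. M \<in> sl4 \<Longrightarrow> P M \<Longrightarrow> P (mscale c M)"
    and bracket: "\<And>M M'. M \<in> sl4 \<Longrightarrow> M' \<in> sl4 \<Longrightarrow> P M \<Longrightarrow> P M' \<Longrightarrow> P (bracket M M')"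
  shows "P M"
proof -
  \<comment> \<open>Membership in \<open>sl4\<close> is carried along because every closure premise
    asks for it.\<close>
  define Q where "Q M \<longleftrightarrow> M \<in> sl4 \<and> P M" for M
  have Q: "Q M \<Longrightarrow> Q M' \<Longrightarrow> Q (M + M')" "Q M \<Longrightarrow> Q (mscale c M)"
      "Q M \<Longrightarrow> Q M' \<Longrightarrow> Q (bracket M M')" for c M M'
    using add scale bracket by (auto simp: Q_def sl4_add sl4_mscale sl4_bracket)
  have Qg: "Q (gen 1)" "Q (gen 2)" "Q (gen 3)" "Q (gen_star 1)" "Q (gen_star 2)" "Q (gen_star 3)"
    using gen gen_star by (auto simp: Q_def gen_in_sl4)
  have "Q M"
    by (subst sl4_decompose[OF assms(1)]) (intro Q Qg)
  then show ?thesis by (simp add: Q_def)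
qed


section \<open>The action of matrices on kernels\<close>

text \<open>Types of a triple of signs up to a common sign: all equal (1), or the first (2), second (3),
  third (4) entry is the odd one out.  The first entry is the one of \<open>\<kappa>\<close>.\<close>

definition sign_type :: "int \<Rightarrow> int \<Rightarrow> int \<Rightarrow> 4" where
  "sign_type a b c =
     (if b = a then if c = a then 1 else 4 else if c = a then 3 else 2)"

text \<open>Together with \<open>put_snd\<close> this replaces the \<open>k\<close>-th signs of
  \<open>y\<close> and \<open>z\<close> by the representative of type \<open>t\<close> whose first
  sign is that of \<kappa>. The second entry agrees with \<kappa> in types 1 and 4, the third in
  types 1 and 3.\<close>

definition put_fst :: "vertex \<Rightarrow> nat \<Rightarrow> 4 \<Rightarrow> vertex \<Rightarrow> vertex" where
  "put_fst \<kappa> k t y = y[k := (if t = 1 \<or> t = 4 then \<kappa> ! k else - \<kappa> ! k)]"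

definition put_snd :: "vertex \<Rightarrow> nat \<Rightarrow> 4 \<Rightarrow> vertex \<Rightarrow> vertex" where
  "put_snd \<kappa> k t z = z[k := (if t = 1 \<or> t = 3 then \<kappa> ! k else - \<kappa> ! k)]"

text \<open>A kernel is a tensor in the \<open>N\<close>-th tensor power of \<open>\<complex>\<^sup>4\<close>, whose \<open>k\<close>-th index is the
  type of the \<open>k\<close>-th coordinates; this is the natural action on that power.\<close>

definition mat_act ::
  "nat \<Rightarrow> vertex \<Rightarrow> mat4 \<Rightarrow> (vertex \<Rightarrow> vertex \<Rightarrow> complex) \<Rightarrow> vertex \<Rightarrow> vertex \<Rightarrow> complex" where
  "mat_act N \<kappa> M K y z = (\<Sum>k<N. \<Sum>t\<in>UNIV. M $ sign_type (\<kappa> ! k) (y ! k) (z ! k) $ t *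
     K (put_fst \<kappa> k t y) (put_snd \<kappa> k t z))"

text \<open>The part of a composite of two actions in which \<open>M\<close> and \<open>M'\<close>
  act at different coordinates.\<close>

definition cross_act ::
  "nat \<Rightarrow> vertex \<Rightarrow> mat4 \<Rightarrow> mat4 \<Rightarrow> (vertex \<Rightarrow> vertex \<Rightarrow> complex) \<Rightarrow> vertex \<Rightarrow> vertex \<Rightarrow> complex" where
  "cross_act N \<kappa> M M' K y z = (\<Sum>k<N. \<Sum>l\<in>{..<N} - {k}. \<Sum>t\<in>UNIV. \<Sum>s\<in>UNIV.
     M $ sign_type (\<kappa> ! k) (y ! k) (z ! k) $ t * M' $ sign_type (\<kappa> ! l) (y ! l) (z ! l) $ s *
     K (put_fst \<kappa> l s (put_fst \<kappa> k t y)) (put_snd \<kappa> l s (put_snd \<kappa> k t z)))"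

lemma put_in:
  assumes "\<kappa> \<in> vertices N" "y \<in> vertices N"
  shows "put_fst \<kappa> k t y \<in> vertices N" "put_snd \<kappa> k t y \<in> vertices N"
proof -
  have *: "y[k := a] \<in> vertices N" if "k < N \<Longrightarrow> a = 1 \<or> a = -1" for a
    using assms(2) that by (cases "k < N") (auto simp: vertices_iff nth_list_update list_update_beyond)
  show "put_fst \<kappa> k t y \<in> vertices N" "put_snd \<kappa> k t y \<in> vertices N"
    unfolding put_fst_def put_snd_def using vertex_nth[OF assms(1), of k] by (auto intro!: *)
qed

lemma put_commute:
  assumes "k \<noteq> l"
  shows "put_fst \<kappa> l s (put_fst \<kappa> k t y) = put_fst \<kappa> k t (put_fst \<kappa> l s y)"
    and "put_snd \<kappa> l s (put_snd \<kappa> k t y) = put_snd \<kappa> k t (put_snd \<kappa> l s y)"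
  unfolding put_fst_def put_snd_def using assms list_update_swap by metis+

lemma put_put:
  "put_fst \<kappa> k s (put_fst \<kappa> k t y) = put_fst \<kappa> k s y"
  "put_snd \<kappa> k s (put_snd \<kappa> k t y) = put_snd \<kappa> k s y"
  by (simp_all add: put_fst_def put_snd_def)

lemma sign_type_put_same:
  assumes "\<kappa> \<in> vertices N" "y \<in> vertices N" "z \<in> vertices N" "k < N"
  shows "sign_type (\<kappa> ! k) (put_fst \<kappa> k t y ! k) (put_snd \<kappa> k t z ! k) = t"
proof -
  have "\<kappa> ! k \<noteq> - \<kappa> ! k" using vertex_nth[OF assms(1,4)] by auto
  then have "\<forall>t. sign_type (\<kappa> ! k) (put_fst \<kappa> k t y ! k) (put_snd \<kappa> k t z ! k) = t"
    unfolding forall_4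
    using assms by (simp add: sign_type_def put_fst_def put_snd_def vertex_length numeral_4_distinct)
  then show ?thesis by blast
qed

lemma put_nth_other:
  "l \<noteq> k \<Longrightarrow> put_fst \<kappa> k t y ! l = y ! l"
  "l \<noteq> k \<Longrightarrow> put_snd \<kappa> k t y ! l = y ! l"
  by (simp_all add: put_fst_def put_snd_def)

text \<open>Updates at different coordinates commute, so exchanging the roles of \<open>k\<close>
  and \<open>l\<close> in the sum over ordered pairs exchanges the two matrices.\<close>

lemma cross_act_commute: "cross_act N \<kappa> M M' K = cross_act N \<kappa> M' M K"
proof (intro ext)
  fix y z
  let ?f = "\<lambda>M M' k l. \<Sum>t\<in>UNIV. \<Sum>s\<in>UNIV.
     M $ sign_type (\<kappa> ! k) (y ! k) (z ! k) $ t * M' $ sign_type (\<kappa> ! l) (y ! l) (z ! l) $ s *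
     K (put_fst \<kappa> l s (put_fst \<kappa> k t y)) (put_snd \<kappa> l s (put_snd \<kappa> k t z))"
  have f: "?f M M' k l = ?f M' M l k" if "k \<noteq> l" for k l
    by (subst sum.swap) (simp add: put_commute[OF that] mult_ac)
  have "cross_act N \<kappa> M M' K y z = (\<Sum>k<N. \<Sum>l | l \<in> {..<N} \<and> k \<noteq> l. ?f M M' k l)"
    unfolding cross_act_def by (intro sum.cong) auto
  also have "\<dots> = (\<Sum>l<N. \<Sum>k | k \<in> {..<N} \<and> k \<noteq> l. ?f M M' k l)"
    by (rule sum.swap_restrict) auto
  also have "\<dots> = (\<Sum>l<N. \<Sum>k | k \<in> {..<N} \<and> k \<noteq> l. ?f M' M l k)"
    by (rule sum.cong[OF refl], rule sum.cong[OF refl], rule f) simp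
  also have "\<dots> = cross_act N \<kappa> M' M K y z"
    unfolding cross_act_def by (intro sum.cong) auto
  finally show "cross_act N \<kappa> M M' K y z = cross_act N \<kappa> M' M K y z" .
qed

text \<open>If both matrices act at coordinate \<open>k\<close>, the inner one sees the type
  \<open>t\<close> just put there and its update overwrites the outer one; summing over
  \<open>t\<close> is matrix multiplication. At another coordinate the inner matrix sees the
  original type, which gives \<open>cross_act\<close>.\<close>

lemma mat_act_mat_act:
  assumes "\<kappa> \<in> vertices N" "y \<in> vertices N" "z \<in> vertices N"
  shows "mat_act N \<kappa> M (mat_act N \<kappa> M' K) y z =
    mat_act N \<kappa> (M ** M') K y z + cross_act N \<kappa> M M' K y z"
proof -
  let ?ty = "\<lambda>k. sign_type (\<kappa> ! k) (y ! k) (z ! k)"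
  let ?g = "\<lambda>k t l. \<Sum>s\<in>UNIV. M' $ sign_type (\<kappa> ! l) (put_fst \<kappa> k t y ! l) (put_snd \<kappa> k t z ! l) $ s *
     K (put_fst \<kappa> l s (put_fst \<kappa> k t y)) (put_snd \<kappa> l s (put_snd \<kappa> k t z))"
  have diag: "(\<Sum>t\<in>UNIV. M $ ?ty k $ t * ?g k t k) =
      (\<Sum>s\<in>UNIV. (M ** M') $ ?ty k $ s * K (put_fst \<kappa> k s y) (put_snd \<kappa> k s z))"
    if "k < N" for k
  proof -
    have "(\<Sum>t\<in>UNIV. M $ ?ty k $ t * ?g k t k) =
      (\<Sum>t\<in>UNIV. \<Sum>s\<in>UNIV. M $ ?ty k $ t * M' $ t $ s * K (put_fst \<kappa> k s y) (put_snd \<kappa> k s z))"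
      by (simp add: sign_type_put_same[OF assms that] put_put sum_distrib_left mult.assoc)
    also have "\<dots> = (\<Sum>s\<in>UNIV. \<Sum>t\<in>UNIV. M $ ?ty k $ t * M' $ t $ s * K (put_fst \<kappa> k s y) (put_snd \<kappa> k s z))"
      by (rule sum.swap)
    finally show ?thesis
      by (simp add: matrix_matrix_mult_def sum_distrib_right)
  qed
  have off: "(\<Sum>t\<in>UNIV. \<Sum>l\<in>{..<N} - {k}. M $ ?ty k $ t * ?g k t l) =
      (\<Sum>l\<in>{..<N} - {k}. \<Sum>t\<in>UNIV. \<Sum>s\<in>UNIV. M $ ?ty k $ t * M' $ ?ty l $ s *
     K (put_fst \<kappa> l s (put_fst \<kappa> k t y)) (put_snd \<kappa> l s (put_snd \<kappa> k t z)))" for k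
    by (subst sum.swap) (intro sum.cong refl, simp add: put_nth_other sum_distrib_left mult.assoc)
  have "mat_act N \<kappa> M (mat_act N \<kappa> M' K) y z = (\<Sum>k<N. \<Sum>t\<in>UNIV. M $ ?ty k $ t * (\<Sum>l<N. ?g k t l))"
    unfolding mat_act_def ..
  also have "\<dots> = (\<Sum>k<N. (\<Sum>t\<in>UNIV. M $ ?ty k $ t * ?g k t k) +
      (\<Sum>t\<in>UNIV. \<Sum>l\<in>{..<N} - {k}. M $ ?ty k $ t * ?g k t l))"
    by (intro sum.cong refl)
      (simp add: sum.remove[of "{..<N}" _ "?g _ _"] distrib_left sum.distrib sum_distrib_left)
  also have "\<dots> = mat_act N \<kappa> (M ** M') K y z + cross_act N \<kappa> M M' K y z"
    using diag off by (simp add: sum.distrib mat_act_def cross_act_def)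
  finally show ?thesis .
qed

lemma mat_act_add_left: "mat_act N \<kappa> (M + M') K y z = mat_act N \<kappa> M K y z + mat_act N \<kappa> M' K y z"
  by (simp add: mat_act_def distrib_right sum.distrib)

lemma mat_act_diff_left: "mat_act N \<kappa> (M - M') K y z = mat_act N \<kappa> M K y z - mat_act N \<kappa> M' K y z"
  by (simp add: mat_act_def left_diff_distrib sum_subtractf)

lemma mat_act_mscale: "mat_act N \<kappa> (mscale c M) K y z = c * mat_act N \<kappa> M K y z"
  by (simp add: mat_act_def mscale_entry sum_distrib_left mult.assoc)

lemma mat_act_add: "mat_act N \<kappa> M (\<lambda>y z. K y z + K' y z) y z = mat_act N \<kappa> M K y z + mat_act N \<kappa> M K' y z"
  by (simp add: mat_act_def distrib_left sum.distrib)

lemma mat_act_scale: "mat_act N \<kappa> M (\<lambda>y z. c * K y z) y z = c * mat_act N \<kappa> M K y z"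
  by (simp add: mat_act_def sum_distrib_left mult_ac)

text \<open>The cross terms are symmetric in the two matrices and cancel in the difference.\<close>

lemma mat_act_bracket:
  assumes "\<kappa> \<in> vertices N" "y \<in> vertices N" "z \<in> vertices N"
  shows "mat_act N \<kappa> (bracket M M') K y z =
    mat_act N \<kappa> M (mat_act N \<kappa> M' K) y z - mat_act N \<kappa> M' (mat_act N \<kappa> M K) y z"
  by (simp add: mat_act_mat_act[OF assms] cross_act_commute[of N \<kappa> M'] bracket_def mat_act_diff_left)

lemma mat_act_cong:
  assumes "\<kappa> \<in> vertices N" "y \<in> vertices N" "z \<in> vertices N"
    and "\<And>y z. y \<in> vertices N \<Longrightarrow> z \<in> vertices N \<Longrightarrow> K y z = K' y z"
  shows "mat_act N \<kappa> M K y z = mat_act N \<kappa> M K' y z"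
  unfolding mat_act_def using assms put_in by simp

lemma list_update_nth_eq: "xs ! i = a \<Longrightarrow> xs[i := a] = xs"
  by auto

section \<open>The six generators as flips and distance multipliers\<close>

definition ker_A ::
  "nat \<Rightarrow> nat \<Rightarrow> (vertex \<Rightarrow> vertex \<Rightarrow> complex) \<Rightarrow> vertex \<Rightarrow> vertex \<Rightarrow> complex" where
  "ker_A N k K y z = sel k (\<Sum>i<N. K (flip i y) (flip i z)) (\<Sum>i<N. K (flip i y) z) (\<Sum>i<N. K y (flip i z))"

definition ker_A_star ::
  "nat \<Rightarrow> vertex \<Rightarrow> nat \<Rightarrow> (vertex \<Rightarrow> vertex \<Rightarrow> complex) \<Rightarrow> vertex \<Rightarrow> vertex \<Rightarrow> complex" where
  "ker_A_star N \<kappa> k K y z = theta N (sel k (hamm N y z) (hamm N z \<kappa>) (hamm N \<kappa> y)) * K y z"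

text \<open>The row of \<open>gen k\<close> at the current type has its single 1 at the type
  \<open>klein k\<close> sends it to. With the sign of \<kappa> kept, passing to that type flips
  both entries for the first generator and one of them for the other two.\<close>

lemma mat_act_gen:
  assumes "\<kappa> \<in> vertices N" "y \<in> vertices N" "z \<in> vertices N"
  shows "mat_act N \<kappa> (gen k) K y z = ker_A N k K y z"
proof -
  have "(\<Sum>t\<in>UNIV. gen k $ sign_type (\<kappa> ! i) (y ! i) (z ! i) $ t * K (put_fst \<kappa> i t y) (put_snd \<kappa> i t z))
     = sel k (K (flip i y) (flip i z)) (K (flip i y) z) (K y (flip i z))" if "i < N" for i
  proof -
    let ?ty = "sign_type (\<kappa> ! i) (y ! i) (z ! i)"
    have "(\<Sum>t\<in>UNIV. gen k $ ?ty $ t * K (put_fst \<kappa> i t y) (put_snd \<kappa> i t z)) =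
        (\<Sum>t\<in>UNIV. if t = klein k ?ty then K (put_fst \<kappa> i t y) (put_snd \<kappa> i t z) else 0)"
      by (intro sum.cong refl) (simp add: gen_entry klein_sym[of ?ty])
    also have "\<dots> = K (put_fst \<kappa> i (klein k ?ty) y) (put_snd \<kappa> i (klein k ?ty) z)"
      by simp
    also have "\<dots> = sel k (K (flip i y) (flip i z)) (K (flip i y) z) (K y (flip i z))"
      using vertex_nth[OF assms(1) that] vertex_nth[OF assms(2) that] vertex_nth[OF assms(3) that]
      by (elim disjE) (simp_all add: list_update_nth_eq put_fst_def put_snd_def klein_def sign_type_def flip_def sel_def numeral_4_distinct)
    finally show ?thesis .
  qed
  then show ?thesis unfolding mat_act_def by (simp add: ker_A_def sel_def)
qed

text \<open>The diagonal entry at a type is the product of two of the three signs, and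
  \<open>theta_hamm\<close> adds these products up over the coordinates.\<close>

lemma mat_act_gen_star:
  assumes "\<kappa> \<in> vertices N" "y \<in> vertices N" "z \<in> vertices N"
  shows "mat_act N \<kappa> (gen_star k) K y z = ker_A_star N \<kappa> k K y z"
proof -
  have "(\<Sum>t\<in>UNIV. gen_star k $ sign_type (\<kappa> ! i) (y ! i) (z ! i) $ t * K (put_fst \<kappa> i t y) (put_snd \<kappa> i t z))
     = of_int (sel k (y ! i * z ! i) (z ! i * \<kappa> ! i) (\<kappa> ! i * y ! i)) * K y z" if "i < N" for i
  proof -
    let ?ty = "sign_type (\<kappa> ! i) (y ! i) (z ! i)"
    have "(\<Sum>t\<in>UNIV. gen_star k $ ?ty $ t * K (put_fst \<kappa> i t y) (put_snd \<kappa> i t z)) =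
        (\<Sum>t\<in>UNIV. if t = ?ty then gen_star k $ t $ t * K (put_fst \<kappa> i t y) (put_snd \<kappa> i t z) else 0)"
      by (intro sum.cong refl) (simp add: gen_star_entry)
    also have "\<dots> = gen_star k $ ?ty $ ?ty * K (put_fst \<kappa> i ?ty y) (put_snd \<kappa> i ?ty z)"
      by simp
    also have "\<dots> = of_int (sel k (y ! i * z ! i) (z ! i * \<kappa> ! i) (\<kappa> ! i * y ! i)) * K y z"
      using vertex_nth[OF assms(1) that] vertex_nth[OF assms(2) that] vertex_nth[OF assms(3) that]
      by (elim disjE) (simp_all add: list_update_nth_eq put_fst_def put_snd_def gen_star_entry sign_type_def sel_def numeral_4_distinct)
    finally show ?thesis .
  qed
  then show ?thesis unfolding mat_act_def ker_A_star_def
    by (simp add: sel_def theta_hamm assms sum_distrib_right)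
qed


section \<open>Endomorphisms as kernels\<close>

text \<open>Vanishing off \<open>V N\<close> puts the map into \<open>Endo\<close>, and only the
  values of the kernel at vertices count; equality of operators is therefore equality of kernels on
  vertices.\<close>

definition op :: "nat \<Rightarrow> (vertex \<Rightarrow> vertex \<Rightarrow> complex) \<Rightarrow> cvec \<Rightarrow> cvec" where
  "op N K v = (\<lambda>y. if v \<in> V N \<and> y \<in> vertices N then \<Sum>z\<in>vertices N. K y z * v z else 0)"

definition ker :: "(cvec \<Rightarrow> cvec) \<Rightarrow> vertex \<Rightarrow> vertex \<Rightarrow> complex" where
  "ker F y z = F (basis_vec z) y"

definition ker_mult :: "nat \<Rightarrow> (vertex \<Rightarrow> vertex \<Rightarrow> complex) \<Rightarrow> (vertex \<Rightarrow> vertex \<Rightarrow> complex) \<Rightarrow> vertex \<Rightarrow> vertex \<Rightarrow> complex" where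
  "ker_mult N K K' y z = (\<Sum>w\<in>vertices N. K y w * K' w z)"

definition ker_diag :: "(vertex \<Rightarrow> complex) \<Rightarrow> vertex \<Rightarrow> vertex \<Rightarrow> complex" where
  "ker_diag f y z = (if y = z then f z else 0)"

lemma V_iff: "v \<in> V N \<longleftrightarrow> (\<forall>a. a \<notin> vertices N \<longrightarrow> v a = 0)"
  by (simp add: V_def free_space_def)

lemma subspace_V: "module.subspace smul (V N)"
  by (auto simp: subspace_smul_iff V_iff smul_def)

lemma basis_vec_V [simp]: "x \<in> vertices N \<Longrightarrow> basis_vec x \<in> V N"
  by (auto simp: V_iff basis_vec_def)

lemma op_in_V: "op N K v \<in> V N"
  by (simp add: V_iff op_def)

lemma op_Endo: "op N K \<in> Endo smul (V N)"
proof -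
  have "u + v \<in> V N" "smul c u \<in> V N" if "u \<in> V N" "v \<in> V N" for u v c
    using that by (auto simp: V_iff smul_def)
  then show ?thesis
    unfolding Endo_def linear_on_def
    by (auto simp: op_in_V) (auto simp: op_def fun_eq_iff smul_def distrib_left sum.distrib sum_distrib_left mult_ac)
qed

lemma vec_decompose:
  assumes "v \<in> V N"
  shows "v = (\<Sum>z\<in>vertices N. smul (v z) (basis_vec z))"
proof
  fix y
  have "(\<Sum>z\<in>vertices N. smul (v z) (basis_vec z)) y = (\<Sum>z\<in>vertices N. if y = z then v z else 0)"
    unfolding sum_fun_apply by (intro sum.cong refl) (simp add: smul_def basis_vec_def)
  also have "\<dots> = v y" using assms by (simp add: V_iff)
  finally show "v y = (\<Sum>z\<in>vertices N. smul (v z) (basis_vec z)) y" ..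
qed

lemma op_basis_vec: "z \<in> vertices N \<Longrightarrow> y \<in> vertices N \<Longrightarrow> op N K (basis_vec z) y = K y z"
proof -
  assume z: "z \<in> vertices N" and "y \<in> vertices N"
  then have "op N K (basis_vec z) y = (\<Sum>w\<in>vertices N. K y w * basis_vec z w)"
    by (simp add: op_def)
  also have "\<dots> = (\<Sum>w\<in>vertices N. if w = z then K y w else 0)"
    by (intro sum.cong refl) (simp add: basis_vec_def)
  finally have "op N K (basis_vec z) y = (\<Sum>w\<in>vertices N. if w = z then K y w else 0)" .
  then show ?thesis using z by simp
qed

lemma ker_op: "y \<in> vertices N \<Longrightarrow> z \<in> vertices N \<Longrightarrow> ker (op N K) y z = K y z"
  by (simp add: ker_def op_basis_vec)

lemma op_ker:
  assumes "F \<in> Endo smul (V N)"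
  shows "op N (ker F) = F"
proof (intro ext)
  fix v y
  have lin: "linear_on smul smul (V N) (V N) F" and out: "v \<notin> V N \<Longrightarrow> F v = 0"
    using assms by (auto simp: Endo_def)
  show "op N (ker F) v y = F v y"
  proof (cases "v \<in> V N")
    case True
    have FV: "F v \<in> V N" using lin True by (simp add: linear_on_def)
    have "F v = (\<Sum>z\<in>vertices N. smul (v z) (F (basis_vec z)))"
      using linear_on_sum[OF vector_space_smul subspace_V vector_space_smul lin finite_vertices,
          of N basis_vec v] vec_decompose[OF True] by simp
    then have "F v y = (\<Sum>z\<in>vertices N. ker F y z * v z)"
      by (simp add: sum_fun_apply smul_def ker_def mult.commute)
    then show ?thesis using True FV by (auto simp: op_def V_iff)
  next
    case False
    then show ?thesis using out by (simp add: op_def)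
  qed
qed

lemma op_cong:
  "(\<And>y z. y \<in> vertices N \<Longrightarrow> z \<in> vertices N \<Longrightarrow> K y z = K' y z) \<Longrightarrow> op N K = op N K'"
  unfolding op_def fun_eq_iff by (auto intro!: sum.cong)

lemma op_eq_iff:
  "op N K = op N K' \<longleftrightarrow> (\<forall>y\<in>vertices N. \<forall>z\<in>vertices N. K y z = K' y z)"
  by (metis ker_op op_cong)

lemma op_add: "op N K + op N K' = op N (\<lambda>y z. K y z + K' y z)"
  by (auto simp: op_def fun_eq_iff distrib_right sum.distrib)

lemma op_diff: "op N K - op N K' = op N (\<lambda>y z. K y z - K' y z)"
  by (auto simp: op_def fun_eq_iff left_diff_distrib sum_subtractf)

lemma op_emul: "emul c (op N K) = op N (\<lambda>y z. c * K y z)"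
  by (auto simp: op_def emul_def smul_def fun_eq_iff sum_distrib_left mult.assoc)

lemma op_zero: "op N (\<lambda>y z. 0) = 0"
  by (auto simp: op_def fun_eq_iff)

lemma op_sum: "(\<Sum>p\<in>P. op N (K p)) = op N (\<lambda>y z. \<Sum>p\<in>P. K p y z)"
  by (induction P rule: infinite_finite_induct) (auto simp: op_zero op_add)

lemma op_comp: "op N K \<circ> op N K' = op N (ker_mult N K K')"
proof (intro ext)
  fix v y
  have "(\<Sum>w\<in>vertices N. K y w * (\<Sum>z\<in>vertices N. K' w z * v z)) =
      (\<Sum>z\<in>vertices N. (\<Sum>w\<in>vertices N. K y w * K' w z) * v z)"
    by (simp add: sum_distrib_left sum_distrib_right mult.assoc) (rule sum.swap)
  then show "(op N K \<circ> op N K') v y = op N (ker_mult N K K') v y"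
    using op_in_V[of N K' v] by (simp add: op_def ker_mult_def)
qed

lemma op_id: "op N (ker_diag (\<lambda>_. 1)) = id_endo (V N)"
proof (intro ext)
  fix v y
  have "(\<Sum>z\<in>vertices N. ker_diag (\<lambda>_. 1) y z * v z) = (\<Sum>z\<in>vertices N. if y = z then v z else 0)"
    by (intro sum.cong refl) (simp add: ker_diag_def)
  then show "op N (ker_diag (\<lambda>_. 1)) v y = id_endo (V N) v y"
    by (auto simp: op_def id_endo_def V_iff)
qed

text \<open>The image of the basis vector at \<open>x\<close> is column \<open>x\<close> of the
  kernel, hence the reversed arguments. All concrete maps on \<open>V\<close> are converted to
  kernels this way.\<close>

lemma lin_ext_op:
  assumes "\<And>x y. x \<in> vertices N \<Longrightarrow> g x y = (if y \<in> vertices N then K y x else 0)"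
  shows "lin_ext smul (vertices N) g = op N K"
  using assms
  by (auto simp: fun_eq_iff lin_ext_def op_def sum_fun_apply smul_def V_def mult.commute intro!: sum.cong)

lemma Ah_op: "Ah N h = op N (\<lambda>y z. if hamm N y z = h then 1 else 0)"
  unfolding Ah_def
proof (rule lin_ext_op)
  fix x y assume x: "x \<in> vertices N"
  have fin: "finite (sphere_at N h x)" by (simp add: sphere_at_def)
  have "(\<Sum>\<xi>\<in>sphere_at N h x. basis_vec \<xi>) y = (\<Sum>\<xi>\<in>sphere_at N h x. if y = \<xi> then 1 else 0)"
    by (simp add: sum_fun_apply basis_vec_def)
  also have "\<dots> = (if y \<in> sphere_at N h x then 1 else 0)" using fin by simp
  finally show "(\<Sum>\<xi>\<in>sphere_at N h x. basis_vec \<xi>) y =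
      (if y \<in> vertices N then if hamm N y x = h then 1 else 0 else 0)"
    using x by (auto simp: sphere_at_def gdist_eq hamm_commute)
qed

lemma idem_star_op:
  assumes "\<kappa> \<in> vertices N"
  shows "idem_star N \<kappa> i = op N (ker_diag (\<lambda>x. if hamm N x \<kappa> = i then 1 else 0))"
  unfolding idem_star_def using assms
  by (intro lin_ext_op) (auto simp: gdist_eq basis_vec_def ker_diag_def)

lemma adjacency_star_op:
  assumes "\<kappa> \<in> vertices N"
  shows "adjacency_star N \<kappa> = op N (ker_diag (\<lambda>x. theta N (hamm N x \<kappa>)))"
  unfolding adjacency_star_def using assms
  by (intro lin_ext_op) (auto simp: gdist_eq basis_vec_def smul_def ker_diag_def)

lemma Ah_star_op: "Ah_star N \<kappa> h = op N (ker_diag (\<lambda>x. 2 ^ N * idem N h (basis_vec \<kappa>) x))"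
proof -
  have herm: "herm N u (basis_vec x) = u x" if "x \<in> vertices N" for u x
  proof -
    have "herm N u (basis_vec x) = (\<Sum>w\<in>vertices N. if w = x then u w else 0)"
      unfolding herm_def by (intro sum.cong refl) (simp add: basis_vec_def)
    then show ?thesis using that by simp
  qed
  show ?thesis
    unfolding Ah_star_def
    by (rule lin_ext_op) (simp add: herm smul_def ker_diag_def, simp add: basis_vec_def)
qed

lemma e_unit_op:
  assumes "x \<in> vertices N"
  shows "e_unit N x y = op N (\<lambda>a b. if a = x \<and> b = y then 1 else 0)"
  unfolding e_unit_def using assms
  by (intro lin_ext_op) (auto simp: basis_vec_def)

lemma eps_op:
  assumes "f \<in> V3 N" and \<kappa>: "\<kappa> \<in> vertices N"
  shows "eps N \<kappa> f = op N (\<lambda>y z. of_real (2 powr (real N / 2)) * f (\<kappa>, y, z))"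
proof -
  let ?c = "of_real (2 powr (real N / 2)) :: complex"
  have f: "f \<in> free_space (triples N)" using assms by (simp add: V3_def)
  have "eps N \<kappa> f = (\<Sum>t\<in>triples N. op N (\<lambda>a b. if t = (\<kappa>, a, b) then ?c * f t else 0))"
    unfolding eps_def lin_ext_def using f
    by (auto intro!: sum.cong op_cong simp: e_unit_op op_emul simp flip: op_zero[of N])
  also have "\<dots> = op N (\<lambda>a b. \<Sum>t\<in>triples N. if t = (\<kappa>, a, b) then ?c * f t else 0)"
    by (rule op_sum)
  also have "\<dots> = op N (\<lambda>y z. ?c * f (\<kappa>, y, z))"
    using \<kappa> by (intro op_cong) (simp add: sum.delta)
  finally show ?thesis .
qed


section \<open>Automorphisms of the hypercube\<close>

lemma Aut_adj:
  "g \<in> Aut N \<Longrightarrow> x \<in> vertices N \<Longrightarrow> y \<in> vertices N \<Longrightarrow> (g x, g y) \<in> adj N \<longleftrightarrow> (x, y) \<in> adj N"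
  unfolding Aut_def by blast

lemma Aut_permutes: "g \<in> Aut N \<Longrightarrow> g permutes vertices N"
  unfolding Aut_def by blast

lemma Aut_in: "g \<in> Aut N \<Longrightarrow> x \<in> vertices N \<Longrightarrow> g x \<in> vertices N"
  using permutes_in_image[OF Aut_permutes] by blast

lemma Aut_bij: "g \<in> Aut N \<Longrightarrow> bij_betw g (vertices N) (vertices N)"
  using permutes_imp_bij[OF Aut_permutes] .

lemma Aut_inv:
  assumes "g \<in> Aut N"
  shows "inv g \<in> Aut N"
proof -
  note g = Aut_permutes[OF assms]
  have "(inv g x, inv g y) \<in> adj N \<longleftrightarrow> (x, y) \<in> adj N" if "x \<in> vertices N" "y \<in> vertices N" for x y
  proof -
    have "inv g x \<in> vertices N" "inv g y \<in> vertices N"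
      using that permutes_in_image[OF permutes_inv[OF g]] by blast+
    from Aut_adj[OF assms this] show ?thesis unfolding permutes_inverses[OF g] ..
  qed
  then show ?thesis unfolding Aut_def using permutes_inv[OF g] by blast
qed

text \<open>An automorphism carries a shortest walk to a walk of the same length; the inverse
  automorphism supplies the opposite inequality.\<close>

lemma Aut_hamm_le:
  assumes "g \<in> Aut N" "x \<in> vertices N" "y \<in> vertices N"
  shows "hamm N (g x) (g y) \<le> hamm N x y"
proof -
  have "(x, y) \<in> adj N ^^ n \<Longrightarrow> (g x, g y) \<in> adj N ^^ n" for n x y
  proof (induction n arbitrary: y)
    case (Suc n)
    then obtain w where w: "(x, w) \<in> adj N ^^ n" "(w, y) \<in> adj N" by auto
    have "w \<in> vertices N" "y \<in> vertices N" using w(2) unfolding adj_iff by blast+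
    then have "(g w, g y) \<in> adj N" using w(2) Aut_adj[OF assms(1)] by blast
    then show ?case using Suc.IH[OF w(1)] by auto
  qed simp
  then show ?thesis using relpow_hamm[OF assms(2,3) refl] hamm_relpow by blast
qed

lemma Aut_hamm:
  assumes "g \<in> Aut N" "x \<in> vertices N" "y \<in> vertices N"
  shows "hamm N (g x) (g y) = hamm N x y"
proof -
  note g = Aut_permutes[OF assms(1)]
  have "hamm N (inv g (g x)) (inv g (g y)) \<le> hamm N (g x) (g y)"
    by (rule Aut_hamm_le[OF Aut_inv[OF assms(1)] Aut_in[OF assms(1,2)] Aut_in[OF assms(1,3)]])
  then show ?thesis using Aut_hamm_le[OF assms] by (simp add: permutes_inverses[OF g])
qed

section \<open>Orbits of the automorphism group on vertex triples\<close>

lemma card_diff_split: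
  assumes "finite A"
  shows "card A = card (A \<inter> B) + card (A - B)"
  using assms card_Int_Diff by blast

text \<open>With only two signs, \<open>y\<close> and \<open>z\<close> differ exactly where one of
  them, but not the other, differs from \<open>x\<close>: the difference set of \<open>y\<close> and
  \<open>z\<close> is a symmetric difference.\<close>

lemma hamm_common:
  assumes "x \<in> vertices N" "y \<in> vertices N" "z \<in> vertices N"
  shows "2 * card {k. k < N \<and> x ! k \<noteq> y ! k \<and> x ! k \<noteq> z ! k} + hamm N y z = hamm N x y + hamm N x z"
proof -
  let ?A = "{k. k < N \<and> x ! k \<noteq> y ! k}" and ?B = "{k. k < N \<and> x ! k \<noteq> z ! k}"
  have sym: "{k. k < N \<and> y ! k \<noteq> z ! k} = (?A - ?B) \<union> (?B - ?A)"
    using vertex_nth[OF assms(1)] vertex_nth[OF assms(2)] vertex_nth[OF assms(3)] by fastforce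
  have "hamm N y z = card (?A - ?B) + card (?B - ?A)"
    unfolding hamm_def sym by (rule card_Un_disjoint) auto
  moreover have "hamm N x y = card (?A \<inter> ?B) + card (?A - ?B)"
    unfolding hamm_def by (rule card_diff_split) simp
  moreover have "hamm N x z = card (?A \<inter> ?B) + card (?B - ?A)"
    unfolding hamm_def by (subst Int_commute, rule card_diff_split) simp
  moreover have "?A \<inter> ?B = {k. k < N \<and> x ! k \<noteq> y ! k \<and> x ! k \<noteq> z ! k}" by auto
  ultimately show ?thesis by simp
qed

text \<open>The overlap \<open>m\<close> is fixed by the three distances, and inclusion and
  exclusion give the other classes. The truncated subtractions and the halving are exact by
  \<open>hamm_common\<close>.\<close>

lemma card_pattern:
  assumes "x \<in> vertices N" "y \<in> vertices N" "z \<in> vertices N"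
  defines "m \<equiv> (hamm N x y + hamm N x z - hamm N y z) div 2"
  shows "card {k. k < N \<and> (x ! k \<noteq> y ! k) = a \<and> (x ! k \<noteq> z ! k) = b} =
    (if a then if b then m else hamm N x y - m else if b then hamm N x z - m
      else N + m - hamm N x y - hamm N x z)"
proof -
  let ?A = "{k. k < N \<and> x ! k \<noteq> y ! k}" and ?B = "{k. k < N \<and> x ! k \<noteq> z ! k}"
  have AB: "?A \<inter> ?B = {k. k < N \<and> x ! k \<noteq> y ! k \<and> x ! k \<noteq> z ! k}" by auto
  have m: "card (?A \<inter> ?B) = m" using hamm_common[OF assms(1-3)] unfolding AB m_def by simp
  have A: "hamm N x y = m + card (?A - ?B)"
    unfolding hamm_def m[symmetric] by (rule card_diff_split) simp
  have B: "hamm N x z = m + card (?B - ?A)"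
    unfolding hamm_def m[symmetric] by (subst Int_commute, rule card_diff_split) simp
  have "card {..<N} = card ({..<N} \<inter> ?A) + card ({..<N} - ?A)"
    by (rule card_diff_split) simp
  also have "card ({..<N} - ?A) = card (({..<N} - ?A) \<inter> ?B) + card ({..<N} - ?A - ?B)"
    by (rule card_diff_split) simp
  also have "{..<N} \<inter> ?A = ?A" by auto
  also have "({..<N} - ?A) \<inter> ?B = ?B - ?A" by auto
  finally have "N = hamm N x y + card (?B - ?A) + card ({..<N} - ?A - ?B)"
    by (simp add: hamm_def)
  then have C: "card ({..<N} - ?A - ?B) = N + m - hamm N x y - hamm N x z" using B by simp
  have "{k. k < N \<and> (x ! k \<noteq> y ! k) = a \<and> (x ! k \<noteq> z ! k) = b} =
      (if a then if b then ?A \<inter> ?B else ?A - ?B else if b then ?B - ?A else {..<N} - ?A - ?B)"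
    by auto
  then show ?thesis using m A B C by simp
qed

text \<open>A coordinate permutation followed by sign changes; the factor
  \<open>x ! p k * x' ! k\<close> is the sign change that makes the map send \<open>x\<close> to
  \<open>x'\<close>.\<close>

lemma Aut_coordinates:
  assumes x: "x \<in> vertices N" "x' \<in> vertices N" and p: "p permutes {..<N}"
  defines "g \<equiv> \<lambda>u. if u \<in> vertices N then map (\<lambda>k. u ! p k * x ! p k * x' ! k) [0..<N] else u"
  shows "g \<in> Aut N"
proof -
  have pN: "p k < N" if "k < N" for k using permutes_in_image[OF p, of k] that by simp
  have g_nth: "g u ! k = u ! p k * x ! p k * x' ! k" if "u \<in> vertices N" "k < N" for u k
    using that by (simp add: g_def)
  have g_in: "g u \<in> vertices N" if u: "u \<in> vertices N" for u
  proof -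
    have "g u ! k = 1 \<or> g u ! k = -1" if "k < N" for k
      using vertex_nth[OF u pN[OF that]] vertex_nth[OF x(1) pN[OF that]] vertex_nth[OF x(2) that]
      by (auto simp: g_nth[OF u that])
    then show ?thesis using u by (simp add: vertices_iff g_def)
  qed
  have hamm: "hamm N (g u) (g v) = hamm N u v" if u: "u \<in> vertices N" and v: "v \<in> vertices N" for u v
  proof -
    have "g u ! k \<noteq> g v ! k \<longleftrightarrow> u ! p k \<noteq> v ! p k" if "k < N" for k
      using vertex_nth[OF x(1) pN[OF that]] vertex_nth[OF x(2) that]
      by (auto simp: g_nth[OF u that] g_nth[OF v that])
    then have eq: "g u ! k \<noteq> g v ! k \<longleftrightarrow> u ! p k \<noteq> v ! p k" if "k < N" for k using that .
    have "k \<in> p ` {k. k < N \<and> g u ! k \<noteq> g v ! k}" if k: "k < N" "u ! k \<noteq> v ! k" for k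
    proof (rule image_eqI)
      show "k = p (inv p k)" by (simp add: permutes_inverses[OF p])
      have "inv p k < N" using permutes_in_image[OF permutes_inv[OF p], of k] k(1) by simp
      then show "inv p k \<in> {k. k < N \<and> g u ! k \<noteq> g v ! k}"
        using k(2) by (simp add: eq permutes_inverses[OF p])
    qed
    then have "{k. k < N \<and> u ! k \<noteq> v ! k} = p ` {k. k < N \<and> g u ! k \<noteq> g v ! k}"
      using eq pN by blast
    moreover have "inj_on p {k. k < N \<and> g u ! k \<noteq> g v ! k}"
      using permutes_inj[OF p] by (rule inj_on_subset) simp
    ultimately show ?thesis unfolding hamm_def by (simp add: card_image)
  qed
  \<comment> \<open>Preserving distances forces injectivity, and finiteness of the vertex set then
    gives bijectivity.\<close>
  have inj: "inj_on g (vertices N)"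
    by (rule inj_onI) (metis hamm hamm_0_iff g_in)
  then have "bij_betw g (vertices N) (vertices N)"
    using g_in by (simp add: bij_betw_def endo_inj_surj image_subsetI)
  then have "g permutes vertices N"
    by (rule bij_imp_permutes) (simp add: g_def)
  then show ?thesis using hamm g_in by (simp add: Aut_def adj_iff)
qed

lemma sign_transfer:
  fixes a b c d :: int
  assumes "a = 1 \<or> a = -1" "b = 1 \<or> b = -1" "c = 1 \<or> c = -1" "d = 1 \<or> d = -1"
    and "a \<noteq> b \<longleftrightarrow> c \<noteq> d"
  shows "b * a * c = d"
  using assms by (elim disjE) simp_all

text \<open>Each coordinate has a pattern recording where \<open>y\<close> and \<open>z\<close>
  differ from \<open>x\<close>. By \<open>card_pattern\<close> equal distances give equally many
  coordinates of each pattern, so some permutation matches the patterns, and sign changes then align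
  \<open>x\<close> with \<open>x'\<close>. Orbits on triples are thus classified by three
  distances.\<close>

lemma Aut_exists:
  assumes "x \<in> vertices N" "y \<in> vertices N" "z \<in> vertices N"
    and "x' \<in> vertices N" "y' \<in> vertices N" "z' \<in> vertices N"
    and eq: "hamm N x y = hamm N x' y'" "hamm N x z = hamm N x' z'" "hamm N y z = hamm N y' z'"
  shows "\<exists>g\<in>Aut N. g x = x' \<and> g y = y' \<and> g z = z'"
proof -
  define f where "f k = (x ! k \<noteq> y ! k, x ! k \<noteq> z ! k)" for k
  define f' where "f' k = (x' ! k \<noteq> y' ! k, x' ! k \<noteq> z' ! k)" for k
  have cnt: "count (image_mset h (mset_set {..<N})) v = card {k. k < N \<and> h k = v}"
    for h :: "nat \<Rightarrow> bool \<times> bool" and v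
    by (simp add: count_image_mset' eq_commute[of v])
  have "count (image_mset f' (mset_set {..<N})) (a, b) = count (image_mset f (mset_set {..<N})) (a, b)" for a b
    unfolding cnt f_def f'_def prod.inject
    using card_pattern[OF assms(1-3), of a b] card_pattern[OF assms(4-6), of a b]
    by (simp add: eq)
  then have "image_mset f' (mset_set {..<N}) = image_mset f (mset_set {..<N})"
    by (intro multiset_eqI) (metis surj_pair)
  then obtain p where p: "p permutes {..<N}" and fp: "\<forall>k\<in>{..<N}. f' k = f (p k)"
    using image_mset_eq_implies_permutes[of "{..<N}" f' f] by auto
  define g where "g u = (if u \<in> vertices N then map (\<lambda>k. u ! p k * x ! p k * x' ! k) [0..<N] else u)" for u
  have g: "g \<in> Aut N"
    unfolding g_def using Aut_coordinates[OF assms(1,4) p] .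
  have pN: "p k < N" if "k < N" for k using permutes_in_image[OF p, of k] that by simp
  have gu: "g u = u'"
    if u: "u \<in> vertices N" "u' \<in> vertices N"
      and pat: "\<And>k. k < N \<Longrightarrow> x ! p k \<noteq> u ! p k \<longleftrightarrow> x' ! k \<noteq> u' ! k" for u u'
  proof (rule vertex_eqI[OF Aut_in[OF g u(1)] u(2)])
    fix k assume k: "k < N"
    have "g u ! k = u ! p k * x ! p k * x' ! k" using u(1) k by (simp add: g_def)
    also have "\<dots> = u' ! k"
      using pat[OF k] vertex_nth pN[OF k] k u assms(1,4) by (intro sign_transfer) blast+
    finally show "g u ! k = u' ! k" .
  qed
  have "g x = x'" by (rule gu[OF assms(1,4)]) simp
  moreover have "g y = y'" by (rule gu[OF assms(2,5)]) (use fp in \<open>simp add: f_def f'_def\<close>)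
  moreover have "g z = z'" by (rule gu[OF assms(3,6)]) (use fp in \<open>simp add: f_def f'_def\<close>)
  ultimately show ?thesis using g by blast
qed

text \<open>Stated through the stabilizer of \<kappa>, which makes closure under products a
  reindexing; the next two lemmas give the equivalent form by distances, which suits explicit
  kernels.\<close>

definition dist_inv :: "nat \<Rightarrow> vertex \<Rightarrow> (vertex \<Rightarrow> vertex \<Rightarrow> complex) \<Rightarrow> bool" where
  "dist_inv N \<kappa> K \<longleftrightarrow> (\<forall>g\<in>Aut N. g \<kappa> = \<kappa> \<longrightarrow>
     (\<forall>y\<in>vertices N. \<forall>z\<in>vertices N. K (g y) (g z) = K y z))"

lemma dist_inv_hamm:
  assumes "\<kappa> \<in> vertices N" "dist_inv N \<kappa> K"
    "y \<in> vertices N" "z \<in> vertices N" "y' \<in> vertices N" "z' \<in> vertices N"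
    "hamm N \<kappa> y = hamm N \<kappa> y'" "hamm N \<kappa> z = hamm N \<kappa> z'" "hamm N y z = hamm N y' z'"
  shows "K y z = K y' z'"
proof -
  obtain g where g: "g \<in> Aut N" "g \<kappa> = \<kappa>" "g y = y'" "g z = z'"
    using Aut_exists[OF assms(1,3,4) assms(1,5,6) assms(7-9)] by blast
  have "K (g y) (g z) = K y z"
    using assms(2-4) g(1,2) unfolding dist_inv_def by blast
  then show ?thesis unfolding g(3,4) by simp
qed

lemma dist_invI:
  assumes "\<kappa> \<in> vertices N"
    and "\<And>y z y' z'. y \<in> vertices N \<Longrightarrow> z \<in> vertices N \<Longrightarrow> y' \<in> vertices N \<Longrightarrow> z' \<in> vertices N \<Longrightarrow>
      hamm N \<kappa> y = hamm N \<kappa> y' \<Longrightarrow> hamm N \<kappa> z = hamm N \<kappa> z' \<Longrightarrow> hamm N y z = hamm N y' z' \<Longrightarrow>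
      K y z = K y' z'"
  shows "dist_inv N \<kappa> K"
  unfolding dist_inv_def
proof (intro ballI impI)
  fix g y z assume g: "g \<in> Aut N" "g \<kappa> = \<kappa>" and yz: "y \<in> vertices N" "z \<in> vertices N"
  show "K (g y) (g z) = K y z"
  proof (rule assms(2))
    show "g y \<in> vertices N" "g z \<in> vertices N" by (rule Aut_in[OF g(1) yz(1)], rule Aut_in[OF g(1) yz(2)])
    show "hamm N \<kappa> (g y) = hamm N \<kappa> y" "hamm N \<kappa> (g z) = hamm N \<kappa> z"
      using Aut_hamm[OF g(1) assms(1) yz(1)] Aut_hamm[OF g(1) assms(1) yz(2)] unfolding g(2) by auto
    show "hamm N (g y) (g z) = hamm N y z" by (rule Aut_hamm[OF g(1) yz])
  qed (rule yz)+
qed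

text \<open>An automorphism permutes the intermediate vertices, so it can be inserted into the
  summation index.\<close>

lemma dist_inv_mult:
  assumes "dist_inv N \<kappa> K" "dist_inv N \<kappa> K'"
  shows "dist_inv N \<kappa> (ker_mult N K K')"
  unfolding dist_inv_def
proof (intro ballI impI)
  fix g y z assume g: "g \<in> Aut N" "g \<kappa> = \<kappa>" and yz: "y \<in> vertices N" "z \<in> vertices N"
  have "ker_mult N K K' (g y) (g z) = (\<Sum>w\<in>vertices N. K (g y) (g w) * K' (g w) (g z))"
    unfolding ker_mult_def by (rule sum.reindex_bij_betw[OF Aut_bij[OF g(1)], symmetric])
  also have "\<dots> = ker_mult N K K' y z"
    unfolding ker_mult_def
  proof (rule sum.cong[OF refl])
    fix w assume w: "w \<in> vertices N"
    have "K (g y) (g w) = K y w" "K' (g w) (g z) = K' w z"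
      using assms g yz w unfolding dist_inv_def by blast+
    then show "K (g y) (g w) * K' (g w) (g z) = K y w * K' w z" by simp
  qed
  finally show "ker_mult N K K' (g y) (g z) = ker_mult N K K' y z" .
qed


section \<open>Duality\<close>

text \<open>The characters of the group of sign vectors, with \<open>\<kappa>\<close> as neutral element; the matrix
  is a symmetric Hadamard matrix that exchanges \<open>A\<close> and \<open>A\<^sup>*\<close>.\<close>

definition had :: "nat \<Rightarrow> vertex \<Rightarrow> vertex \<Rightarrow> vertex \<Rightarrow> complex" where
  "had N \<kappa> y z = (\<Prod>k<N. if y ! k \<noteq> \<kappa> ! k \<and> z ! k \<noteq> \<kappa> ! k then -1 else 1)"

lemma had_commute: "had N \<kappa> y z = had N \<kappa> z y"
  unfolding had_def by (intro prod.cong) auto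

lemma had_base: "had N \<kappa> y \<kappa> = 1"
  by (simp add: had_def)

lemma had_power: "had N \<kappa> y z = (-1) ^ card {k. k < N \<and> \<kappa> ! k \<noteq> y ! k \<and> \<kappa> ! k \<noteq> z ! k}"
proof -
  have eq: "{k. k < N \<and> \<kappa> ! k \<noteq> y ! k \<and> \<kappa> ! k \<noteq> z ! k} = {k \<in> {..<N}. y ! k \<noteq> \<kappa> ! k \<and> z ! k \<noteq> \<kappa> ! k}"
    by auto
  show ?thesis
    unfolding had_def eq by (subst prod.inter_filter[symmetric]) simp_all
qed

lemma had_flip:
  assumes "\<kappa> \<in> vertices N" "y \<in> vertices N" "u \<in> vertices N" "i < N"
  shows "had N \<kappa> (flip i y) u = of_int (u ! i * \<kappa> ! i) * had N \<kappa> y u"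
proof -
  let ?c = "\<lambda>y k. if y ! k \<noteq> \<kappa> ! k \<and> u ! k \<noteq> \<kappa> ! k then -1 else (1::complex)"
  have split: "had N \<kappa> y u = ?c y i * (\<Prod>k\<in>{..<N} - {i}. ?c y k)" for y
    unfolding had_def using assms(4) by (simp only: prod.remove[of "{..<N}" i] finite_lessThan lessThan_iff)
  have rest: "(\<Prod>k\<in>{..<N} - {i}. ?c (flip i y) k) = (\<Prod>k\<in>{..<N} - {i}. ?c y k)"
    by (rule prod.cong) (simp_all add: flip_nth[OF assms(2,4)])
  have "?c (flip i y) i = of_int (u ! i * \<kappa> ! i) * ?c y i"
    unfolding flip_nth[OF assms(2,4)]
    using vertex_nth[OF assms(1,4)] vertex_nth[OF assms(2,4)] vertex_nth[OF assms(3,4)]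
    by (elim disjE) simp_all
  then show ?thesis unfolding split rest by simp
qed

text \<open>Multiplicativity of a character: \<open>translate N \<kappa> z u\<close> is the product
  of \<open>z\<close> and \<open>u\<close> in the group with neutral element \<kappa>.\<close>

lemma had_translate:
  assumes "\<kappa> \<in> vertices N" "x \<in> vertices N" "z \<in> vertices N" "u \<in> vertices N"
  shows "had N \<kappa> x (translate N \<kappa> z u) = had N \<kappa> x z * had N \<kappa> x u"
proof -
  have *: "(if a \<noteq> k \<and> k * c * d \<noteq> k then -1 else (1::complex)) =
      (if a \<noteq> k \<and> c \<noteq> k then -1 else 1) * (if a \<noteq> k \<and> d \<noteq> k then -1 else 1)"
    if "k = 1 \<or> k = -1" "c = 1 \<or> c = -1" "d = 1 \<or> d = -1" for a k c d :: int
    using that by (elim disjE) simp_all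
  show ?thesis
    unfolding had_def prod.distrib[symmetric]
    using vertex_nth[OF assms(1)] vertex_nth[OF assms(3)] vertex_nth[OF assms(4)]
    by (intro prod.cong refl) (simp only: translate_nth lessThan_iff *)
qed

lemma hamm_translate:
  assumes "x \<in> vertices N" "y \<in> vertices N"
  shows "hamm N (translate N x y u) (translate N x y v) = hamm N u v"
proof -
  have "translate N x y u ! k \<noteq> translate N x y v ! k \<longleftrightarrow> u ! k \<noteq> v ! k" if "k < N" for k
    unfolding translate_nth[OF that]
    using vertex_nth[OF assms(1) that] vertex_nth[OF assms(2) that] by (elim disjE) simp_all
  then have "{k. k < N \<and> translate N x y u ! k \<noteq> translate N x y v ! k} = {k. k < N \<and> u ! k \<noteq> v ! k}"
    by blast
  then show ?thesis by (simp add: hamm_def)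
qed

lemma bij_translate:
  assumes "x \<in> vertices N" "y \<in> vertices N"
  shows "bij_betw (translate N x y) (vertices N) (vertices N)"
  by (rule bij_betw_byWitness[where f' = "translate N x y"])
    (use assms in \<open>auto simp: translate_translate\<close>)

lemma bij_flip: "bij_betw (flip k) (vertices N) (vertices N)"
  by (rule bij_betw_byWitness[where f' = "flip k"]) auto

section \<open>Kernel products and conjugation by the Hadamard matrix\<close>

lemma ker_mult_assoc: "ker_mult N (ker_mult N K L) M = ker_mult N K (ker_mult N L M)"
proof (intro ext)
  fix y z
  show "ker_mult N (ker_mult N K L) M y z = ker_mult N K (ker_mult N L M) y z"
    unfolding ker_mult_def sum_distrib_left sum_distrib_right mult.assoc by (rule sum.swap)
qed

lemma ker_mult_cong:
  assumes "\<And>w. w \<in> vertices N \<Longrightarrow> K y w = K' y w" "\<And>w. w \<in> vertices N \<Longrightarrow> L w z = L' w z"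
  shows "ker_mult N K L y z = ker_mult N K' L' y z"
  unfolding ker_mult_def using assms by (intro sum.cong) auto

lemma ker_mult_scale:
  "ker_mult N (\<lambda>y z. c * K y z) L = (\<lambda>y z. c * ker_mult N K L y z)"
  "ker_mult N K (\<lambda>y z. c * L y z) = (\<lambda>y z. c * ker_mult N K L y z)"
  by (simp_all add: ker_mult_def fun_eq_iff sum_distrib_left mult_ac)

lemma ker_mult_diag:
  shows ker_mult_diag_left: "y \<in> vertices N \<Longrightarrow> ker_mult N (ker_diag f) K y z = f y * K y z"
    and ker_mult_diag_right: "z \<in> vertices N \<Longrightarrow> ker_mult N K (ker_diag f) y z = K y z * f z"
proof -
  assume y: "y \<in> vertices N"
  have "ker_mult N (ker_diag f) K y z = (\<Sum>w\<in>vertices N. if y = w then f w * K w z else 0)"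
    unfolding ker_mult_def by (intro sum.cong refl) (simp add: ker_diag_def)
  then show "ker_mult N (ker_diag f) K y z = f y * K y z" using y by simp
next
  assume z: "z \<in> vertices N"
  have "ker_mult N K (ker_diag f) y z = (\<Sum>w\<in>vertices N. if w = z then K y w * f w else 0)"
    unfolding ker_mult_def by (intro sum.cong refl) (simp add: ker_diag_def)
  then show "ker_mult N K (ker_diag f) y z = K y z * f z" using z by simp
qed

context
  fixes N :: nat and \<kappa> :: vertex
  assumes \<kappa>: "\<kappa> \<in> vertices N"
begin

abbreviation "H \<equiv> had N \<kappa>"

text \<open>If \<open>y\<close> and \<open>z\<close> differ at \<open>i\<close>, flipping coordinate
  \<open>i\<close> of the summation variable negates each summand, so the sum equals its own
  negative.\<close>

lemma had_orthogonal:
  assumes yz: "y \<in> vertices N" "z \<in> vertices N"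
  shows "ker_mult N H H y z = (if y = z then 2 ^ N else 0)"
proof (cases "y = z")
  case True
  have "H y w * H w z = 1" if "w \<in> vertices N" for w
    unfolding True had_commute[of N \<kappa> w] by (simp add: had_power flip: power_add)
  then show ?thesis using True by (simp add: ker_mult_def card_vertices)
next
  case False
  then obtain i where i: "i < N" "y ! i \<noteq> z ! i" using yz vertex_eqI by blast
  have neg: "H y (flip i w) * H (flip i w) z = - (H y w * H w z)" if w: "w \<in> vertices N" for w
  proof -
    have "of_int (y ! i * \<kappa> ! i) * of_int (z ! i * \<kappa> ! i) = (-1::complex)"
      using vertex_nth[OF yz(1) i(1)] vertex_nth[OF yz(2) i(1)] vertex_nth[OF \<kappa> i(1)] i(2)
      by (elim disjE) simp_all
    then show ?thesis
      unfolding had_commute[of N \<kappa> y] had_flip[OF \<kappa> w yz(1) i(1)] had_flip[OF \<kappa> w yz(2) i(1)]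
      by (metis (no_types, lifting) mult.assoc mult.left_commute mult_minus1)
  qed
  have "ker_mult N H H y z = (\<Sum>w\<in>vertices N. H y (flip i w) * H (flip i w) z)"
    unfolding ker_mult_def by (rule sum.reindex_bij_betw[OF bij_flip, symmetric])
  also have "\<dots> = - ker_mult N H H y z"
    unfolding ker_mult_def sum_negf[symmetric] using neg by (intro sum.cong) auto
  finally show ?thesis using False by simp
qed

text \<open>Conjugation by \<open>H\<close>, since the inverse of \<open>H\<close> is
  \<open>H\<close> divided by 2^N. It is a multiplicative involution on kernels.\<close>

definition dual_ker :: "(vertex \<Rightarrow> vertex \<Rightarrow> complex) \<Rightarrow> vertex \<Rightarrow> vertex \<Rightarrow> complex" where
  "dual_ker K = (\<lambda>y z. (1 / 2 ^ N) * ker_mult N H (ker_mult N K H) y z)"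

lemma had_had_left:
  assumes "y \<in> vertices N"
  shows "ker_mult N H (ker_mult N H K) y z = 2 ^ N * K y z"
proof -
  have "ker_mult N H (ker_mult N H K) y z = ker_mult N (ker_diag (\<lambda>_. 2 ^ N)) K y z"
    unfolding ker_mult_assoc[symmetric]
    by (rule ker_mult_cong) (simp_all add: had_orthogonal assms ker_diag_def)
  then show ?thesis using assms by (simp add: ker_mult_diag_left)
qed

lemma had_had_right:
  assumes "z \<in> vertices N"
  shows "ker_mult N (ker_mult N K H) H y z = 2 ^ N * K y z"
proof -
  have "ker_mult N (ker_mult N K H) H y z = ker_mult N K (ker_diag (\<lambda>_. 2 ^ N)) y z"
    unfolding ker_mult_assoc
    by (rule ker_mult_cong) (simp_all add: had_orthogonal assms ker_diag_def)
  then show ?thesis using assms by (simp add: ker_mult_diag_right)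
qed

lemma dual_ker_cong:
  assumes "\<And>y z. y \<in> vertices N \<Longrightarrow> z \<in> vertices N \<Longrightarrow> K y z = K' y z"
  shows "dual_ker K = dual_ker K'"
  unfolding dual_ker_def ker_mult_def using assms by (simp cong: sum.cong)

lemma dual_ker_expand:
  "dual_ker K y z = (1 / 2 ^ N) * (\<Sum>u\<in>vertices N. \<Sum>v\<in>vertices N. H y u * K u v * H v z)"
  by (simp add: dual_ker_def ker_mult_def sum_distrib_left mult.assoc)

lemma dual_ker_involution:
  assumes "y \<in> vertices N" "z \<in> vertices N"
  shows "dual_ker (dual_ker K) y z = K y z"
proof -
  have "dual_ker (dual_ker K) y z = (1 / 2 ^ N) * (1 / 2 ^ N) *
      ker_mult N (ker_mult N H (ker_mult N H (ker_mult N K H))) H y z"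
    unfolding dual_ker_def ker_mult_scale ker_mult_assoc by simp
  also have "ker_mult N (ker_mult N H (ker_mult N H (ker_mult N K H))) H y z =
      ker_mult N (\<lambda>y z. 2 ^ N * ker_mult N K H y z) H y z"
    by (rule ker_mult_cong) (simp_all add: had_had_left assms)
  also have "\<dots> = 2 ^ N * (2 ^ N * K y z)"
    by (simp add: ker_mult_scale had_had_right assms)
  finally show ?thesis by simp
qed

lemma dual_ker_mult:
  "ker_mult N (dual_ker K) (dual_ker L) = dual_ker (ker_mult N K L)"
proof (intro ext)
  fix y z
  have "ker_mult N (dual_ker K) (dual_ker L) y z = (1 / 2 ^ N) * (1 / 2 ^ N) *
      ker_mult N H (ker_mult N K (ker_mult N H (ker_mult N H (ker_mult N L H)))) y z"
    unfolding dual_ker_def ker_mult_scale ker_mult_assoc by simp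
  also have "ker_mult N H (ker_mult N K (ker_mult N H (ker_mult N H (ker_mult N L H)))) y z =
      ker_mult N H (ker_mult N K (\<lambda>y z. 2 ^ N * ker_mult N L H y z)) y z"
    by (intro ker_mult_cong refl) (simp add: had_had_left)
  also have "\<dots> = 2 ^ N * ker_mult N H (ker_mult N (ker_mult N K L) H) y z"
    unfolding ker_mult_scale ker_mult_assoc ..
  finally show "ker_mult N (dual_ker K) (dual_ker L) y z = dual_ker (ker_mult N K L) y z"
    by (simp add: dual_ker_def)
qed

lemma dual_ker_add: "dual_ker (\<lambda>y z. K y z + L y z) = (\<lambda>y z. dual_ker K y z + dual_ker L y z)"
  unfolding dual_ker_expand fun_eq_iff by (simp add: distrib_left distrib_right sum.distrib add_divide_distrib)

lemma dual_ker_scale: "dual_ker (\<lambda>y z. c * K y z) = (\<lambda>y z. c * dual_ker K y z)"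
  unfolding dual_ker_expand fun_eq_iff by (simp add: sum_distrib_left mult_ac)

lemma op_dual_ker: "op N (dual_ker K) = emul (1 / 2 ^ N) (op N H \<circ> (op N K \<circ> op N H))"
  unfolding dual_ker_def op_emul op_comp ..

text \<open>The columns of \<open>H\<close> are eigenvectors of adjacency: every neighbour of
  \<open>y\<close> is a flip, each flip multiplies the character by a sign, and the signs add up to
  \<open>theta\<close>.\<close>

lemma adj_had:
  assumes "y \<in> vertices N" "z \<in> vertices N"
  shows "ker_mult N (\<lambda>y z. if hamm N y z = 1 then 1 else 0) H y z = H y z * theta N (hamm N z \<kappa>)"
    (is "ker_mult N ?A H y z = _")
proof -
  have "ker_mult N ?A H y z = (\<Sum>w\<in>{w \<in> vertices N. hamm N y w = 1}. H w z)"
    unfolding ker_mult_def by (subst sum.inter_filter) (auto intro!: sum.cong)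
  also have "{w \<in> vertices N. hamm N y w = 1} = sphere_at N 1 y"
    using assms by (auto simp: sphere_at_def gdist_eq)
  also have "(\<Sum>w\<in>sphere_at N 1 y. H w z) = (\<Sum>k<N. H (flip k y) z)"
    by (rule sum_sphere_1[OF assms(1)])
  also have "\<dots> = (\<Sum>k<N. of_int (z ! k * \<kappa> ! k) * H y z)"
    by (intro sum.cong refl had_flip[OF \<kappa> assms]) simp
  also have "\<dots> = H y z * theta N (hamm N z \<kappa>)"
    unfolding theta_hamm[OF assms(2) \<kappa>] by (simp add: sum_distrib_left mult.commute)
  finally show ?thesis .
qed

lemma dual_ker_theta:
  assumes "y \<in> vertices N" "z \<in> vertices N"
  shows "dual_ker (ker_diag (\<lambda>x. theta N (hamm N x \<kappa>))) y z = (if hamm N y z = 1 then 1 else 0)"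
    (is "dual_ker ?D y z = ?A y z")
proof -
  have "dual_ker ?D y z = (1 / 2 ^ N) * ker_mult N (ker_mult N ?A H) H y z"
    unfolding dual_ker_def ker_mult_assoc[symmetric]
    by (rule arg_cong2[where f = "(*)", OF refl], rule ker_mult_cong)
      (simp_all only: ker_mult_diag_right adj_had assms)
  then show ?thesis using assms by (simp add: had_had_right)
qed

text \<open>The kernel depends on a distance only, so it is invariant under translations and the
  characters diagonalize it. Substituting \<open>translate N \<kappa> z u\<close> moves the sphere
  around \<open>z\<close> to the one around \<kappa>; the eigenvalue at \<open>x\<close> is the
  character sum over that sphere.\<close>

lemma dual_ker_Ah:
  assumes "x \<in> vertices N" "z \<in> vertices N"
  shows "dual_ker (\<lambda>y z. if hamm N y z = h then 1 else 0) x z =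
    ker_diag (\<lambda>x. \<Sum>u\<in>vertices N. if hamm N u \<kappa> = h then H x u else 0) x z"
    (is "dual_ker ?A x z = ker_diag ?a x z")
proof -
  have *: "ker_mult N H ?A x z = ?a x * H x z" if x: "x \<in> vertices N" and z: "z \<in> vertices N" for x z
  proof -
    have "ker_mult N H ?A x z = (\<Sum>u\<in>vertices N. H x (translate N \<kappa> z u) * ?A (translate N \<kappa> z u) z)"
      unfolding ker_mult_def by (rule sum.reindex_bij_betw[OF bij_translate[OF \<kappa> z], symmetric])
    also have "\<dots> = (\<Sum>u\<in>vertices N. (if hamm N u \<kappa> = h then H x u else 0) * H x z)"
    proof (rule sum.cong[OF refl])
      fix u assume u: "u \<in> vertices N"
      have "hamm N (translate N \<kappa> z u) z = hamm N u \<kappa>"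
        using hamm_translate[OF \<kappa> z, of u \<kappa>] translate_same(2)[OF \<kappa> z] by simp
      then show "H x (translate N \<kappa> z u) * ?A (translate N \<kappa> z u) z =
          (if hamm N u \<kappa> = h then H x u else 0) * H x z"
        by (simp add: had_translate[OF \<kappa> x z u])
    qed
    also have "\<dots> = ?a x * H x z" by (simp only: sum_distrib_right)
    finally show ?thesis .
  qed
  have "dual_ker ?A x z = (1 / 2 ^ N) * ker_mult N (ker_mult N (ker_diag ?a) H) H x z"
    unfolding dual_ker_def ker_mult_assoc[symmetric]
    by (rule arg_cong2[where f = "(*)", OF refl], rule ker_mult_cong)
      (simp_all only: ker_mult_diag_left assms *)
  then show ?thesis using assms by (simp add: had_had_right)
qed

text \<open>By \<open>had_flip\<close>, flipping \<open>y\<close> at \<open>i\<close> brings out the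
  sign \<open>u ! i * \<kappa> ! i\<close> and flipping \<open>z\<close> brings out
  \<open>v ! i * \<kappa> ! i\<close>. Flipping both leaves \<open>u ! i * v ! i\<close>, because
  the sign of \<kappa> occurs squared. Summation over \<open>i\<close> turns these signs into
  \<open>theta\<close>.\<close>

lemma ker_A_dual_ker:
  assumes "y \<in> vertices N" "z \<in> vertices N"
  shows "ker_A N k (dual_ker K) y z =
    dual_ker (\<lambda>u v. theta N (sel k (hamm N u v) (hamm N u \<kappa>) (hamm N v \<kappa>)) * K u v) y z"
proof -
  let ?w = "\<lambda>i u v. sel k (u ! i * v ! i) (u ! i * \<kappa> ! i) (v ! i * \<kappa> ! i)"
  have pt: "sel k (H (flip i y) u * K u v * H v (flip i z)) (H (flip i y) u * K u v * H v z)
      (H y u * K u v * H v (flip i z)) = of_int (?w i u v) * (H y u * K u v * H v z)"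
    if "u \<in> vertices N" "v \<in> vertices N" "i < N" for i u v
    unfolding had_commute[of N \<kappa> v] had_flip[OF \<kappa> assms(1) that(1,3)] had_flip[OF \<kappa> assms(2) that(2,3)]
    using vertex_nth[OF \<kappa> that(3)] by (elim disjE) (simp_all add: sel_def)
  have "ker_A N k (dual_ker K) y z = (\<Sum>i<N. (1 / 2 ^ N) * (\<Sum>u\<in>vertices N. \<Sum>v\<in>vertices N.
      sel k (H (flip i y) u * K u v * H v (flip i z)) (H (flip i y) u * K u v * H v z)
      (H y u * K u v * H v (flip i z))))"
    unfolding ker_A_def dual_ker_expand by (simp add: sel_def)
  also have "\<dots> = (1 / 2 ^ N) * (\<Sum>i<N. \<Sum>u\<in>vertices N. \<Sum>v\<in>vertices N. of_int (?w i u v) * (H y u * K u v * H v z))"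
    unfolding sum_distrib_left[symmetric]
    by (intro arg_cong2[where f = "(*)"] sum.cong refl pt) simp_all
  also have "(\<Sum>i<N. \<Sum>u\<in>vertices N. \<Sum>v\<in>vertices N. of_int (?w i u v) * (H y u * K u v * H v z)) =
      (\<Sum>u\<in>vertices N. \<Sum>v\<in>vertices N. (\<Sum>i<N. of_int (?w i u v)) * (H y u * K u v * H v z))"
    unfolding sum_distrib_right by (subst sum.swap, intro sum.cong refl, rule sum.swap)
  also have "\<dots> = (\<Sum>u\<in>vertices N. \<Sum>v\<in>vertices N. H y u *
      (theta N (sel k (hamm N u v) (hamm N u \<kappa>) (hamm N v \<kappa>)) * K u v) * H v z)"
    by (intro sum.cong refl) (simp add: sel_def theta_hamm \<kappa> mult_ac)
  finally show ?thesis unfolding dual_ker_expand .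
qed

text \<open>A character value is the parity of the overlap of the two difference sets from \<kappa>,
  and \<open>hamm_common\<close> computes the overlap from distances.\<close>

lemma dist_inv_had: "dist_inv N \<kappa> H"
proof (rule dist_invI[OF \<kappa>])
  fix y z y' z'
  assume "y \<in> vertices N" "z \<in> vertices N" "y' \<in> vertices N" "z' \<in> vertices N"
    "hamm N \<kappa> y = hamm N \<kappa> y'" "hamm N \<kappa> z = hamm N \<kappa> z'" "hamm N y z = hamm N y' z'"
  then have "card {k. k < N \<and> \<kappa> ! k \<noteq> y ! k \<and> \<kappa> ! k \<noteq> z ! k} =
      card {k. k < N \<and> \<kappa> ! k \<noteq> y' ! k \<and> \<kappa> ! k \<noteq> z' ! k}"
    using hamm_common[OF \<kappa>, of y z] hamm_common[OF \<kappa>, of y' z'] by linarith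
  then show "H y z = H y' z'" by (simp add: had_power)
qed

lemma dist_inv_dual_ker:
  assumes "dist_inv N \<kappa> K"
  shows "dist_inv N \<kappa> (dual_ker K)"
proof -
  have "dist_inv N \<kappa> (ker_mult N H (ker_mult N K H))"
    using assms dist_inv_had by (intro dist_inv_mult)
  then show ?thesis unfolding dual_ker_def dist_inv_def by simp
qed

end


section \<open>Orbit kernels\<close>

text \<open>Indicators of the orbits of the stabilizer of \<kappa> on pairs of vertices, or zero if
  no pair has the given distances.\<close>

definition ker_orbit :: "nat \<Rightarrow> vertex \<Rightarrow> nat \<times> nat \<times> nat \<Rightarrow> vertex \<Rightarrow> vertex \<Rightarrow> complex" where
  "ker_orbit N \<kappa> = (\<lambda>(h, i, j) y z.
     if hamm N y z = h \<and> hamm N y \<kappa> = i \<and> hamm N z \<kappa> = j then 1 else 0)"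

definition inv_ops :: "nat \<Rightarrow> vertex \<Rightarrow> (cvec \<Rightarrow> cvec) set" where
  "inv_ops N \<kappa> = {op N K | K. dist_inv N \<kappa> K}"

lemma finite_P'': "finite (P'' N)"
  by (rule finite_subset[of _ "{..N} \<times> {..N} \<times> {..N}"]) (auto simp: P''_def)

text \<open>Where \<open>x\<close> differs from both \<open>y\<close> and \<open>z\<close>, these
  two agree. So the overlap \<open>m\<close> and the difference set of \<open>y\<close> and
  \<open>z\<close> are disjoint, and the sum of the three distances is twice their joint size; this
  gives evenness and the bound 2N.\<close>

lemma hamm_in_P'':
  assumes "x \<in> vertices N" "y \<in> vertices N" "z \<in> vertices N"
  shows "(hamm N y z, hamm N y x, hamm N z x) \<in> P'' N"
proof -
  let ?M = "{k. k < N \<and> x ! k \<noteq> y ! k \<and> x ! k \<noteq> z ! k}"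
  let ?D = "{k. k < N \<and> y ! k \<noteq> z ! k}"
  define m where "m = card ?M"
  have two: "2 * m + hamm N y z = hamm N x y + hamm N x z"
    unfolding m_def by (rule hamm_common[OF assms])
  have disj: "k \<notin> ?D" if "k \<in> ?M" for k
  proof -
    have k: "k < N" using that by blast
    have "x ! k \<noteq> y ! k" "x ! k \<noteq> z ! k" using that by blast+
    then have "y ! k = z ! k"
      using vertex_nth[OF assms(1) k] vertex_nth[OF assms(2) k] vertex_nth[OF assms(3) k] by metis
    then show ?thesis by blast
  qed
  have "m + card ?D = card (?M \<union> ?D)"
    unfolding m_def using disj by (intro card_Un_disjoint[symmetric]) (simp, simp, blast)
  also have "\<dots> \<le> card {..<N}" by (rule card_mono) (simp, blast)
  finally have le: "m + hamm N y z \<le> N" by (simp add: hamm_def)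
  have sum: "hamm N y z + hamm N x y + hamm N x z = 2 * (m + hamm N y z)"
    using two by presburger
  then have ev: "even (hamm N y z + hamm N x y + hamm N x z)" by (rule dvdI)
  have "hamm N y z + hamm N x y + hamm N x z \<le> 2 * N" using sum le by presburger
  moreover have "hamm N y z \<le> hamm N x y + hamm N x z" using two by presburger
  moreover have "hamm N x y \<le> hamm N x z + hamm N y z"
    using hamm_triangle[of N x y z] unfolding hamm_commute[of N z y] .
  moreover have "hamm N x z \<le> hamm N y z + hamm N x y"
    using hamm_triangle[of N x z y] by (simp only: add.commute)
  ultimately show ?thesis
    unfolding P''_def mem_Collect_eq prod.case hamm_commute[of N y x] hamm_commute[of N z x]
    using ev hamm_le by blast
qed

lemma dual_ker_sum:
  assumes \<kappa>: "\<kappa> \<in> vertices N" and "finite P"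
  shows "dual_ker N \<kappa> (\<lambda>y z. \<Sum>p\<in>P. c p * K p y z) = (\<lambda>y z. \<Sum>p\<in>P. c p * dual_ker N \<kappa> (K p) y z)"
  using assms(2)
proof (induction P)
  case empty
  show ?case unfolding dual_ker_expand[OF \<kappa>] by simp
next
  case (insert p P)
  show ?case
    unfolding sum.insert[OF insert.hyps] dual_ker_add[OF \<kappa>] dual_ker_scale[OF \<kappa>] insert.IH ..
qed

context
  fixes N :: nat and \<kappa> :: vertex
  assumes \<kappa>: "\<kappa> \<in> vertices N"
begin

text \<open>\<open>H\<close> intertwines adjacency with multiplication by \<open>theta\<close> of
  the distance to \<kappa>. An eigenvector goes to a vector supported at the single distance
  \<open>j\<close>, because the values of \<open>theta\<close> are distinct.\<close>

lemma eigenspace_had: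
  assumes v: "v \<in> eigenspace N j"
  shows "op N (ker_diag (\<lambda>x. if hamm N x \<kappa> = i then 1 else 0)) (op N (had N \<kappa>) v) =
    (if j = i then op N (had N \<kappa>) v else 0)"
proof
  fix y
  let ?H = "had N \<kappa>" and ?A = "\<lambda>y z. if hamm N y z = 1 then 1 else (0::complex)"
  have vV: "v \<in> V N" and Av: "op N ?A v = smul (theta N j) v"
    using v by (simp_all add: eigenspace_def Ah_op)
  let ?u = "op N ?H v"
  have comm: "ker_mult N ?H ?A y z = ker_mult N (ker_diag (\<lambda>x. theta N (hamm N x \<kappa>))) ?H y z"
    if "y \<in> vertices N" "z \<in> vertices N" for y z
  proof -
    have "ker_mult N ?H ?A y z = ker_mult N ?A ?H z y"
      unfolding ker_mult_def by (simp add: had_commute[of N \<kappa> y] hamm_commute[of N z] mult.commute)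
    also have "\<dots> = ?H y z * theta N (hamm N y \<kappa>)"
      unfolding adj_had[OF \<kappa> that(2,1)] had_commute[of N \<kappa> z] ..
    finally show ?thesis
      using that by (simp only: ker_mult_diag_left mult.commute)
  qed
  have "op N ?H (op N ?A v) = op N (ker_diag (\<lambda>x. theta N (hamm N x \<kappa>))) ?u"
  proof -
    have "op N ?H \<circ> op N ?A = op N (ker_diag (\<lambda>x. theta N (hamm N x \<kappa>))) \<circ> op N ?H"
      unfolding op_comp using comm by (rule op_cong)
    from fun_cong[OF this, of v] show ?thesis unfolding comp_apply .
  qed
  moreover have "op N ?H (smul (theta N j) v) = smul (theta N j) ?u"
    using op_Endo[of N ?H] vV unfolding Endo_def linear_on_def by blast
  ultimately have eq: "op N (ker_diag (\<lambda>x. theta N (hamm N x \<kappa>))) ?u = smul (theta N j) ?u"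
    unfolding Av by (rule trans[OF sym])
  have diag: "op N (ker_diag f) ?u y = (if y \<in> vertices N then f y * ?u y else 0)" for f
  proof -
    have "(\<Sum>z\<in>vertices N. ker_diag f y z * ?u z) = (\<Sum>z\<in>vertices N. if y = z then f z * ?u z else 0)"
      by (intro sum.cong refl) (simp add: ker_diag_def)
    also have "\<dots> = (if y \<in> vertices N then f y * ?u y else 0)" by simp
    finally show ?thesis unfolding op_def[of N "ker_diag f" ?u] using op_in_V[of N ?H v] by argo
  qed
  have "hamm N y \<kappa> = j \<or> ?u y = 0" if "y \<in> vertices N"
  proof -
    have "theta N (hamm N y \<kappa>) * ?u y = theta N j * ?u y"
      using fun_cong[OF eq, of y] that unfolding diag smul_def by argo
    then show ?thesis unfolding mult_cancel_right theta_inj by blast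
  qed
  moreover have "y \<notin> vertices N \<Longrightarrow> ?u y = 0" by (simp add: op_def)
  ultimately show "op N (ker_diag (\<lambda>x. if hamm N x \<kappa> = i then 1 else 0)) ?u y =
      (if j = i then ?u else 0) y"
    unfolding diag by (cases "y \<in> vertices N"; cases "j = i"; force)
qed

lemma had_had_op: "v \<in> V N \<Longrightarrow> op N (had N \<kappa>) (op N (had N \<kappa>) v) = smul (2 ^ N) v"
proof -
  assume v: "v \<in> V N"
  have "op N (had N \<kappa>) \<circ> op N (had N \<kappa>) = op N (\<lambda>y z. 2 ^ N * ker_diag (\<lambda>_. 1) y z)"
    unfolding op_comp by (rule op_cong) (simp add: had_orthogonal[OF \<kappa>] ker_diag_def)
  also have "\<dots> = emul (2 ^ N) (id_endo (V N))"
    by (simp only: op_emul[symmetric] op_id)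
  finally show ?thesis using v by (simp add: fun_eq_iff emul_def id_endo_def)
qed

lemma had_basis_eigenspace:
  assumes s: "s \<in> vertices N"
  shows "op N (had N \<kappa>) (basis_vec s) \<in> eigenspace N (hamm N s \<kappa>)"
proof -
  let ?H = "had N \<kappa>" and ?A = "\<lambda>y z. if hamm N y z = 1 then 1 else (0::complex)"
  have "op N ?A (op N ?H (basis_vec s)) y = theta N (hamm N s \<kappa>) * op N ?H (basis_vec s) y"
    if y: "y \<in> vertices N" for y
  proof -
    have "op N ?A (op N ?H (basis_vec s)) y = op N (ker_mult N ?A ?H) (basis_vec s) y"
      using fun_cong[OF op_comp[of N ?A ?H], of "basis_vec s"] by simp
    then show ?thesis by (simp only: op_basis_vec[OF s y] adj_had[OF \<kappa> y s] mult.commute)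
  qed
  moreover have "op N ?A (op N ?H (basis_vec s)) y = theta N (hamm N s \<kappa>) * op N ?H (basis_vec s) y"
    if "y \<notin> vertices N" for y
    using that by (simp add: op_def)
  ultimately show ?thesis
    unfolding eigenspace_def Ah_op by (auto simp: op_in_V smul_def)
qed

text \<open>Existence is \<open>eigenspace_had\<close> conjugated back. For uniqueness, the columns
  of \<open>H\<close> are eigenvectors, so any competitor agrees with the candidate after
  composition with \<open>H\<close>, and \<open>H\<close> can be cancelled.\<close>

lemma idem_op: "idem N i = op N (dual_ker N \<kappa> (ker_diag (\<lambda>x. if hamm N x \<kappa> = i then 1 else 0)))"
  (is "_ = op N (dual_ker N \<kappa> ?D)")
  unfolding idem_def
proof (rule the_equality)
  let ?H = "had N \<kappa>"
  let ?P = "op N (dual_ker N \<kappa> ?D)"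
  have P: "?P v = (if j = i then v else 0)" if "v \<in> eigenspace N j" for j v
  proof -
    have v: "v \<in> V N" using that by (simp add: eigenspace_def)
    have Pv: "?P v = smul (1 / 2 ^ N) (op N ?H (op N ?D (op N ?H v)))"
      by (simp add: op_dual_ker[OF \<kappa>] emul_def)
    have "op N ?H 0 = 0" by (simp add: op_def fun_eq_iff)
    with Pv have "?P v = smul (1 / 2 ^ N) (if j = i then smul (2 ^ N) v else 0)"
      using v by (simp add: eigenspace_had[OF that] had_had_op)
    then show ?thesis by (simp add: smul_def fun_eq_iff)
  qed
  then show "?P \<in> Endo smul (V N) \<and> (\<forall>j\<le>N. \<forall>v\<in>eigenspace N j. ?P v = (if j = i then v else 0))"
    using op_Endo by blast
  fix P' assume P': "P' \<in> Endo smul (V N) \<and>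
      (\<forall>j\<le>N. \<forall>v\<in>eigenspace N j. P' v = (if j = i then v else 0))"
  \<comment> \<open>Column \<open>s\<close> belongs to the eigenvalue with index
    \<open>hamm N s \<kappa>\<close>, and \<open>hamm_le\<close> places this index in the range
    where \<open>P'\<close> is prescribed.\<close>
  have basis: "P' (op N ?H (basis_vec s)) = ?P (op N ?H (basis_vec s))" if s: "s \<in> vertices N" for s
    using P' P[OF had_basis_eigenspace[OF s]] had_basis_eigenspace[OF s] hamm_le[of N s \<kappa>] by metis
  obtain K' where K': "P' = op N K'" using op_ker P' by metis
  have "op N (ker_mult N K' ?H) = op N (ker_mult N (dual_ker N \<kappa> ?D) ?H)"
    unfolding op_eq_iff
  proof (intro ballI)
    fix y s assume y: "y \<in> vertices N" and s: "s \<in> vertices N"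
    have "op N (ker_mult N K' ?H) (basis_vec s) y = op N (ker_mult N (dual_ker N \<kappa> ?D) ?H) (basis_vec s) y"
      using basis[OF s] unfolding op_comp[symmetric] K' by simp
    then show "ker_mult N K' ?H y s = ker_mult N (dual_ker N \<kappa> ?D) ?H y s"
      by (simp only: op_basis_vec[OF s y])
  qed
  then have PH: "P' (op N ?H w) = ?P (op N ?H w)" for w
    unfolding op_comp[symmetric] K' by (metis comp_apply)
  show "P' = ?P"
  proof
    fix v
    show "P' v = ?P v"
    proof (cases "v \<in> V N")
      case True
      \<comment> \<open>The vector \<open>smul (2 ^ N) v\<close> is \<open>H\<close> applied to
        \<open>H v\<close>, where both maps are known to agree.\<close>
      have "smul (2 ^ N) (F v) = F (smul (2 ^ N) v)" if "F \<in> Endo smul (V N)" for F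
        using that True by (simp add: Endo_def linear_on_def)
      then have "smul (2 ^ N) (P' v) = smul (2 ^ N) (?P v)"
        using PH[of "op N ?H v"] P' op_Endo[of N "dual_ker N \<kappa> ?D"] by (simp add: had_had_op True)
      then show ?thesis by (simp add: smul_def fun_eq_iff)
    next
      case False
      then show ?thesis using P' op_Endo[of N "dual_ker N \<kappa> ?D"] by (simp add: Endo_def)
    qed
  qed
qed

text \<open>The column of \<open>H\<close> at \<kappa> is constantly 1. Hence 2^N times the
  idempotent at \<kappa> is the character sum over a sphere, which is the eigenvalue found in
  \<open>dual_ker_Ah\<close>; the factor 2^N in the definition of \<open>Ah_star\<close> cancels the
  one in \<open>dual_ker\<close>.\<close>

lemma Ah_star_dual_ker: "Ah_star N \<kappa> h = op N (dual_ker N \<kappa> (\<lambda>y z. if hamm N y z = h then 1 else 0))"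
  unfolding Ah_star_op
proof (rule op_cong)
  fix y z assume yz: "y \<in> vertices N" "z \<in> vertices N"
  let ?D = "ker_diag (\<lambda>x. if hamm N x \<kappa> = h then 1 else 0)"
  have "2 ^ N * idem N h (basis_vec \<kappa>) z = 2 ^ N * dual_ker N \<kappa> ?D z \<kappa>"
    by (simp only: idem_op op_basis_vec[OF \<kappa> yz(2)])
  also have "\<dots> = ker_mult N (had N \<kappa>) (ker_mult N ?D (had N \<kappa>)) z \<kappa>"
    by (simp add: dual_ker_def[OF \<kappa>])
  also have "\<dots> = (\<Sum>u\<in>vertices N. if hamm N u \<kappa> = h then had N \<kappa> z u else 0)"
    unfolding ker_mult_def[of N "had N \<kappa>"]
    by (intro sum.cong refl) (simp add: ker_mult_diag_left had_base)
  finally show "ker_diag (\<lambda>x. 2 ^ N * idem N h (basis_vec \<kappa>) x) y z =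
      dual_ker N \<kappa> (\<lambda>y z. if hamm N y z = h then 1 else 0) y z"
    unfolding dual_ker_Ah[OF \<kappa> yz] by (simp add: ker_diag_def)
qed

lemma orbit_product:
  "idem_star N \<kappa> i \<circ> Ah N h \<circ> idem_star N \<kappa> j = op N (ker_orbit N \<kappa> (h, i, j))"
  unfolding idem_star_op[OF \<kappa>] Ah_op op_comp
  by (rule op_cong) (simp add: ker_mult_diag_left ker_mult_diag_right ker_orbit_def)

lemma orbit_product_dual:
  "idem N i \<circ> Ah_star N \<kappa> h \<circ> idem N j = op N (dual_ker N \<kappa> (ker_orbit N \<kappa> (h, i, j)))"
  unfolding idem_op Ah_star_dual_ker op_comp dual_ker_mult[OF \<kappa>]
  by (rule arg_cong[where f = "op N"], rule dual_ker_cong[OF \<kappa>])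
    (simp add: ker_mult_diag_left ker_mult_diag_right ker_orbit_def)

lemma dist_inv_orbit: "dist_inv N \<kappa> (ker_orbit N \<kappa> p)"
  by (rule dist_invI[OF \<kappa>]) (simp add: ker_orbit_def hamm_commute[of N _ \<kappa>] split: prod.split)

text \<open>The coefficient at \<open>p\<close> is the common value of \<open>K\<close> on pairs
  with distances \<open>p\<close>, arbitrary if there are none. By \<open>hamm_in_P''\<close>
  exactly one summand survives at each pair.\<close>

lemma orbit_span:
  assumes K: "dist_inv N \<kappa> K"
  shows "\<exists>c. \<forall>y\<in>vertices N. \<forall>z\<in>vertices N. K y z = (\<Sum>p\<in>P'' N. c p * ker_orbit N \<kappa> p y z)"
proof -
  define t where "t y z = (hamm N y z, hamm N y \<kappa>, hamm N z \<kappa>)" for y z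
  have "\<exists>a. \<forall>y\<in>vertices N. \<forall>z\<in>vertices N. t y z = p \<longrightarrow> K y z = a" for p
  proof (cases "\<exists>y\<in>vertices N. \<exists>z\<in>vertices N. t y z = p")
    case True
    then obtain y z where yz: "y \<in> vertices N" "z \<in> vertices N" "t y z = p" by blast
    have "K y' z' = K y z" if "y' \<in> vertices N" "z' \<in> vertices N" "t y' z' = p" for y' z'
    proof (rule dist_inv_hamm[OF \<kappa> K that(1,2) yz(1,2)])
      have "t y' z' = t y z" using that yz by simp
      then show "hamm N \<kappa> y' = hamm N \<kappa> y" "hamm N \<kappa> z' = hamm N \<kappa> z" "hamm N y' z' = hamm N y z"
        by (simp_all add: t_def hamm_commute[of N \<kappa>])
    qed
    then show ?thesis by blast
  qed blast
  then obtain c where c: "\<And>p y z. y \<in> vertices N \<Longrightarrow> z \<in> vertices N \<Longrightarrow> t y z = p \<Longrightarrow> K y z = c p"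
    by metis
  have "K y z = (\<Sum>p\<in>P'' N. c p * ker_orbit N \<kappa> p y z)" if "y \<in> vertices N" "z \<in> vertices N" for y z
  proof -
    have "(\<Sum>p\<in>P'' N. c p * ker_orbit N \<kappa> p y z) = (\<Sum>p\<in>P'' N. if p = t y z then c p else 0)"
      by (intro sum.cong refl) (auto simp: ker_orbit_def t_def split: prod.split)
    also have "\<dots> = c (t y z)"
      using finite_P'' hamm_in_P''[OF \<kappa> that] by (simp add: t_def)
    finally show ?thesis using c[OF that refl] by simp
  qed
  then show ?thesis by blast
qed

lemma inv_ops_orbit_span:
  assumes "F \<in> inv_ops N \<kappa>"
  shows "\<exists>c. F = (\<Sum>p\<in>P'' N. emul (c p) (op N (ker_orbit N \<kappa> p)))"
proof -
  obtain K where K: "F = op N K" "dist_inv N \<kappa> K" using assms by (auto simp: inv_ops_def)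
  obtain c where "\<forall>y\<in>vertices N. \<forall>z\<in>vertices N. K y z = (\<Sum>p\<in>P'' N. c p * ker_orbit N \<kappa> p y z)"
    using orbit_span[OF K(2)] by blast
  then have "op N K = op N (\<lambda>y z. \<Sum>p\<in>P'' N. c p * ker_orbit N \<kappa> p y z)"
    unfolding op_eq_iff .
  then have "F = (\<Sum>p\<in>P'' N. emul (c p) (op N (ker_orbit N \<kappa> p)))"
    unfolding K(1) op_emul op_sum .
  then show ?thesis by blast
qed

text \<open>The dual of \<open>K\<close> is again invariant; its orbit expansion is dualized
  back.\<close>

lemma inv_ops_dual_span:
  assumes "F \<in> inv_ops N \<kappa>"
  shows "\<exists>c. F = (\<Sum>p\<in>P'' N. emul (c p) (op N (dual_ker N \<kappa> (ker_orbit N \<kappa> p))))"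
proof -
  obtain K where K: "F = op N K" "dist_inv N \<kappa> K" using assms by (auto simp: inv_ops_def)
  obtain c where c: "\<forall>y\<in>vertices N. \<forall>z\<in>vertices N. dual_ker N \<kappa> K y z = (\<Sum>p\<in>P'' N. c p * ker_orbit N \<kappa> p y z)"
    using orbit_span[OF dist_inv_dual_ker[OF \<kappa> K(2)]] by blast
  have "F = op N (dual_ker N \<kappa> (dual_ker N \<kappa> K))"
    unfolding K(1) by (rule op_cong) (simp add: dual_ker_involution[OF \<kappa>])
  also have "dual_ker N \<kappa> (dual_ker N \<kappa> K) = dual_ker N \<kappa> (\<lambda>y z. \<Sum>p\<in>P'' N. c p * ker_orbit N \<kappa> p y z)"
    by (rule dual_ker_cong[OF \<kappa>]) (rule c[rule_format])
  finally have "F = (\<Sum>p\<in>P'' N. emul (c p) (op N (dual_ker N \<kappa> (ker_orbit N \<kappa> p))))"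
    unfolding dual_ker_sum[OF \<kappa> finite_P''] op_emul op_sum .
  then show ?thesis by blast
qed

end


section \<open>The subconstituent algebra\<close>

lemma ker_add: "ker (F + F') y z = ker F y z + ker F' y z"
  by (simp add: ker_def)

lemma ker_emul: "ker (emul c F) y z = c * ker F y z"
  by (simp add: ker_def emul_def smul_def)

lemma dist_inv_cong:
  assumes "\<And>y z. y \<in> vertices N \<Longrightarrow> z \<in> vertices N \<Longrightarrow> K y z = L y z" "dist_inv N \<kappa> L"
  shows "dist_inv N \<kappa> K"
  unfolding dist_inv_def
proof (intro ballI impI)
  fix g y z assume g: "g \<in> Aut N" "g \<kappa> = \<kappa>" and yz: "y \<in> vertices N" "z \<in> vertices N"
  have "L (g y) (g z) = L y z" using assms(2) g yz unfolding dist_inv_def by blast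
  then show "K (g y) (g z) = K y z"
    using assms(1)[OF yz] assms(1)[OF Aut_in[OF g(1) yz(1)] Aut_in[OF g(1) yz(2)]] by argo
qed

lemma dist_invD:
  "dist_inv N \<kappa> K \<Longrightarrow> g \<in> Aut N \<Longrightarrow> g \<kappa> = \<kappa> \<Longrightarrow> y \<in> vertices N \<Longrightarrow> z \<in> vertices N \<Longrightarrow>
    K (g y) (g z) = K y z"
  unfolding dist_inv_def by blast

lemma dist_inv_add:
  assumes "dist_inv N \<kappa> K" "dist_inv N \<kappa> L"
  shows "dist_inv N \<kappa> (\<lambda>y z. K y z + L y z)"
  unfolding dist_inv_def
  by (intro ballI impI arg_cong2[where f = "(+)"] dist_invD[OF assms(1)] dist_invD[OF assms(2)])

lemma dist_inv_diff:
  assumes "dist_inv N \<kappa> K" "dist_inv N \<kappa> L"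
  shows "dist_inv N \<kappa> (\<lambda>y z. K y z - L y z)"
  unfolding dist_inv_def
  by (intro ballI impI arg_cong2[where f = "(-)"] dist_invD[OF assms(1)] dist_invD[OF assms(2)])

lemma dist_inv_times:
  assumes "dist_inv N \<kappa> K" "dist_inv N \<kappa> L"
  shows "dist_inv N \<kappa> (\<lambda>y z. K y z * L y z)"
  unfolding dist_inv_def
  by (intro ballI impI arg_cong2[where f = "(*)"] dist_invD[OF assms(1)] dist_invD[OF assms(2)])

lemma dist_inv_const: "dist_inv N \<kappa> (\<lambda>y z. c)"
  unfolding dist_inv_def by blast

lemma dist_inv_hamm_fun:
  assumes "\<kappa> \<in> vertices N"
  shows "dist_inv N \<kappa> (\<lambda>y z. f (hamm N y z) (hamm N y \<kappa>) (hamm N z \<kappa>))"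
  by (rule dist_invI[OF assms]) (simp add: hamm_commute[of N _ \<kappa>])

lemma dist_inv_ker_diag:
  assumes "\<kappa> \<in> vertices N"
  shows "dist_inv N \<kappa> (ker_diag (\<lambda>x. f (hamm N x \<kappa>)))"
proof (rule dist_inv_cong)
  show "dist_inv N \<kappa> (\<lambda>y z. (\<lambda>h i j. if h = 0 then f j else 0) (hamm N y z) (hamm N y \<kappa>) (hamm N z \<kappa>))"
    by (rule dist_inv_hamm_fun[OF assms])
qed (simp add: ker_diag_def hamm_0_iff)

lemma ker_A_cong:
  assumes "y \<in> vertices N" "z \<in> vertices N"
    and "\<And>y z. y \<in> vertices N \<Longrightarrow> z \<in> vertices N \<Longrightarrow> K y z = L y z"
  shows "ker_A N k K y z = ker_A N k L y z"
  unfolding ker_A_def using assms by simp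

text \<open>Lagrange interpolation in a diagonalizable element with eigenvalues \<open>\<theta>\<^sub>0, \<dots>, \<theta>\<^sub>N\<close>.\<close>

lemma subalgebra_interpolation:
  fixes \<Phi> :: "(vertex \<Rightarrow> complex) \<Rightarrow> cvec \<Rightarrow> cvec" and d :: "vertex \<Rightarrow> nat"
  assumes S: "unital_subalgebra N S"
    and add: "\<And>f g. \<Phi> (\<lambda>x. f x + g x) = \<Phi> f + \<Phi> g"
    and scale: "\<And>c f. \<Phi> (\<lambda>x. c * f x) = emul c (\<Phi> f)"
    and mult: "\<And>f g. \<Phi> (\<lambda>x. f x * g x) = \<Phi> f \<circ> \<Phi> g"
    and one: "\<Phi> (\<lambda>x. 1) = id_endo (V N)"
    and gen: "\<Phi> (\<lambda>x. theta N (d x)) \<in> S"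
    and d: "\<And>x. d x \<le> N"
  shows "\<Phi> (\<lambda>x. c (d x)) \<in> S"
proof -
  have S_add: "F + F' \<in> S" and S_mult: "F \<circ> F' \<in> S" if "F \<in> S" "F' \<in> S" for F F'
    using S that unfolding unital_subalgebra_def subspace_emul_iff by blast+
  have S_emul: "emul a F \<in> S" if "F \<in> S" for a F
    using S that unfolding unital_subalgebra_def subspace_emul_iff by blast
  have S_one: "\<Phi> (\<lambda>x. 1) \<in> S"
    unfolding one using S unfolding unital_subalgebra_def by blast
  have prod_in: "\<Phi> (\<lambda>x. \<Prod>j\<in>J. (theta N (d x) - theta N j)) \<in> S" if "finite J" for J
    using that
  proof (induction J)
    case empty
    then show ?case using S_one by simp
  next
    case (insert j J)
    have "\<Phi> (\<lambda>x. theta N (d x) + (- theta N j) * 1) \<in> S"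
      unfolding add scale[of "- theta N j" "\<lambda>x. 1"] by (intro S_add gen S_emul S_one)
    then have "\<Phi> (\<lambda>x. theta N (d x) + (- theta N j) * 1) \<circ> \<Phi> (\<lambda>x. \<Prod>j\<in>J. (theta N (d x) - theta N j)) \<in> S"
      using insert.IH by (rule S_mult)
    then show ?case
      using insert.hyps by (simp add: mult[symmetric])
  qed
  have ind: "\<Phi> (\<lambda>x. if d x = i then 1 else 0) \<in> S" if "i \<le> N" for i
  proof -
    \<comment> \<open>The interpolation product at its own node; it is nonzero because the values of
      \<open>theta\<close> are distinct.\<close>
    define q where "q = (\<Prod>j\<in>{..N} - {i}. (theta N i - theta N j))"
    have "q \<noteq> 0" by (simp add: q_def theta_inj)
    have "(\<Prod>j\<in>{..N} - {i}. (theta N (d x) - theta N j)) = (if d x = i then q else 0)" for x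
    proof (cases "d x = i")
      case False
      then have "d x \<in> {..N} - {i}" using d by simp
      then have "\<exists>j\<in>{..N} - {i}. theta N (d x) - theta N j = 0" by (metis right_minus_eq)
      then show ?thesis using False by (simp add: prod_zero_iff)
    qed (simp add: q_def)
    then have "(\<lambda>x. if d x = i then 1 else 0) =
        (\<lambda>x. (1 / q) * (\<Prod>j\<in>{..N} - {i}. (theta N (d x) - theta N j)))"
      using \<open>q \<noteq> 0\<close> by (simp add: fun_eq_iff)
    then show ?thesis
      using S_emul[OF prod_in[of "{..N} - {i}"], of "1 / q"] by (simp only: scale finite_Diff finite_atMost)
  qed
  have sum_in: "\<Phi> (\<lambda>x. \<Sum>i\<in>I. c i * (if d x = i then 1 else 0)) \<in> S" if "finite I" "I \<subseteq> {..N}" for I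
    using that
  proof (induction I)
    case empty
    \<comment> \<open>The image of the zero function is reached through the scalar rule for
      \<open>\<Phi>\<close>.\<close>
    have "\<Phi> (\<lambda>x. 0 * 1) \<in> S" unfolding scale[of 0 "\<lambda>x. 1"] by (intro S_emul S_one)
    then show ?case by simp
  next
    case (insert i I)
    have "\<Phi> (\<lambda>x. c i * (if d x = i then 1 else 0)) \<in> S"
      unfolding scale using insert.prems by (intro S_emul ind) simp
    then have "\<Phi> (\<lambda>x. c i * (if d x = i then 1 else 0) + (\<Sum>i\<in>I. c i * (if d x = i then 1 else 0))) \<in> S"
      unfolding add using insert by (intro S_add) simp_all
    then show ?case by (simp only: sum.insert[OF insert.hyps])
  qed
  have "(\<lambda>x. \<Sum>i\<in>{..N}. c i * (if d x = i then 1 else 0)) = (\<lambda>x. c (d x))"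
  proof
    fix x
    have "(\<Sum>i\<in>{..N}. c i * (if d x = i then 1 else 0)) = (\<Sum>i\<in>{..N}. if d x = i then c i else 0)"
      by (intro sum.cong refl) simp
    also have "\<dots> = c (d x)" using d[of x] by simp
    finally show "(\<Sum>i\<in>{..N}. c i * (if d x = i then 1 else 0)) = c (d x)" .
  qed
  then show ?thesis using sum_in[of "{..N}"] by simp
qed

context
  fixes N :: nat and \<kappa> :: vertex
  assumes \<kappa>: "\<kappa> \<in> vertices N"
begin

lemma inv_opsI: "dist_inv N \<kappa> K \<Longrightarrow> op N K \<in> inv_ops N \<kappa>"
  unfolding inv_ops_def by blast

lemma inv_ops_subspace: "module.subspace emul (inv_ops N \<kappa>)"
  unfolding subspace_emul_iff
proof (intro conjI ballI allI)
  show "0 \<in> inv_ops N \<kappa>"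
    unfolding op_zero[of N, symmetric] by (rule inv_opsI[OF dist_inv_const])
next
  fix F F' assume "F \<in> inv_ops N \<kappa>" "F' \<in> inv_ops N \<kappa>"
  then obtain K K' where "F = op N K" "F' = op N K'" "dist_inv N \<kappa> K" "dist_inv N \<kappa> K'"
    unfolding inv_ops_def by blast
  then show "F + F' \<in> inv_ops N \<kappa>" by (simp add: op_add inv_opsI dist_inv_add)
next
  fix c F assume "F \<in> inv_ops N \<kappa>"
  then obtain K where "F = op N K" "dist_inv N \<kappa> K"
    unfolding inv_ops_def by blast
  then show "emul c F \<in> inv_ops N \<kappa>" by (simp add: op_emul inv_opsI dist_inv_times dist_inv_const)
qed

lemma inv_ops_subalgebra: "unital_subalgebra N (inv_ops N \<kappa>)"
  unfolding unital_subalgebra_def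
proof (intro conjI ballI)
  show "inv_ops N \<kappa> \<subseteq> Endo smul (V N)" using op_Endo unfolding inv_ops_def by blast
  show "id_endo (V N) \<in> inv_ops N \<kappa>"
    unfolding op_id[symmetric] by (rule inv_opsI[OF dist_inv_ker_diag[OF \<kappa>, of "\<lambda>_. 1"]])
  fix F F' assume "F \<in> inv_ops N \<kappa>" "F' \<in> inv_ops N \<kappa>"
  then obtain K K' where "F = op N K" "F' = op N K'" "dist_inv N \<kappa> K" "dist_inv N \<kappa> K'"
    unfolding inv_ops_def by blast
  then show "F \<circ> F' \<in> inv_ops N \<kappa>" by (simp add: op_comp inv_opsI dist_inv_mult)
qed (rule inv_ops_subspace)

text \<open>Interpolation is used twice: on diagonal kernels, generated by the dual adjacency map,
  and on their conjugates by \<open>H\<close>, generated by adjacency. The first yields the dual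
  idempotents, the second all \<open>Ah\<close>.\<close>

lemma orbit_in_subalgebra:
  assumes S: "unital_subalgebra N S" and A: "adjacency N \<in> S" and A': "adjacency_star N \<kappa> \<in> S"
  shows "op N (ker_orbit N \<kappa> p) \<in> S"
proof -
  have S_mult: "F \<circ> F' \<in> S" if "F \<in> S" "F' \<in> S" for F F'
    using S that unfolding unital_subalgebra_def by blast
  have diag: "op N (ker_diag (\<lambda>x. c (hamm N x \<kappa>))) \<in> S" for c
  proof (rule subalgebra_interpolation[OF S, where \<Phi> = "\<lambda>f. op N (ker_diag f)" and d = "\<lambda>x. hamm N x \<kappa>"])
    show "op N (ker_diag (\<lambda>x. f x + g x)) = op N (ker_diag f) + op N (ker_diag g)" for f g
      unfolding op_add by (rule op_cong) (simp add: ker_diag_def)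
    show "op N (ker_diag (\<lambda>x. c * f x)) = emul c (op N (ker_diag f))" for c f
      unfolding op_emul by (rule op_cong) (simp add: ker_diag_def)
    show "op N (ker_diag (\<lambda>x. f x * g x)) = op N (ker_diag f) \<circ> op N (ker_diag g)" for f g
      unfolding op_comp by (rule op_cong) (simp add: ker_mult_diag_left, simp add: ker_diag_def)
    show "op N (ker_diag (\<lambda>x. 1)) = id_endo (V N)" by (rule op_id)
    show "op N (ker_diag (\<lambda>x. theta N (hamm N x \<kappa>))) \<in> S"
      using A' unfolding adjacency_star_op[OF \<kappa>] .
  qed (rule hamm_le)
  have conj: "op N (dual_ker N \<kappa> (ker_diag (\<lambda>x. c (hamm N x \<kappa>)))) \<in> S" for c
  proof (rule subalgebra_interpolation[OF S, where \<Phi> = "\<lambda>f. op N (dual_ker N \<kappa> (ker_diag f))" and d = "\<lambda>x. hamm N x \<kappa>"])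
    show "op N (dual_ker N \<kappa> (ker_diag (\<lambda>x. f x + g x))) = op N (dual_ker N \<kappa> (ker_diag f)) + op N (dual_ker N \<kappa> (ker_diag g))" for f g
      unfolding op_add dual_ker_add[OF \<kappa>, symmetric]
      by (rule arg_cong[where f = "op N"], rule dual_ker_cong[OF \<kappa>]) (simp add: ker_diag_def)
    show "op N (dual_ker N \<kappa> (ker_diag (\<lambda>x. c * f x))) = emul c (op N (dual_ker N \<kappa> (ker_diag f)))" for c f
      unfolding op_emul dual_ker_scale[OF \<kappa>, symmetric]
      by (rule arg_cong[where f = "op N"], rule dual_ker_cong[OF \<kappa>]) (simp add: ker_diag_def)
    show "op N (dual_ker N \<kappa> (ker_diag (\<lambda>x. f x * g x))) = op N (dual_ker N \<kappa> (ker_diag f)) \<circ> op N (dual_ker N \<kappa> (ker_diag g))" for f g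
      unfolding op_comp dual_ker_mult[OF \<kappa>]
      by (rule arg_cong[where f = "op N"], rule dual_ker_cong[OF \<kappa>])
        (simp add: ker_mult_diag_left, simp add: ker_diag_def)
    show "op N (dual_ker N \<kappa> (ker_diag (\<lambda>x. 1))) = id_endo (V N)"
    proof -
      have "dual_ker N \<kappa> (ker_diag (\<lambda>x. 1)) y z = ker_diag (\<lambda>x. 1) y z"
        if "y \<in> vertices N" "z \<in> vertices N" for y z
      proof -
        have "ker_mult N (had N \<kappa>) (ker_mult N (ker_diag (\<lambda>x. 1)) (had N \<kappa>)) y z = ker_mult N (had N \<kappa>) (had N \<kappa>) y z"
          by (rule ker_mult_cong) (simp_all add: ker_mult_diag_left)
        then show ?thesis
          unfolding dual_ker_def[OF \<kappa>] had_orthogonal[OF \<kappa> that] by (simp add: ker_diag_def)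
      qed
      then show ?thesis unfolding op_id[symmetric] by (rule op_cong)
    qed
    have "op N (dual_ker N \<kappa> (ker_diag (\<lambda>x. theta N (hamm N x \<kappa>)))) = adjacency N"
      unfolding Ah_op by (rule op_cong) (rule dual_ker_theta[OF \<kappa>])
    then show "op N (dual_ker N \<kappa> (ker_diag (\<lambda>x. theta N (hamm N x \<kappa>)))) \<in> S"
      using A by simp
  qed (rule hamm_le)
  have idem_in: "idem_star N \<kappa> i \<in> S" for i
    unfolding idem_star_op[OF \<kappa>] by (rule diag[of "\<lambda>j. if j = i then 1 else 0"])
  have Ah_in: "Ah N h \<in> S" for h
  proof -
    let ?A = "\<lambda>y z. if hamm N y z = h then 1 else (0::complex)"
    \<comment> \<open>\<open>a x\<close> is the eigenvalue of \<open>Ah N h\<close> at the character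
      \<open>x\<close>. The dual of an invariant kernel is invariant, so this eigenvalue is a
      function \<open>c\<close> of the distance to \<kappa>, as the interpolation requires.\<close>
    define a where "a x = (\<Sum>u\<in>vertices N. if hamm N u \<kappa> = h then had N \<kappa> x u else 0)" for x
    have dA: "dist_inv N \<kappa> (dual_ker N \<kappa> ?A)"
      by (rule dist_inv_dual_ker[OF \<kappa> dist_inv_hamm_fun[OF \<kappa>, of "\<lambda>b i j. if b = h then 1 else 0"]])
    have a: "a x = dual_ker N \<kappa> ?A x x" if "x \<in> vertices N" for x
      unfolding dual_ker_Ah[OF \<kappa> that that] ker_diag_def a_def by simp
    have "\<exists>r. \<forall>x\<in>vertices N. hamm N x \<kappa> = i \<longrightarrow> a x = r" for i
    proof (cases "\<exists>x\<in>vertices N. hamm N x \<kappa> = i")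
      case True
      then obtain x where x: "x \<in> vertices N" "hamm N x \<kappa> = i" by blast
      have "a y = a x" if y: "y \<in> vertices N" "hamm N y \<kappa> = i" for y
        unfolding a[OF x(1)] a[OF y(1)]
        by (rule dist_inv_hamm[OF \<kappa> dA y(1) y(1) x(1) x(1)])
          (simp_all add: hamm_commute[of N \<kappa>] x y)
      then show ?thesis by blast
    qed blast
    then obtain c where c: "\<And>x i. x \<in> vertices N \<Longrightarrow> hamm N x \<kappa> = i \<Longrightarrow> a x = c i" by metis
    have "dual_ker N \<kappa> (ker_diag (\<lambda>x. c (hamm N x \<kappa>))) = dual_ker N \<kappa> (dual_ker N \<kappa> ?A)"
      by (rule dual_ker_cong[OF \<kappa>]) (simp add: dual_ker_Ah[OF \<kappa>] ker_diag_def c[OF _ refl, symmetric] a_def)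
    then have "op N (dual_ker N \<kappa> (ker_diag (\<lambda>x. c (hamm N x \<kappa>)))) = Ah N h"
      unfolding Ah_op by (simp only:) (rule op_cong, rule dual_ker_involution[OF \<kappa>])
    then show ?thesis using conj[of c] by simp
  qed
  obtain h i j where p: "p = (h, i, j)" by (cases p)
  show ?thesis
    unfolding p orbit_product[OF \<kappa>, symmetric] by (intro S_mult idem_in Ah_in)
qed

text \<open>The invariant operators form an algebra containing both generators. Conversely every
  subalgebra containing the generators contains all orbit kernels and hence their span, and
  \<open>T\<close> is the intersection of these subalgebras.\<close>

lemma T_eq_inv_ops: "T N \<kappa> = inv_ops N \<kappa>"
proof
  have "adjacency N \<in> inv_ops N \<kappa>"
    unfolding Ah_op by (rule inv_opsI[OF dist_inv_hamm_fun[OF \<kappa>, of "\<lambda>h i j. if h = 1 then 1 else 0"]])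
  moreover have "adjacency_star N \<kappa> \<in> inv_ops N \<kappa>"
    unfolding adjacency_star_op[OF \<kappa>] by (rule inv_opsI[OF dist_inv_ker_diag[OF \<kappa>]])
  ultimately show "T N \<kappa> \<subseteq> inv_ops N \<kappa>"
    unfolding T_def by (intro hull_minimal inv_ops_subalgebra) simp
  show "inv_ops N \<kappa> \<subseteq> T N \<kappa>"
    unfolding T_def hull_def
  proof (intro subsetI InterI)
    fix F S assume F: "F \<in> inv_ops N \<kappa>"
      and "S \<in> {t. unital_subalgebra N t \<and> {adjacency N, adjacency_star N \<kappa>} \<subseteq> t}"
    then have S: "unital_subalgebra N S" "adjacency N \<in> S" "adjacency_star N \<kappa> \<in> S" by simp_all
    obtain c where c: "F = (\<Sum>p\<in>P'' N. emul (c p) (op N (ker_orbit N \<kappa> p)))"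
      using inv_ops_orbit_span[OF \<kappa> F] by blast
    have lin: "linear_on emul emul S S id"
      using S(1) unfolding unital_subalgebra_def linear_on_def by simp
    have sub: "module.subspace emul S"
      using S(1) unfolding unital_subalgebra_def by blast
    show "F \<in> S"
      unfolding c
      by (rule conjunct1[OF linear_on_sum[OF vector_space_emul sub vector_space_emul lin finite_P''
          orbit_in_subalgebra[OF S]]])
  qed
qed

lemma T_op: "F \<in> T N \<kappa> \<Longrightarrow> \<exists>K. F = op N K \<and> dist_inv N \<kappa> K"
  unfolding T_eq_inv_ops inv_ops_def by blast

lemma T_ker: "F \<in> T N \<kappa> \<Longrightarrow> F = op N (ker F) \<and> dist_inv N \<kappa> (ker F)"
proof -
  assume "F \<in> T N \<kappa>"
  then obtain K where K: "F = op N K" "dist_inv N \<kappa> K" using T_op by blast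
  have "dist_inv N \<kappa> (ker F)"
    by (rule dist_inv_cong[OF _ K(2)]) (simp add: K(1) ker_op)
  moreover have "F = op N (ker F)" unfolding K(1) by (rule op_ker[OF op_Endo, symmetric])
  ultimately show ?thesis by blast
qed

lemma op_in_T: "dist_inv N \<kappa> K \<Longrightarrow> op N K \<in> T N \<kappa>"
  unfolding T_eq_inv_ops by (rule inv_opsI)

lemma subspace_T: "module.subspace emul (T N \<kappa>)"
  unfolding T_eq_inv_ops by (rule inv_ops_subspace)

text \<open>A single flip need not respect the stabilizer, but after dualizing the sum of flips is
  multiplication by \<open>theta\<close> of a distance, which does.\<close>

lemma dist_inv_ker_A:
  assumes "dist_inv N \<kappa> K"
  shows "dist_inv N \<kappa> (ker_A N k K)"
proof (rule dist_inv_cong)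
  fix y z assume yz: "y \<in> vertices N" "z \<in> vertices N"
  have "ker_A N k K y z = ker_A N k (dual_ker N \<kappa> (dual_ker N \<kappa> K)) y z"
    by (rule ker_A_cong[OF yz]) (simp add: dual_ker_involution[OF \<kappa>])
  then show "ker_A N k K y z = dual_ker N \<kappa> (\<lambda>u v. theta N (sel k (hamm N u v) (hamm N u \<kappa>) (hamm N v \<kappa>)) * dual_ker N \<kappa> K u v) y z"
    by (simp only: ker_A_dual_ker[OF \<kappa> yz])
next
  show "dist_inv N \<kappa> (dual_ker N \<kappa> (\<lambda>u v. theta N (sel k (hamm N u v) (hamm N u \<kappa>) (hamm N v \<kappa>)) * dual_ker N \<kappa> K u v))"
    by (intro dist_inv_dual_ker[OF \<kappa>] dist_inv_times assms dist_inv_hamm_fun[OF \<kappa>, of "\<lambda>h i j. theta N (sel k h i j)"])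
qed

lemma dist_inv_ker_A_star:
  assumes "dist_inv N \<kappa> K"
  shows "dist_inv N \<kappa> (ker_A_star N \<kappa> k K)"
  unfolding ker_A_star_def hamm_commute[of N \<kappa>]
  by (intro dist_inv_times assms dist_inv_hamm_fun[OF \<kappa>, of "\<lambda>h i j. theta N (sel k h j i)"])

lemma ker_A_op_Endo:
  assumes lin: "\<And>K L y z. \<Psi> (\<lambda>y z. K y z + L y z) y z = \<Psi> K y z + \<Psi> L y z"
      "\<And>c K y z. \<Psi> (\<lambda>y z. c * K y z) y z = c * \<Psi> K y z"
    and inv: "\<And>K. dist_inv N \<kappa> K \<Longrightarrow> dist_inv N \<kappa> (\<Psi> K)"
  shows "(\<lambda>F. if F \<in> T N \<kappa> then op N (\<Psi> (ker F)) else 0) \<in> Endo emul (T N \<kappa>)"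
proof -
  have T: "F + F' \<in> T N \<kappa>" "emul c F \<in> T N \<kappa>" if "F \<in> T N \<kappa>" "F' \<in> T N \<kappa>" for F F' c
    using subspace_T that unfolding subspace_emul_iff by blast+
  have "\<Psi> (ker (F + F')) = (\<lambda>y z. \<Psi> (ker F) y z + \<Psi> (ker F') y z)" for F F'
  proof -
    have "ker (F + F') = (\<lambda>y z. ker F y z + ker F' y z)" by (intro ext ker_add)
    then show ?thesis by (simp only:) (intro ext lin)
  qed
  moreover have "\<Psi> (ker (emul c F)) = (\<lambda>y z. c * \<Psi> (ker F) y z)" for c F
  proof -
    have "ker (emul c F) = (\<lambda>y z. c * ker F y z)" by (intro ext ker_emul)
    then show ?thesis by (simp only:) (intro ext lin)
  qed
  ultimately show ?thesis
    unfolding Endo_def linear_on_def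
    using T op_in_T inv T_ker by (simp add: op_add op_emul)
qed

text \<open>The sum of flips has the prescribed eigenvectors by \<open>ker_A_dual_ker\<close>, and
  the dual orbit kernels span \<open>T\<close>, so no other linear map qualifies.\<close>

lemma calA_op:
  assumes "F \<in> T N \<kappa>"
  shows "calA N \<kappa> k F = op N (ker_A N k (ker F))"
proof -
  let ?G = "\<lambda>F. if F \<in> T N \<kappa> then op N (ker_A N k (ker F)) else 0"
  let ?b = "\<lambda>p. op N (dual_ker N \<kappa> (ker_orbit N \<kappa> p))"
  have b: "?b p \<in> T N \<kappa>" for p
    by (intro op_in_T dist_inv_dual_ker[OF \<kappa>] dist_inv_orbit[OF \<kappa>])
  have G: "?G \<in> Endo emul (T N \<kappa>)"
    by (rule ker_A_op_Endo[OF _ _ dist_inv_ker_A])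
      (simp_all add: ker_A_def sel_def sum.distrib sum_distrib_left)
  have Gb: "?G (?b (h, i, j)) = emul (theta N (sel k h i j)) (?b (h, i, j))" for h i j
  proof -
    have "op N (ker_A N k (ker (?b (h, i, j)))) = op N (ker_A N k (dual_ker N \<kappa> (ker_orbit N \<kappa> (h, i, j))))"
      by (intro op_cong ker_A_cong) (simp_all add: ker_op)
    also have "\<dots> = op N (dual_ker N \<kappa> (\<lambda>u v. theta N (sel k (hamm N u v) (hamm N u \<kappa>) (hamm N v \<kappa>)) *
        ker_orbit N \<kappa> (h, i, j) u v))"
      by (rule op_cong) (rule ker_A_dual_ker[OF \<kappa>])
    also have "(\<lambda>u v. theta N (sel k (hamm N u v) (hamm N u \<kappa>) (hamm N v \<kappa>)) * ker_orbit N \<kappa> (h, i, j) u v) =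
        (\<lambda>u v. theta N (sel k h i j) * ker_orbit N \<kappa> (h, i, j) u v)"
      by (simp add: ker_orbit_def fun_eq_iff)
    finally show ?thesis using b by (simp add: dual_ker_scale[OF \<kappa>] op_emul)
  qed
  have "calA N \<kappa> k = ?G"
    unfolding calA_def orbit_product_dual[OF \<kappa>]
  proof (rule the_equality)
    show "?G \<in> Endo emul (T N \<kappa>) \<and> (\<forall>(h, i, j)\<in>P'' N. ?G (?b (h, i, j)) = emul (theta N (sel k h i j)) (?b (h, i, j)))"
      using G Gb by blast
    fix G' assume G': "G' \<in> Endo emul (T N \<kappa>) \<and> (\<forall>(h, i, j)\<in>P'' N. G' (?b (h, i, j)) = emul (theta N (sel k h i j)) (?b (h, i, j)))"
    show "G' = ?G"
    proof (rule Endo_eqI[OF vector_space_emul subspace_T _ G finite_P'' b])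
      show "G' \<in> Endo emul (T N \<kappa>)" using G' by blast
      show "\<exists>c. F = (\<Sum>p\<in>P'' N. emul (c p) (?b p))" if "F \<in> T N \<kappa>" for F
        using that inv_ops_dual_span[OF \<kappa>] unfolding T_eq_inv_ops by blast
      show "G' (?b p) = ?G (?b p)" if "p \<in> P'' N" for p
      proof -
        obtain h i j where p: "p = (h, i, j)" by (cases p)
        show ?thesis using G' that Gb[of h i j] unfolding p by auto
      qed
    qed
  qed
  then show ?thesis using assms by simp
qed

text \<open>In an orbit kernel \<open>i\<close> is the distance from \<kappa> to the row vertex and
  \<open>j\<close> the distance to the column vertex. The second multiplier reads the column, hence
  the eigenvalue order \<open>h j i\<close>.\<close>

lemma calA_star_op:
  assumes "F \<in> T N \<kappa>"
  shows "calA_star N \<kappa> k F = op N (ker_A_star N \<kappa> k (ker F))"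
proof -
  let ?G = "\<lambda>F. if F \<in> T N \<kappa> then op N (ker_A_star N \<kappa> k (ker F)) else 0"
  let ?b = "\<lambda>p. op N (ker_orbit N \<kappa> p)"
  have b: "?b p \<in> T N \<kappa>" for p
    by (intro op_in_T dist_inv_orbit[OF \<kappa>])
  have G: "?G \<in> Endo emul (T N \<kappa>)"
    by (rule ker_A_op_Endo[OF _ _ dist_inv_ker_A_star])
      (simp_all add: ker_A_star_def algebra_simps)
  have Gb: "?G (?b (h, i, j)) = emul (theta N (sel k h j i)) (?b (h, i, j))" for h i j
  proof -
    have "op N (ker_A_star N \<kappa> k (ker (?b (h, i, j)))) = op N (\<lambda>u v. theta N (sel k h j i) * ker_orbit N \<kappa> (h, i, j) u v)"
      by (rule op_cong) (simp add: ker_A_star_def ker_op ker_orbit_def hamm_commute[of N \<kappa>])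
    then show ?thesis using b by (simp add: op_emul)
  qed
  have "calA_star N \<kappa> k = ?G"
    unfolding calA_star_def orbit_product[OF \<kappa>]
  proof (rule the_equality)
    show "?G \<in> Endo emul (T N \<kappa>) \<and> (\<forall>(h, i, j)\<in>P'' N. ?G (?b (h, i, j)) = emul (theta N (sel k h j i)) (?b (h, i, j)))"
      using G Gb by blast
    fix G' assume G': "G' \<in> Endo emul (T N \<kappa>) \<and> (\<forall>(h, i, j)\<in>P'' N. G' (?b (h, i, j)) = emul (theta N (sel k h j i)) (?b (h, i, j)))"
    show "G' = ?G"
    proof (rule Endo_eqI[OF vector_space_emul subspace_T _ G finite_P'' b])
      show "G' \<in> Endo emul (T N \<kappa>)" using G' by blast
      show "\<exists>c. F = (\<Sum>p\<in>P'' N. emul (c p) (?b p))" if "F \<in> T N \<kappa>" for F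
        using that inv_ops_orbit_span[OF \<kappa>] unfolding T_eq_inv_ops by blast
      show "G' (?b p) = ?G (?b p)" if "p \<in> P'' N" for p
      proof -
        obtain h i j where p: "p = (h, i, j)" by (cases p)
        show ?thesis using G' that Gb[of h i j] unfolding p by auto
      qed
    qed
  qed
  then show ?thesis using assms by simp
qed

end


section \<open>Modules\<close>

lemma sl4_module_linear:
  assumes "sl4_module s W \<rho>" "M \<in> sl4"
  shows "linear_on s s W W (\<rho> M)"
  using assms unfolding sl4_module_def by blast

lemma sl4_module_in: "sl4_module s W \<rho> \<Longrightarrow> M \<in> sl4 \<Longrightarrow> w \<in> W \<Longrightarrow> \<rho> M w \<in> W"
  using sl4_module_linear unfolding linear_on_def by blast

lemma subspace_diff_in:
  assumes "vector_space s" "module.subspace s U" "a \<in> U" "b \<in> U"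
  shows "a - b \<in> U"
proof -
  interpret vector_space s by fact
  show ?thesis using assms(2-4) by (rule subspace_diff)
qed

lemma linear_on_diff:
  assumes "vector_space s" "module.subspace s U" "linear_on s s' U W f" "a \<in> U" "b \<in> U"
  shows "f (a - b) = f a - f b"
proof -
  have "f ((a - b) + b) = f (a - b) + f b"
    using assms(3,5) subspace_diff_in[OF assms(1,2,4,5)] unfolding linear_on_def by blast
  then show ?thesis by simp
qed

text \<open>Each law is checked after applying the injective map \<open>f\<close>, where it becomes
  the corresponding law in \<open>W\<close>.\<close>

lemma sl4_module_transport:
  assumes mod: "sl4_module s' W \<rho>" and vs: "vector_space s" and sub: "module.subspace s U"
    and lin: "linear_on s s' U W f" and bij: "bij_betw f U W"
  shows "sl4_module s U (\<lambda>M u. inv_into U f (\<rho> M (f u)))"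
proof -
  let ?e = "inv_into U f"
  have fU: "f u \<in> W" if "u \<in> U" for u using lin that unfolding linear_on_def by blast
  have fadd: "f (u + v) = f u + f v" if "u \<in> U" "v \<in> U" for u v
    using lin that unfolding linear_on_def by blast
  have fscale: "f (s c u) = s' c (f u)" if "u \<in> U" for c u
    using lin that unfolding linear_on_def by blast
  have eW: "?e w \<in> U" and fe: "f (?e w) = w" if "w \<in> W" for w
    using bij that by (auto simp: bij_betw_def inv_into_into f_inv_into_f)
  have inj: "u = v" if "f u = f v" "u \<in> U" "v \<in> U" for u v
    using bij that unfolding bij_betw_def inj_on_def by blast
  have Uadd: "u + v \<in> U" and Uscale: "s c u \<in> U" if "u \<in> U" "v \<in> U" for u v c
    using sub that unfolding subspace_iff[OF vs] by blast+
  have rW: "\<rho> M (f u) \<in> W" if "M \<in> sl4" "u \<in> U" for M u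
    using sl4_module_in[OF mod that(1) fU[OF that(2)]] .
  have rU: "?e (\<rho> M (f u)) \<in> U" and fr: "f (?e (\<rho> M (f u))) = \<rho> M (f u)"
    if "M \<in> sl4" "u \<in> U" for M u
    using eW fe rW[OF that] by blast+
  have radd: "\<rho> M (w + w') = \<rho> M w + \<rho> M w'" and rscale: "\<rho> M (s' c w) = s' c (\<rho> M w)"
    if "M \<in> sl4" "w \<in> W" "w' \<in> W" for M w w' c
    using sl4_module_linear[OF mod that(1)] that unfolding linear_on_def by blast+
  have laws: "\<rho> (M + M') w = \<rho> M w + \<rho> M' w" "\<rho> (mscale c M) w = s' c (\<rho> M w)"
      "\<rho> (bracket M M') w = \<rho> M (\<rho> M' w) - \<rho> M' (\<rho> M w)"
    if "M \<in> sl4" "M' \<in> sl4" "w \<in> W" for M M' w c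
    using mod that unfolding sl4_module_def by blast+
  show ?thesis
    unfolding sl4_module_def
  proof (intro conjI ballI allI vs sub)
    fix M :: mat4 assume M: "M \<in> sl4"
    show "linear_on s s U U (\<lambda>u. ?e (\<rho> M (f u)))"
      unfolding linear_on_def
    proof (intro conjI ballI allI)
      fix u v assume u: "u \<in> U" and v: "v \<in> U"
      have "f (?e (\<rho> M (f (u + v)))) = f (?e (\<rho> M (f u)) + ?e (\<rho> M (f v)))"
        unfolding fr[OF M Uadd[OF u v]] fadd[OF rU[OF M u] rU[OF M v]] fr[OF M u] fr[OF M v]
        unfolding fadd[OF u v] radd[OF M fU[OF u] fU[OF v]] ..
      then show "?e (\<rho> M (f (u + v))) = ?e (\<rho> M (f u)) + ?e (\<rho> M (f v))"
        by (rule inj) (intro rU Uadd M u v)+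
    next
      fix c u assume u: "u \<in> U"
      have "f (?e (\<rho> M (f (s c u)))) = f (s c (?e (\<rho> M (f u))))"
        unfolding fr[OF M Uscale[OF u u]] fscale[OF rU[OF M u]] fr[OF M u]
        unfolding fscale[OF u] rscale[OF M fU[OF u] fU[OF u]] ..
      then show "?e (\<rho> M (f (s c u))) = s c (?e (\<rho> M (f u)))"
        by (rule inj) (intro rU[OF M] Uscale[OF _ u] u)+
    qed (rule rU[OF M])
  next
    fix M M' :: mat4 and u assume M: "M \<in> sl4" "M' \<in> sl4" and u: "u \<in> U"
    have "f (?e (\<rho> (M + M') (f u))) = f (?e (\<rho> M (f u)) + ?e (\<rho> M' (f u)))"
      unfolding fr[OF sl4_add[OF M] u] fadd[OF rU[OF M(1) u] rU[OF M(2) u]] fr[OF M(1) u] fr[OF M(2) u]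
      by (rule laws(1)[OF M fU[OF u]])
    then show "?e (\<rho> (M + M') (f u)) = ?e (\<rho> M (f u)) + ?e (\<rho> M' (f u))"
      by (rule inj) (intro rU Uadd sl4_add M u)+
    have in_U: "?e (\<rho> M (f (?e (\<rho> M' (f u))))) \<in> U" "?e (\<rho> M' (f (?e (\<rho> M (f u))))) \<in> U"
      by (intro rU M u)+
    have "f (?e (\<rho> (bracket M M') (f u))) =
        f (?e (\<rho> M (f (?e (\<rho> M' (f u))))) - ?e (\<rho> M' (f (?e (\<rho> M (f u))))))"
      unfolding linear_on_diff[OF vs sub lin in_U]
      unfolding fr[OF sl4_bracket u] fr[OF M(1) rU[OF M(2) u]] fr[OF M(2) rU[OF M(1) u]]
      unfolding fr[OF M(1) u] fr[OF M(2) u]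
      by (rule laws(3)[OF M fU[OF u]])
    then show "?e (\<rho> (bracket M M') (f u)) =
        ?e (\<rho> M (f (?e (\<rho> M' (f u))))) - ?e (\<rho> M' (f (?e (\<rho> M (f u)))))"
      by (rule inj[OF _ rU[OF sl4_bracket u] subspace_diff_in[OF vs sub in_U]])
  next
    fix c and M :: mat4 and u assume M: "M \<in> sl4" and u: "u \<in> U"
    have "f (?e (\<rho> (mscale c M) (f u))) = f (s c (?e (\<rho> M (f u))))"
      unfolding fr[OF sl4_mscale[OF M] u] fscale[OF rU[OF M u]] fr[OF M u]
      by (rule laws(2)[OF M M fU[OF u]])
    then show "?e (\<rho> (mscale c M) (f u)) = s c (?e (\<rho> M (f u)))"
      by (rule inj[OF _ rU[OF sl4_mscale[OF M] u] Uscale[OF rU[OF M u] u]])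
  qed
qed

text \<open>The matrices whose actions commute with \<open>f\<close> are closed under sums,
  multiples and brackets. The two actions are arbitrary apart from their values on the generators,
  so the conclusion holds for every choice of module structure.\<close>

lemma sl4_module_intertwine:
  assumes \<sigma>: "sl4_module_on_which s U P Q \<sigma>" and \<rho>: "sl4_module_on_which s' W P' Q' \<rho>"
    and lin: "linear_on s s' U W f"
    and gens: "\<And>k u. u \<in> U \<Longrightarrow> f (P k u) = P' k (f u)" "\<And>k u. u \<in> U \<Longrightarrow> f (Q k u) = Q' k (f u)"
    and "M \<in> sl4"
  shows "\<forall>u\<in>U. f (\<sigma> M u) = \<rho> M (f u)"
  using \<open>M \<in> sl4\<close>
proof (induction rule: sl4_induct)
  have mod: "sl4_module s U \<sigma>" "sl4_module s' W \<rho>"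
    using \<sigma> \<rho> unfolding sl4_module_on_which_def by blast+
  have vs: "vector_space s" and sub: "module.subspace s U"
    using mod(1) unfolding sl4_module_def by blast+
  have fU: "f u \<in> W" if "u \<in> U" for u using lin that unfolding linear_on_def by blast
  have fadd: "f (u + v) = f u + f v" if "u \<in> U" "v \<in> U" for u v
    using lin that unfolding linear_on_def by blast
  have fscale: "f (s c u) = s' c (f u)" if "u \<in> U" for c u
    using lin that unfolding linear_on_def by blast
  have laws1: "\<sigma> (M + M') u = \<sigma> M u + \<sigma> M' u" "\<sigma> (mscale c M) u = s c (\<sigma> M u)"
      "\<sigma> (bracket M M') u = \<sigma> M (\<sigma> M' u) - \<sigma> M' (\<sigma> M u)"
    if "M \<in> sl4" "M' \<in> sl4" "u \<in> U" for M M' u c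
    using mod(1) that unfolding sl4_module_def by blast+
  have laws2: "\<rho> (M + M') w = \<rho> M w + \<rho> M' w" "\<rho> (mscale c M) w = s' c (\<rho> M w)"
      "\<rho> (bracket M M') w = \<rho> M (\<rho> M' w) - \<rho> M' (\<rho> M w)"
    if "M \<in> sl4" "M' \<in> sl4" "w \<in> W" for M M' w c
    using mod(2) that unfolding sl4_module_def by blast+
  note sU = sl4_module_in[OF mod(1)]
  {
    case (gen k)
    have "\<sigma> (gen k) u = P k u" if "u \<in> U" for u
      using \<sigma> gen that unfolding sl4_module_on_which_def by blast
    moreover have "\<rho> (gen k) w = P' k w" if "w \<in> W" for w
      using \<rho> gen that unfolding sl4_module_on_which_def by blast
    ultimately show ?case using gens(1) fU by simp
  next
    case (gen_star k)
    have "\<sigma> (gen_star k) u = Q k u" if "u \<in> U" for u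
      using \<sigma> gen_star that unfolding sl4_module_on_which_def by blast
    moreover have "\<rho> (gen_star k) w = Q' k w" if "w \<in> W" for w
      using \<rho> gen_star that unfolding sl4_module_on_which_def by blast
    ultimately show ?case using gens(2) fU by simp
  next
    case (add M M')
    then show ?case using laws1(1) laws2(1) fU fadd sU by simp
  next
    case (mscale c M)
    then show ?case using laws1(2)[OF _ mscale(1)] laws2(2)[OF _ mscale(1)] fU fscale sU by simp
  next
    case (bracket M M')
    then show ?case using laws1(3) laws2(3) fU linear_on_diff[OF vs sub lin] sU by simp
  }
qed

section \<open>The matrix action on the subconstituent algebra\<close>

context
  fixes N :: nat and \<kappa> :: vertex
  assumes \<kappa>: "\<kappa> \<in> vertices N"
begin

text \<open>For the generators the action is by flips or distances. A bracket acts as a commutator,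
  where the hypothesis is applied to kernels that have already been acted on, so \<open>K\<close>
  must stay arbitrary in the induction.\<close>

lemma dist_inv_mat_act:
  assumes "M \<in> sl4" "dist_inv N \<kappa> K"
  shows "dist_inv N \<kappa> (mat_act N \<kappa> M K)"
  using assms
proof (induction arbitrary: K rule: sl4_induct)
  case (gen k)
  show ?case
    by (rule dist_inv_cong[OF mat_act_gen[OF \<kappa>] dist_inv_ker_A[OF \<kappa> gen(2)]])
next
  case (gen_star k)
  show ?case
    by (rule dist_inv_cong[OF mat_act_gen_star[OF \<kappa>] dist_inv_ker_A_star[OF \<kappa> gen_star(2)]])
next
  case (add M M')
  show ?case
    by (rule dist_inv_cong[OF mat_act_add_left dist_inv_add[OF add.IH(1)[OF add.prems] add.IH(2)[OF add.prems]]])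
next
  case (mscale c M)
  show ?case
    by (rule dist_inv_cong[OF mat_act_mscale dist_inv_times[OF dist_inv_const mscale.IH[OF mscale.prems]]])
next
  case (bracket M M')
  show ?case
    by (rule dist_inv_cong[OF mat_act_bracket[OF \<kappa>]
      dist_inv_diff[OF bracket.IH(1)[OF bracket.IH(2)[OF bracket.prems]] bracket.IH(2)[OF bracket.IH(1)[OF bracket.prems]]]])
qed

lemma T_module:
  "sl4_module_on_which emul (T N \<kappa>) (calA N \<kappa>) (calA_star N \<kappa>) (\<lambda>M F. op N (mat_act N \<kappa> M (ker F)))"
proof -
  have "sl4_module emul (T N \<kappa>) (\<lambda>M F. op N (mat_act N \<kappa> M (ker F)))"
    unfolding sl4_module_def linear_on_def
  proof (intro conjI ballI allI vector_space_emul subspace_T[OF \<kappa>])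
    fix M F assume "M \<in> sl4" "F \<in> T N \<kappa>"
    then show "op N (mat_act N \<kappa> M (ker F)) \<in> T N \<kappa>"
      using T_ker[OF \<kappa>] by (intro op_in_T[OF \<kappa>] dist_inv_mat_act) blast+
  next
    fix M and F F' :: "cvec \<Rightarrow> cvec"
    have "ker (F + F') = (\<lambda>y z. ker F y z + ker F' y z)" by (intro ext ker_add)
    then show "op N (mat_act N \<kappa> M (ker (F + F'))) = op N (mat_act N \<kappa> M (ker F)) + op N (mat_act N \<kappa> M (ker F'))"
      unfolding op_add by (simp only:) (rule op_cong, rule mat_act_add)
  next
    fix M c and F :: "cvec \<Rightarrow> cvec"
    have "ker (emul c F) = (\<lambda>y z. c * ker F y z)" by (intro ext ker_emul)
    then show "op N (mat_act N \<kappa> M (ker (emul c F))) = emul c (op N (mat_act N \<kappa> M (ker F)))"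
      unfolding op_emul by (simp only:) (rule op_cong, rule mat_act_scale)
  next
    fix M M' and F :: "cvec \<Rightarrow> cvec"
    show "op N (mat_act N \<kappa> (M + M') (ker F)) = op N (mat_act N \<kappa> M (ker F)) + op N (mat_act N \<kappa> M' (ker F))"
      unfolding op_add by (rule op_cong) (rule mat_act_add_left)
  next
    fix c M and F :: "cvec \<Rightarrow> cvec"
    show "op N (mat_act N \<kappa> (mscale c M) (ker F)) = emul c (op N (mat_act N \<kappa> M (ker F)))"
      unfolding op_emul by (rule op_cong) (rule mat_act_mscale)
  next
    fix M M' and F :: "cvec \<Rightarrow> cvec"
    \<comment> \<open>Reading the kernel back from an operator recovers it on vertices only;
      \<open>mat_act_cong\<close> shows that the action sees no other values.\<close>
    have *: "op N (mat_act N \<kappa> M (ker (op N (mat_act N \<kappa> M' (ker F))))) = op N (mat_act N \<kappa> M (mat_act N \<kappa> M' (ker F)))"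
      for M M'
      by (rule op_cong, rule mat_act_cong[OF \<kappa>], assumption, assumption, rule ker_op)
    show "op N (mat_act N \<kappa> (bracket M M') (ker F)) =
        op N (mat_act N \<kappa> M (ker (op N (mat_act N \<kappa> M' (ker F))))) -
        op N (mat_act N \<kappa> M' (ker (op N (mat_act N \<kappa> M (ker F)))))"
      unfolding * op_diff by (rule op_cong) (rule mat_act_bracket[OF \<kappa>])
  qed
  moreover have "op N (mat_act N \<kappa> (gen k) (ker F)) = calA N \<kappa> k F"
    "op N (mat_act N \<kappa> (gen_star k) (ker F)) = calA_star N \<kappa> k F" if "F \<in> T N \<kappa>" for k F
    unfolding calA_op[OF \<kappa> that] calA_star_op[OF \<kappa> that]
    by (rule op_cong, rule mat_act_gen[OF \<kappa>], assumption+)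
      (rule op_cong, rule mat_act_gen_star[OF \<kappa>], assumption+)
  ultimately show ?thesis unfolding sl4_module_on_which_def by blast
qed

end


section \<open>Fixed tensors\<close>

lemma V3_iff: "f \<in> V3 N \<longleftrightarrow> (\<forall>t. t \<notin> triples N \<longrightarrow> f t = 0)"
  by (simp add: V3_def free_space_def)

lemma btensor_apply: "btensor x y z (a, b, c) = (if a = x \<and> b = y \<and> c = z then 1 else 0)"
  by (simp add: tensor3_def basis_vec_def)

lemma lin_ext_apply:
  assumes "f \<in> V3 N"
  shows "lin_ext smul (triples N) g f t = (\<Sum>s\<in>triples N. f s * g s t)"
  using assms by (simp add: lin_ext_def V3_def sum_fun_apply smul_def)

lemma sum_triples: "(\<Sum>s\<in>triples N. \<phi> s) = (\<Sum>a\<in>vertices N. \<Sum>b\<in>vertices N. \<Sum>c\<in>vertices N. \<phi> (a, b, c))"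
  by (simp add: sum.cartesian_product)

lemma act3_apply:
  assumes f: "f \<in> V3 N" and g: "g \<in> Aut N" and xyz: "x \<in> vertices N" "y \<in> vertices N" "z \<in> vertices N"
  shows "act3 N g f (g x, g y, g z) = f (x, y, z)"
proof -
  have inj: "g a = g b \<longleftrightarrow> a = b" for a b
    using permutes_inj[OF Aut_permutes[OF g]] by (rule inj_eq)
  have "act3 N g f (g x, g y, g z) =
      (\<Sum>s\<in>triples N. f s * (\<lambda>(a, b, c). btensor (g a) (g b) (g c)) s (g x, g y, g z))"
    unfolding act3_def by (rule lin_ext_apply[OF f])
  also have "\<dots> = (\<Sum>s\<in>triples N. if s = (x, y, z) then f s else 0)"
    by (intro sum.cong refl) (auto simp: btensor_apply inj split: if_splits)
  also have "\<dots> = f (x, y, z)" using xyz by simp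
  finally show ?thesis .
qed

lemma act3_outside:
  assumes f: "f \<in> V3 N" and g: "g \<in> Aut N" and t: "t \<notin> triples N"
  shows "act3 N g f t = 0"
proof -
  obtain x y z where t': "t = (x, y, z)" by (cases t)
  have "act3 N g f t = (\<Sum>s\<in>triples N. f s * (\<lambda>(a, b, c). btensor (g a) (g b) (g c)) s t)"
    unfolding act3_def by (rule lin_ext_apply[OF f])
  also have "\<dots> = 0"
  proof (rule sum.neutral, rule ballI)
    fix s assume "s \<in> triples N"
    then obtain a b c where s: "s = (a, b, c)" "a \<in> vertices N" "b \<in> vertices N" "c \<in> vertices N" by blast
    have neg: "\<not> (x = g a \<and> y = g b \<and> z = g c)"
      using t Aut_in[OF g s(2)] Aut_in[OF g s(3)] Aut_in[OF g s(4)] unfolding t' by blast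
    show "f s * (\<lambda>(a, b, c). btensor (g a) (g b) (g c)) s t = 0"
      unfolding s(1) t' prod.case btensor_apply if_not_P[OF neg] by (rule mult_zero_right)
  qed
  finally show ?thesis .
qed

text \<open>\<open>act3\<close> moves basis tensors forward, so its value at the image of a triple
  is the old value at that triple; surjectivity of \<open>g\<close> covers all triples.\<close>

lemma Fix_iff:
  "f \<in> Fix N \<longleftrightarrow> f \<in> V3 N \<and> (\<forall>g\<in>Aut N. \<forall>x\<in>vertices N. \<forall>y\<in>vertices N. \<forall>z\<in>vertices N.
     f (g x, g y, g z) = f (x, y, z))"
proof (intro iffI conjI ballI)
  assume f: "f \<in> Fix N"
  then show V: "f \<in> V3 N" unfolding Fix_def by blast
  fix g x y z assume g: "g \<in> Aut N" and "x \<in> vertices N" "y \<in> vertices N" "z \<in> vertices N"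
  then have "act3 N g f (g x, g y, g z) = f (x, y, z)" by (rule act3_apply[OF V])
  moreover have "act3 N g f = f" using f g unfolding Fix_def by blast
  ultimately show "f (g x, g y, g z) = f (x, y, z)" by simp
next
  assume f: "f \<in> V3 N \<and> (\<forall>g\<in>Aut N. \<forall>x\<in>vertices N. \<forall>y\<in>vertices N. \<forall>z\<in>vertices N.
     f (g x, g y, g z) = f (x, y, z))"
  have "act3 N g f = f" if g: "g \<in> Aut N" for g
  proof
    fix t
    show "act3 N g f t = f t"
    proof (cases "t \<in> triples N")
      case True
      have surj: "\<exists>a\<in>vertices N. x = g a" if "x \<in> vertices N" for x
        using bij_betw_imp_surj_on[OF Aut_bij[OF g]] that by blast
      obtain x y z where t: "t = (x, y, z)" "x \<in> vertices N" "y \<in> vertices N" "z \<in> vertices N"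
        using True by blast
      obtain a b c where abc: "a \<in> vertices N" "b \<in> vertices N" "c \<in> vertices N" "x = g a" "y = g b" "z = g c"
        using surj[OF t(2)] surj[OF t(3)] surj[OF t(4)] by blast
      have "act3 N g f t = f (a, b, c)"
        unfolding t(1) abc(4-6) using f abc by (intro act3_apply g) blast+
      also have "\<dots> = f t" unfolding t(1) abc(4-6) using f g abc(1-3) by metis
      finally show ?thesis .
    next
      case False
      then show ?thesis using act3_outside[OF _ g False] f V3_iff by metis
    qed
  qed
  then show "f \<in> Fix N" using f unfolding Fix_def by blast
qed

lemma Fix_V3: "f \<in> Fix N \<Longrightarrow> f \<in> V3 N"
  unfolding Fix_def by blast

lemma Fix_Aut: "f \<in> Fix N \<Longrightarrow> g \<in> Aut N \<Longrightarrow> x \<in> vertices N \<Longrightarrow> y \<in> vertices N \<Longrightarrow> z \<in> vertices N \<Longrightarrow>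
    f (g x, g y, g z) = f (x, y, z)"
  unfolding Fix_iff by blast

lemma Fix_hamm:
  assumes "f \<in> Fix N" "x \<in> vertices N" "y \<in> vertices N" "z \<in> vertices N"
    and "x' \<in> vertices N" "y' \<in> vertices N" "z' \<in> vertices N"
    and "hamm N x y = hamm N x' y'" "hamm N x z = hamm N x' z'" "hamm N y z = hamm N y' z'"
  shows "f (x, y, z) = f (x', y', z')"
proof -
  obtain g where g: "g \<in> Aut N" "g x = x'" "g y = y'" "g z = z'"
    using Aut_exists[OF assms(2-)] by blast
  show ?thesis using Fix_Aut[OF assms(1) g(1) assms(2-4)] unfolding g(2-4) by simp
qed

lemma subspace_Fix: "module.subspace smul (Fix N)"
  unfolding subspace_smul_iff
proof (intro conjI ballI allI)
  show "0 \<in> Fix N" unfolding Fix_iff V3_iff by simp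
next
  fix u v assume "u \<in> Fix N" "v \<in> Fix N"
  then show "u + v \<in> Fix N" unfolding Fix_iff V3_iff by simp
next
  fix c u assume "u \<in> Fix N"
  then show "smul c u \<in> Fix N" unfolding Fix_iff V3_iff smul_def by simp
qed

section \<open>The six tensor maps on fixed tensors\<close>

lemma sum_btensor_sphere:
  assumes "x \<in> vertices N" "a \<in> vertices N"
  shows "(\<Sum>\<xi>\<in>sphere_at N 1 a. if x = \<xi> then r else 0) = (if a \<in> sphere_at N 1 x then r else (0::complex))"
proof -
  have "finite (sphere_at N 1 a)" by (simp add: sphere_at_def)
  then have "(\<Sum>\<xi>\<in>sphere_at N 1 a. if x = \<xi> then r else 0) = (if x \<in> sphere_at N 1 a then r else 0)"
    by simp
  also have "x \<in> sphere_at N 1 a \<longleftrightarrow> a \<in> sphere_at N 1 x"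
    using assms by (simp add: sphere_at_def gdist_eq hamm_commute[of N a])
  finally show ?thesis .
qed

text \<open>The definition spreads a basis tensor over the neighbours; as adjacency is symmetric,
  the coefficient at a triple collects the values at its neighbours.\<close>

lemma A3_apply:
  assumes f: "f \<in> V3 N" and xyz: "x \<in> vertices N" "y \<in> vertices N" "z \<in> vertices N"
  shows "A3 N k f (x, y, z) = sel k
    (\<Sum>\<xi>\<in>sphere_at N 1 x. f (\<xi>, y, z)) (\<Sum>\<xi>\<in>sphere_at N 1 y. f (x, \<xi>, z)) (\<Sum>\<xi>\<in>sphere_at N 1 z. f (x, y, \<xi>))"
proof -
  let ?S = "sphere_at N 1"
  have sub: "?S x \<subseteq> vertices N" for x by (auto simp: sphere_at_def)
  have restr: "(\<Sum>a\<in>vertices N. if a \<in> ?S x then h a else 0) = (\<Sum>a\<in>?S x. h a)" for x and h :: "vertex \<Rightarrow> complex"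
    by (simp only: sum.inter_restrict[OF finite_vertices, symmetric] Int_absorb1[OF sub])
  have "A3 N k f (x, y, z) = (\<Sum>a\<in>vertices N. \<Sum>b\<in>vertices N. \<Sum>c\<in>vertices N. f (a, b, c) *
     (sel k (\<Sum>\<xi>\<in>?S a. btensor \<xi> b c) (\<Sum>\<xi>\<in>?S b. btensor a \<xi> c) (\<Sum>\<xi>\<in>?S c. btensor a b \<xi>)) (x, y, z))"
    unfolding A3_def lin_ext_apply[OF f] sum_triples prod.case ..
  \<comment> \<open>The conditions are nested with \<open>c\<close> outermost so that the sums over
    \<open>c\<close>, \<open>b\<close>, \<open>a\<close> collapse from the inside outwards.\<close>
  also have "\<dots> = (\<Sum>a\<in>vertices N. \<Sum>b\<in>vertices N. \<Sum>c\<in>vertices N.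
      sel k (if c = z then if b = y then if a \<in> ?S x then f (a, b, c) else 0 else 0 else 0)
        (if c = z then if b \<in> ?S y then if a = x then f (a, b, c) else 0 else 0 else 0)
        (if c \<in> ?S z then if b = y then if a = x then f (a, b, c) else 0 else 0 else 0))"
  proof (intro sum.cong refl)
    fix a b c assume abc: "a \<in> vertices N" "b \<in> vertices N" "c \<in> vertices N"
    have "(\<Sum>\<xi>\<in>?S a. btensor \<xi> b c) (x, y, z) = (if c = z \<and> b = y then \<Sum>\<xi>\<in>?S a. if x = \<xi> then 1 else 0 else 0)"
      "(\<Sum>\<xi>\<in>?S b. btensor a \<xi> c) (x, y, z) = (if c = z \<and> a = x then \<Sum>\<xi>\<in>?S b. if y = \<xi> then 1 else 0 else 0)"
      "(\<Sum>\<xi>\<in>?S c. btensor a b \<xi>) (x, y, z) = (if b = y \<and> a = x then \<Sum>\<xi>\<in>?S c. if z = \<xi> then 1 else 0 else 0)"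
      unfolding sum_fun_apply btensor_apply by (auto intro: sum.cong)
    note eqs = this[unfolded sum_btensor_sphere[OF xyz(1) abc(1)] sum_btensor_sphere[OF xyz(2) abc(2)]
        sum_btensor_sphere[OF xyz(3) abc(3)]]
    show "f (a, b, c) * (sel k (\<Sum>\<xi>\<in>?S a. btensor \<xi> b c) (\<Sum>\<xi>\<in>?S b. btensor a \<xi> c) (\<Sum>\<xi>\<in>?S c. btensor a b \<xi>)) (x, y, z) =
      sel k (if c = z then if b = y then if a \<in> ?S x then f (a, b, c) else 0 else 0 else 0)
        (if c = z then if b \<in> ?S y then if a = x then f (a, b, c) else 0 else 0 else 0)
        (if c \<in> ?S z then if b = y then if a = x then f (a, b, c) else 0 else 0 else 0)"
      unfolding sel_def using eqs by simp
  qed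
  also have "\<dots> = sel k (\<Sum>\<xi>\<in>?S x. f (\<xi>, y, z)) (\<Sum>\<xi>\<in>?S y. f (x, \<xi>, z)) (\<Sum>\<xi>\<in>?S z. f (x, y, \<xi>))"
  proof -
    have "(\<Sum>a\<in>vertices N. \<Sum>b\<in>vertices N. \<Sum>c\<in>vertices N.
        if c = z then if b = y then if a \<in> ?S x then f (a, b, c) else 0 else 0 else 0) = (\<Sum>\<xi>\<in>?S x. f (\<xi>, y, z))"
      using xyz by (simp add: restr[unfolded One_nat_def])
    moreover have "(\<Sum>a\<in>vertices N. \<Sum>b\<in>vertices N. \<Sum>c\<in>vertices N.
        if c = z then if b \<in> ?S y then if a = x then f (a, b, c) else 0 else 0 else 0) = (\<Sum>\<xi>\<in>?S y. f (x, \<xi>, z))"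
    proof -
      have "(\<Sum>b\<in>vertices N. \<Sum>c\<in>vertices N.
          if c = z then if b \<in> ?S y then if a = x then f (a, b, c) else 0 else 0 else 0) =
          (if a = x then \<Sum>\<xi>\<in>?S y. f (a, \<xi>, z) else 0)" for a
        using xyz by (cases "a = x") (simp_all add: restr[unfolded One_nat_def])
      then show ?thesis using xyz by simp
    qed
    moreover have "(\<Sum>a\<in>vertices N. \<Sum>b\<in>vertices N. \<Sum>c\<in>vertices N.
        if c \<in> ?S z then if b = y then if a = x then f (a, b, c) else 0 else 0 else 0) = (\<Sum>\<xi>\<in>?S z. f (x, y, \<xi>))"
    proof -
      have "(\<Sum>c\<in>vertices N. if c \<in> ?S z then if b = y then if a = x then f (a, b, c) else 0 else 0 else 0) =
          (if b = y then if a = x then \<Sum>\<xi>\<in>?S z. f (a, b, \<xi>) else 0 else 0)" for a b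
        unfolding restr by simp
      then show ?thesis using xyz by simp
    qed
    ultimately show ?thesis unfolding sel_def by simp
  qed
  finally show ?thesis .
qed

lemma A3_outside:
  assumes f: "f \<in> V3 N" and t: "t \<notin> triples N"
  shows "A3 N k f t = 0"
proof -
  obtain x y z where t': "t = (x, y, z)" by (cases t)
  have sph: "\<xi> \<in> vertices N" if "\<xi> \<in> sphere_at N 1 a" for \<xi> a using that by (simp add: sphere_at_def)
  have zero: "btensor a b c t = 0" if "a \<in> vertices N" "b \<in> vertices N" "c \<in> vertices N" for a b c
    using t that unfolding t' btensor_apply by auto
  have "A3 N k f t = (\<Sum>a\<in>vertices N. \<Sum>b\<in>vertices N. \<Sum>c\<in>vertices N. f (a, b, c) *
     (sel k (\<Sum>\<xi>\<in>sphere_at N 1 a. btensor \<xi> b c) (\<Sum>\<xi>\<in>sphere_at N 1 b. btensor a \<xi> c)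
       (\<Sum>\<xi>\<in>sphere_at N 1 c. btensor a b \<xi>)) t)"
    unfolding A3_def lin_ext_apply[OF f] sum_triples prod.case ..
  also have "\<dots> = 0"
    by (intro sum.neutral ballI) (simp add: sel_def sum_fun_apply zero sph)
  finally show ?thesis .
qed

lemma A3_star_apply:
  assumes f: "f \<in> V3 N" and xyz: "x \<in> vertices N" "y \<in> vertices N" "z \<in> vertices N"
  shows "A3_star N k f (x, y, z) = theta N (sel k (hamm N y z) (hamm N z x) (hamm N x y)) * f (x, y, z)"
proof -
  have "A3_star N k f (x, y, z) = (\<Sum>s\<in>triples N. f s * (\<lambda>(a, b, c).
      smul (theta N (sel k (gdist N b c) (gdist N c a) (gdist N a b))) (btensor a b c)) s (x, y, z))"
    unfolding A3_star_def by (rule lin_ext_apply[OF f])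
  also have "\<dots> = (\<Sum>s\<in>triples N. if s = (x, y, z) then
      theta N (sel k (hamm N y z) (hamm N z x) (hamm N x y)) * f s else 0)"
    by (intro sum.cong refl) (auto simp: btensor_apply smul_def gdist_eq split: if_splits)
  also have "\<dots> = theta N (sel k (hamm N y z) (hamm N z x) (hamm N x y)) * f (x, y, z)"
    using xyz by simp
  finally show ?thesis .
qed

lemma A3_star_outside:
  assumes f: "f \<in> V3 N" and t: "t \<notin> triples N"
  shows "A3_star N k f t = 0"
proof -
  obtain x y z where t': "t = (x, y, z)" by (cases t)
  have zero: "btensor a b c t = 0" if "(a, b, c) \<in> triples N" for a b c
    using t that unfolding t' btensor_apply by auto
  have "A3_star N k f t = (\<Sum>s\<in>triples N. f s * (\<lambda>(a, b, c).
      smul (theta N (sel k (gdist N b c) (gdist N c a) (gdist N a b))) (btensor a b c)) s t)"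
    unfolding A3_star_def by (rule lin_ext_apply[OF f])
  also have "\<dots> = 0"
    by (rule sum.neutral) (use zero in \<open>auto simp: smul_def\<close>)
  finally show ?thesis .
qed

lemma bij_sphere:
  assumes g: "g \<in> Aut N" and x: "x \<in> vertices N"
  shows "bij_betw g (sphere_at N 1 x) (sphere_at N 1 (g x))"
proof (rule bij_betw_imageI)
  show "inj_on g (sphere_at N 1 x)"
    using permutes_inj[OF Aut_permutes[OF g]] by (rule inj_on_subset) simp
  have sph: "g a \<in> sphere_at N 1 (g x) \<longleftrightarrow> a \<in> sphere_at N 1 x" if a: "a \<in> vertices N" for a
    using Aut_hamm[OF g x a] Aut_in[OF g x] Aut_in[OF g a] a x by (simp add: sphere_at_def gdist_eq)
  have "\<exists>a\<in>sphere_at N 1 x. b = g a" if b: "b \<in> sphere_at N 1 (g x)" for b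
  proof -
    have "b \<in> vertices N" using b by (simp add: sphere_at_def)
    then obtain a where "a \<in> vertices N" "b = g a"
      using bij_betw_imp_surj_on[OF Aut_bij[OF g]] by blast
    then show ?thesis using sph b by blast
  qed
  moreover have "g a \<in> sphere_at N 1 (g x)" if "a \<in> sphere_at N 1 x" for a
    using sph that by (simp add: sphere_at_def)
  ultimately show "g ` sphere_at N 1 x = sphere_at N 1 (g x)" by blast
qed

lemma A3_Fix:
  assumes f: "f \<in> Fix N"
  shows "A3 N k f \<in> Fix N"
  unfolding Fix_iff V3_iff
proof (intro conjI allI impI ballI)
  note fV = Fix_V3[OF f]
  show "A3 N k f t = 0" if "t \<notin> triples N" for t using A3_outside[OF fV that] .
  fix g x y z assume g: "g \<in> Aut N" and xyz: "x \<in> vertices N" "y \<in> vertices N" "z \<in> vertices N"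
  have "(\<Sum>\<xi>\<in>sphere_at N 1 (g x). f (\<xi>, g y, g z)) = (\<Sum>\<xi>\<in>sphere_at N 1 x. f (\<xi>, y, z))"
    unfolding sum.reindex_bij_betw[OF bij_sphere[OF g xyz(1)], symmetric]
    by (intro sum.cong refl Fix_Aut[OF f g _ xyz(2,3)]) (simp add: sphere_at_def)
  moreover have "(\<Sum>\<xi>\<in>sphere_at N 1 (g y). f (g x, \<xi>, g z)) = (\<Sum>\<xi>\<in>sphere_at N 1 y. f (x, \<xi>, z))"
    unfolding sum.reindex_bij_betw[OF bij_sphere[OF g xyz(2)], symmetric]
    by (intro sum.cong refl Fix_Aut[OF f g xyz(1) _ xyz(3)]) (simp add: sphere_at_def)
  moreover have "(\<Sum>\<xi>\<in>sphere_at N 1 (g z). f (g x, g y, \<xi>)) = (\<Sum>\<xi>\<in>sphere_at N 1 z. f (x, y, \<xi>))"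
    unfolding sum.reindex_bij_betw[OF bij_sphere[OF g xyz(3)], symmetric]
    by (intro sum.cong refl Fix_Aut[OF f g xyz(1,2)]) (simp add: sphere_at_def)
  ultimately show "A3 N k f (g x, g y, g z) = A3 N k f (x, y, z)"
    unfolding A3_apply[OF fV xyz] A3_apply[OF fV Aut_in[OF g xyz(1)] Aut_in[OF g xyz(2)] Aut_in[OF g xyz(3)]]
    by presburger
qed

lemma A3_star_Fix:
  assumes f: "f \<in> Fix N"
  shows "A3_star N k f \<in> Fix N"
  unfolding Fix_iff V3_iff
proof (intro conjI allI impI ballI)
  note fV = Fix_V3[OF f]
  show "A3_star N k f t = 0" if "t \<notin> triples N" for t using A3_star_outside[OF fV that] .
  fix g x y z assume g: "g \<in> Aut N" and xyz: "x \<in> vertices N" "y \<in> vertices N" "z \<in> vertices N"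
  show "A3_star N k f (g x, g y, g z) = A3_star N k f (x, y, z)"
    unfolding A3_star_apply[OF fV xyz] A3_star_apply[OF fV Aut_in[OF g xyz(1)] Aut_in[OF g xyz(2)] Aut_in[OF g xyz(3)]]
      Fix_Aut[OF f g xyz] Aut_hamm[OF g xyz(2,3)] Aut_hamm[OF g xyz(3,1)] Aut_hamm[OF g xyz(1,2)] ..
qed


section \<open>The isomorphism\<close>

lemma translate_self: "x \<in> vertices N \<Longrightarrow> z \<in> vertices N \<Longrightarrow> translate N z x x = z"
  using translate_same(2)[of x N z] by (simp add: translate_def mult_ac)

context
  fixes N :: nat and \<kappa> :: vertex
  assumes \<kappa>: "\<kappa> \<in> vertices N"
begin

abbreviation "eps_const \<equiv> complex_of_real (2 powr (real N / 2))"

lemma eps_Fix_op: "f \<in> Fix N \<Longrightarrow> eps N \<kappa> f = op N (\<lambda>y z. eps_const * f (\<kappa>, y, z))"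
  by (rule eps_op[OF Fix_V3 \<kappa>])

lemma dist_inv_Fix:
  assumes "f \<in> Fix N"
  shows "dist_inv N \<kappa> (\<lambda>y z. eps_const * f (\<kappa>, y, z))"
  unfolding dist_inv_def
proof (intro ballI impI)
  fix g y z assume "g \<in> Aut N" "g \<kappa> = \<kappa>" "y \<in> vertices N" "z \<in> vertices N"
  then show "eps_const * f (\<kappa>, g y, g z) = eps_const * f (\<kappa>, y, z)"
    using Fix_Aut[OF assms _ \<kappa>, of g y z] by simp
qed

lemma eps_linear: "linear_on smul emul (Fix N) (T N \<kappa>) (eps N \<kappa>)"
  unfolding linear_on_def
proof (intro conjI ballI allI)
  fix u assume u: "u \<in> Fix N"
  show "eps N \<kappa> u \<in> T N \<kappa>"
    unfolding eps_Fix_op[OF u] by (rule op_in_T[OF \<kappa> dist_inv_Fix[OF u]])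
  fix v assume v: "v \<in> Fix N"
  have uv: "u + v \<in> Fix N" using subspace_Fix u v unfolding subspace_smul_iff by blast
  show "eps N \<kappa> (u + v) = eps N \<kappa> u + eps N \<kappa> v"
    unfolding eps_Fix_op[OF u] eps_Fix_op[OF v] eps_Fix_op[OF uv] op_add
    by (rule op_cong) (simp add: distrib_left)
next
  fix c u assume u: "u \<in> Fix N"
  have cu: "smul c u \<in> Fix N" using subspace_Fix u unfolding subspace_smul_iff by blast
  show "eps N \<kappa> (smul c u) = emul c (eps N \<kappa> u)"
    unfolding eps_Fix_op[OF u] eps_Fix_op[OF cu] op_emul
    by (rule op_cong) (simp add: smul_def)
qed

lemma eps_inj: "inj_on (eps N \<kappa>) (Fix N)"
proof (rule inj_onI)
  fix f f' assume f: "f \<in> Fix N" and f': "f' \<in> Fix N" and eq: "eps N \<kappa> f = eps N \<kappa> f'"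
  have base: "f (\<kappa>, y, z) = f' (\<kappa>, y, z)" if "y \<in> vertices N" "z \<in> vertices N" for y z
  proof -
    have "eps_const * f (\<kappa>, y, z) = eps_const * f' (\<kappa>, y, z)"
      using eq that unfolding eps_Fix_op[OF f] eps_Fix_op[OF f'] op_eq_iff by blast
    then show ?thesis by simp
  qed
  show "f = f'"
  proof
    fix t
    show "f t = f' t"
    proof (cases "t \<in> triples N")
      case True
      then obtain x y z where t: "t = (x, y, z)" "x \<in> vertices N" "y \<in> vertices N" "z \<in> vertices N"
        by blast
      \<comment> \<open>Transitivity on vertices is the case of constant triples, whose distances
        are all 0.\<close>
      obtain g where g: "g \<in> Aut N" "g x = \<kappa>"
        using Aut_exists[OF t(2) t(2) t(2) \<kappa> \<kappa> \<kappa>] by auto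
      have "f t = f (g x, g y, g z)" "f' t = f' (g x, g y, g z)"
        unfolding t(1) using Fix_Aut[OF f g(1) t(2-4)] Fix_Aut[OF f' g(1) t(2-4)] by simp_all
      then show ?thesis
        unfolding g(2) using base[OF Aut_in[OF g(1) t(3)] Aut_in[OF g(1) t(4)]] by simp
    next
      case False
      then have "f t = 0" "f' t = 0" using Fix_V3[OF f] Fix_V3[OF f'] unfolding V3_iff by blast+
      then show ?thesis by simp
    qed
  qed
qed

lemma eps_surj:
  assumes F: "F \<in> T N \<kappa>"
  shows "\<exists>f\<in>Fix N. eps N \<kappa> f = F"
proof -
  obtain K where K: "F = op N K" "dist_inv N \<kappa> K" using T_op[OF \<kappa> F] by blast
  \<comment> \<open>The translation by \<kappa> and \<open>x\<close> carries \<open>x\<close> to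
    \<kappa>, so \<open>K\<close> can be evaluated at the translated \<open>y\<close> and
    \<open>z\<close>. Translations preserve distances, which makes \<open>f\<close> invariant;
    \<open>1 / eps_const\<close> undoes the scaling in \<open>eps\<close>.\<close>
  define f where "f = (\<lambda>(x, y, z). if (x, y, z) \<in> triples N
    then (1 / eps_const) * K (translate N \<kappa> x y) (translate N \<kappa> x z) else 0)"
  have "f \<in> Fix N"
    unfolding Fix_iff V3_iff
  proof (intro conjI allI impI ballI)
    show "f t = 0" if "t \<notin> triples N" for t
      using that by (cases t) (simp only: f_def prod.case if_False)
    fix g x y z assume g: "g \<in> Aut N" and x: "x \<in> vertices N" and y: "y \<in> vertices N" and z: "z \<in> vertices N"
    note gx = Aut_in[OF g x] and gy = Aut_in[OF g y] and gz = Aut_in[OF g z]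
    have base: "hamm N \<kappa> (translate N \<kappa> x w) = hamm N x w" if "x \<in> vertices N" for x w
      using hamm_translate[OF \<kappa> that, of x w] unfolding translate_self[OF that \<kappa>] .
    have "K (translate N \<kappa> (g x) (g y)) (translate N \<kappa> (g x) (g z)) = K (translate N \<kappa> x y) (translate N \<kappa> x z)"
    proof (rule dist_inv_hamm[OF \<kappa> K(2)])
      show "translate N \<kappa> (g x) (g y) \<in> vertices N" by (rule translate_in[OF \<kappa> gx gy])
      show "translate N \<kappa> (g x) (g z) \<in> vertices N" by (rule translate_in[OF \<kappa> gx gz])
      show "translate N \<kappa> x y \<in> vertices N" by (rule translate_in[OF \<kappa> x y])
      show "translate N \<kappa> x z \<in> vertices N" by (rule translate_in[OF \<kappa> x z])
      show "hamm N \<kappa> (translate N \<kappa> (g x) (g y)) = hamm N \<kappa> (translate N \<kappa> x y)"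
        unfolding base[OF gx] base[OF x] by (rule Aut_hamm[OF g x y])
      show "hamm N \<kappa> (translate N \<kappa> (g x) (g z)) = hamm N \<kappa> (translate N \<kappa> x z)"
        unfolding base[OF gx] base[OF x] by (rule Aut_hamm[OF g x z])
      show "hamm N (translate N \<kappa> (g x) (g y)) (translate N \<kappa> (g x) (g z)) =
          hamm N (translate N \<kappa> x y) (translate N \<kappa> x z)"
        unfolding hamm_translate[OF \<kappa> gx] hamm_translate[OF \<kappa> x] by (rule Aut_hamm[OF g y z])
    qed
    then show "f (g x, g y, g z) = f (x, y, z)"
      using x y z gx gy gz unfolding f_def by simp
  qed
  moreover have "eps N \<kappa> f = F"
    unfolding eps_Fix_op[OF \<open>f \<in> Fix N\<close>] K(1)
    by (rule op_cong) (simp add: f_def \<kappa> translate_same)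
  ultimately show ?thesis by blast
qed

lemma eps_bij: "bij_betw (eps N \<kappa>) (Fix N) (T N \<kappa>)"
proof (rule bij_betw_imageI[OF eps_inj])
  have "eps N \<kappa> f \<in> T N \<kappa>" if "f \<in> Fix N" for f
    using eps_linear that unfolding linear_on_def by blast
  then show "eps N \<kappa> ` Fix N = T N \<kappa>" using eps_surj by blast
qed

lemma ker_eps:
  "f \<in> Fix N \<Longrightarrow> y \<in> vertices N \<Longrightarrow> z \<in> vertices N \<Longrightarrow> ker (eps N \<kappa> f) y z = eps_const * f (\<kappa>, y, z)"
  by (simp only: eps_Fix_op ker_op)

lemma eps_in_T: "f \<in> Fix N \<Longrightarrow> eps N \<kappa> f \<in> T N \<kappa>"
  using eps_linear unfolding linear_on_def by blast

lemma eps_A3: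
  assumes f: "f \<in> Fix N"
  shows "eps N \<kappa> (A3 N k f) = calA N \<kappa> k (eps N \<kappa> f)"
  unfolding eps_Fix_op[OF A3_Fix[OF f]] calA_op[OF \<kappa> eps_in_T[OF f]]
proof (rule op_cong)
  fix y z assume y: "y \<in> vertices N" and z: "z \<in> vertices N"
  have flip: "f (flip i \<kappa>, y, z) = f (\<kappa>, flip i y, flip i z)" if i: "i < N" for i
  proof (rule Fix_hamm[OF f])
    show "hamm N (flip i \<kappa>) y = hamm N \<kappa> (flip i y)" by (rule hamm_flip_swap[OF \<kappa> y i])
    show "hamm N (flip i \<kappa>) z = hamm N \<kappa> (flip i z)" by (rule hamm_flip_swap[OF \<kappa> z i])
    show "hamm N y z = hamm N (flip i y) (flip i z)"
      unfolding hamm_flip_swap[OF y flip_in[OF z] i] flip_flip ..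
  qed (simp_all add: \<kappa> y z)
  have "A3 N k f (\<kappa>, y, z) = sel k (\<Sum>i<N. f (flip i \<kappa>, y, z)) (\<Sum>i<N. f (\<kappa>, flip i y, z)) (\<Sum>i<N. f (\<kappa>, y, flip i z))"
    unfolding A3_apply[OF Fix_V3[OF f] \<kappa> y z] sum_sphere_1[OF \<kappa>] sum_sphere_1[OF y] sum_sphere_1[OF z] ..
  also have "(\<Sum>i<N. f (flip i \<kappa>, y, z)) = (\<Sum>i<N. f (\<kappa>, flip i y, flip i z))"
    by (intro sum.cong refl flip) simp
  finally have "eps_const * A3 N k f (\<kappa>, y, z) = ker_A N k (\<lambda>y z. eps_const * f (\<kappa>, y, z)) y z"
    unfolding ker_A_def by (simp add: sel_def sum_distrib_left)
  also have "\<dots> = ker_A N k (ker (eps N \<kappa> f)) y z"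
    by (rule ker_A_cong[OF y z]) (rule ker_eps[OF f, symmetric])
  finally show "eps_const * A3 N k f (\<kappa>, y, z) = ker_A N k (ker (eps N \<kappa> f)) y z" .
qed

lemma eps_A3_star:
  assumes f: "f \<in> Fix N"
  shows "eps N \<kappa> (A3_star N k f) = calA_star N \<kappa> k (eps N \<kappa> f)"
  unfolding eps_Fix_op[OF A3_star_Fix[OF f]] calA_star_op[OF \<kappa> eps_in_T[OF f]]
proof (rule op_cong)
  fix y z assume y: "y \<in> vertices N" and z: "z \<in> vertices N"
  show "eps_const * A3_star N k f (\<kappa>, y, z) = ker_A_star N \<kappa> k (ker (eps N \<kappa> f)) y z"
    unfolding A3_star_apply[OF Fix_V3[OF f] \<kappa> y z] ker_A_star_def ker_eps[OF f y z]
    by (rule mult.left_commute)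
qed

text \<open>The action is transported from \<open>T\<close> along the bijection \<open>eps\<close>.
  The generators then act by the tensor maps because \<open>eps\<close> intertwines these with
  \<open>calA\<close> and \<open>calA_star\<close>, and the tensor maps preserve
  \<open>Fix N\<close>.\<close>

lemma Fix_module: "\<exists>\<sigma>. sl4_module_on_which smul (Fix N) (A3 N) (A3_star N) \<sigma>"
proof -
  let ?\<rho> = "\<lambda>M F. op N (mat_act N \<kappa> M (ker F))"
  let ?e = "inv_into (Fix N) (eps N \<kappa>)"
  have \<rho>: "sl4_module emul (T N \<kappa>) ?\<rho>"
    and gens: "\<And>k F. k \<in> {1, 2, 3} \<Longrightarrow> F \<in> T N \<kappa> \<Longrightarrow> ?\<rho> (gen k) F = calA N \<kappa> k F \<and> ?\<rho> (gen_star k) F = calA_star N \<kappa> k F"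
    using T_module[OF \<kappa>] unfolding sl4_module_on_which_def by blast+
  have "sl4_module smul (Fix N) (\<lambda>M f. ?e (?\<rho> M (eps N \<kappa> f)))"
    by (rule sl4_module_transport[OF \<rho> vector_space_smul subspace_Fix eps_linear eps_bij])
  moreover have "?e (?\<rho> (gen k) (eps N \<kappa> f)) = A3 N k f \<and> ?e (?\<rho> (gen_star k) (eps N \<kappa> f)) = A3_star N k f"
    if k: "k \<in> {1, 2, 3}" and f: "f \<in> Fix N" for k f
  proof -
    have "?\<rho> (gen k) (eps N \<kappa> f) = eps N \<kappa> (A3 N k f)" "?\<rho> (gen_star k) (eps N \<kappa> f) = eps N \<kappa> (A3_star N k f)"
      using gens[OF k eps_in_T[OF f]] unfolding eps_A3[OF f] eps_A3_star[OF f] by blast+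
    then show ?thesis
      by (simp only: inv_into_f_f[OF eps_inj A3_Fix[OF f]] inv_into_f_f[OF eps_inj A3_star_Fix[OF f]])
  qed
  ultimately have "sl4_module_on_which smul (Fix N) (A3 N) (A3_star N) (\<lambda>M f. ?e (?\<rho> M (eps N \<kappa> f)))"
    unfolding sl4_module_on_which_def by blast
  then show ?thesis by blast
qed

end

theorem theorem18p16:
  fixes N :: nat and \<kappa> :: vertex
  assumes "\<kappa> \<in> vertices N"
  shows "(\<exists>\<rho>. sl4_module_on_which emul (T N \<kappa>) (calA N \<kappa>) (calA_star N \<kappa>) \<rho>) \<and>
         (\<exists>\<sigma>. sl4_module_on_which smul (Fix N) (A3 N) (A3_star N) \<sigma>) \<and>
         (\<forall>\<rho> \<sigma>. sl4_module_on_which emul (T N \<kappa>) (calA N \<kappa>) (calA_star N \<kappa>) \<rho> \<longrightarrow>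
                 sl4_module_on_which smul (Fix N) (A3 N) (A3_star N) \<sigma> \<longrightarrow>
                 sl4_module_iso smul (Fix N) \<sigma> emul (T N \<kappa>) \<rho> (eps N \<kappa>))"
proof (intro conjI allI impI)
  show "\<exists>\<rho>. sl4_module_on_which emul (T N \<kappa>) (calA N \<kappa>) (calA_star N \<kappa>) \<rho>"
    using T_module[OF assms] by blast
  show "\<exists>\<sigma>. sl4_module_on_which smul (Fix N) (A3 N) (A3_star N) \<sigma>"
    by (rule Fix_module[OF assms])
  fix \<rho> \<sigma>
  assume \<rho>: "sl4_module_on_which emul (T N \<kappa>) (calA N \<kappa>) (calA_star N \<kappa>) \<rho>"
    and \<sigma>: "sl4_module_on_which smul (Fix N) (A3 N) (A3_star N) \<sigma>"
  have "\<forall>f\<in>Fix N. eps N \<kappa> (\<sigma> M f) = \<rho> M (eps N \<kappa> f)" if "M \<in> sl4" for M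
    by (rule sl4_module_intertwine[OF \<sigma> \<rho> eps_linear[OF assms]])
      (rule eps_A3[OF assms] eps_A3_star[OF assms] that, assumption?)+
  then show "sl4_module_iso smul (Fix N) \<sigma> emul (T N \<kappa>) \<rho> (eps N \<kappa>)"
    unfolding sl4_module_iso_def using eps_linear[OF assms] eps_bij[OF assms] by blast
qed

end
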